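(* In addition to the standing assumptions listed in the context, assume (H2): there exist constants $\theta_1\in(0,1)$ and $\theta_2$ such that $\min_{u\in\mathcal{U}(x)}c(x,u)\ge\theta_1V_\star(x)-\theta_2$ for all $x\in\mathbb{X}$. For $\Phi_0\in\mathcal{L}(\mathbb{X})\cap\mathcal{O}(V_\star)$ let $\Phi_{n+1}(x)=\min_{u\in\mathcal{U}(x)}[c(x,u)-\beta+\int\Phi_n(y)P(dy\,|\,x,u)]$, $n\ge0$, let $\hat v_n:\mathbb{X}\to\mathbb{U}$ be a measurable selector of the minimizer in this definition of $\Phi_{n+1}$, and let $N_0=N_0(\Phi_0)\in\mathbb{N}$ be such that $\hat v_n$ is stabilizing for all $n\ge N_0$ (such an $N_0$ exists under (H2)). Assume further: (a) The running cost $c$ is inf-compact on $\mathbb{K}$. (b) There exists $\psi\in\mathfrak{P}(\mathbb{X})$ such that under the stabilizing policies $\hat v_n$, $n\ge N_0$, the controlled chain is positive Harris recurrent and the corresponding invariant probability measures are absolutely continuous with respect to $\psi$. Then for every $\Phi_0\in\mathcal{L}(\mathbb{X})\cap\mathcal{O}(V_\star)$ the sequence $\{\hat v_n\}_{n\in\mathbb{N}}$ is asymptotically optimal in the sense that $$\lim_{n\to\infty}\hat\pi_n(c_n)=\beta,$$ where $\hat\pi_n$ denotes the invariant probability measure of the chain under the control $\hat v_n$ and $c_n(x)=c(x,\hat v_n(x))$.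
   Context: Notation. For a Polish space $\mathbb{Y}$, $\mathfrak{B}(\mathbb{Y})$ is its Borel $\sigma$-algebra, $\mathfrak{P}(\mathbb{Y})$ the Borel probability measures, $\mathcal{M}(\mathbb{Y})$ the real-valued Borel functions, $\mathcal{M}_b(\mathbb{Y})$ the bounded ones, $C_b(\mathbb{Y})$ the bounded continuous functions, and $\mathcal{L}(\mathbb{Y})$ the real-valued lower semicontinuous functions bounded from below. For a probability measure $\mu$, $\mu(f)=\int f\,d\mu$. For $f\in\mathcal{M}(\mathbb{X})$, $\|g\|_f=\sup_x\frac{|g(x)|}{1+|f(x)|}$ and $\mathcal{O}(f)=\{g\in\mathcal{M}(\mathbb{X}):\|g\|_f<\infty\}$. Model. A Markov decision process $(\mathbb{X},\mathbb{U},\mathcal{U},P,c)$: the state space $\mathbb{X}$ and the action space $\mathbb{U}$ are Polish; $\mathcal{U}:\mathbb{X}\to\mathfrak{B}(\mathbb{U})$ is a strict (nonempty-valued) measurable multifunction; $\mathbb{K}=\{(x,u):x\in\mathbb{X},\,u\in\mathcal{U}(x)\}$ has the relative topology of $\mathbb{X}\times\mathbb{U}$; $P(\cdot\,|\,x,u)$ is a stochastic kernel on $\mathbb{K}\times\mathfrak{B}(\mathbb{X})$; $c:\mathbb{K}\to[1,\infty]$ is the measurable running cost. Admissible strategies $\xi=\{\xi_t\}\in\mathfrak{U}$ are sequences of stochastic kernels on $\mathbb{U}$ given the history $h_t=(x_0,u_0,\dots,u_{t-1},x_t)$ with $\xi_t(\mathcal{U}(x_t)\,|\,h_t)=1$;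 $\mathbb{P}^\xi_\mu$, $\mathbb{E}^\xi_\mu$ are the induced law and expectation of $(X_t,U_t)_{t\ge0}$ with $X_0\sim\mu$ (subscript $x$ for the Dirac mass at $x$). $\mathfrak{U}_{\mathrm{sm}}$ is the set of stationary Markov randomized strategies, i.e. stochastic kernels $v(du\,|\,x)$ with $v(\mathcal{U}(x)\,|\,x)=1$ (a measurable selector $v:\mathbb{X}\to\mathbb{U}$ of $\mathcal{U}$ is identified with the kernel of Dirac masses). For $v\in\mathfrak{U}_{\mathrm{sm}}$, $P_v(A\,|\,x)=\int P(A\,|\,x,u)v(du\,|\,x)$ and $c_v(x)=\int c(x,u)v(du\,|\,x)$. A $v\in\mathfrak{U}_{\mathrm{sm}}$ is stabilizing if $\limsup_{N\to\infty}\frac1N\mathbb{E}^v_x[\sum_{k=0}^{N-1}c_v(X_k)]<\infty$ for all $x\in\mathbb{X}$. Harris recurrence. A chain is $\varphi$-irreducible if, for some nonzero measure $\varphi$ (taken maximal), $\varphi$ is absolutely continuous with respect to the resolvent $\sum_{n\ge1}2^{-n}P^n(x,\cdot)$ for every $x$; it is Harris if $\mathbb{P}_x(\tau_A<\infty)=1$ for every $x\in\mathbb{X}$ and every Borel $A$ with $\varphi(A)>0$, where $\tau_A=\min\{n\ge1:X_n\in A\}$; it is positive Harris if in addition it admits an invariant probability measure. Average cost. $\mathcal{E}(\mu,\xi)=\limsup_{N}\frac1N\mathbb{E}^\xi_\mu[\sum_{n=0}^{N-1}c(X_n,U_n)]$, $J(\mu)=\inf_{\xi\in\mathfrak{U}}\mathcal{E}(\mu,\xi)$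 ($J(x)$ for the Dirac mass at $x$), $\beta=\inf_{\mu}J(\mu)$. Standing assumptions. Basic: $P$ is strongly continuous, i.e. $(x,u)\mapsto\int f(y)P(dy\,|\,x,u)$ is continuous on $\mathbb{K}$ for every $f\in\mathcal{M}_b(\mathbb{X})$; $\mathcal{U}$ is upper semicontinuous and closed-valued; $c$ is lower semicontinuous. (A0): there are a bounded (Borel) set $\mathcal{B}\subset\mathbb{X}$ with $\inf_{(x,u)\in(\mathcal{B}^c\times\mathbb{U})\cap\mathbb{K}}c(x,u)>\beta$, a measure $\nu\in\mathfrak{P}(\mathbb{X})$ with $\nu(\mathcal{B})=1$ and a constant $\delta>0$ with $P(A\,|\,x,u)\ge\delta\nu(A)\mathbf{1}_{\mathcal{B}}(x)$ for all $A\in\mathfrak{B}(\mathbb{X})$, $(x,u)\in\mathbb{K}$, and $\sum_{n\ge1}\mathbb{P}^v_x(X_n\in\mathcal{B})>0$ for all $v\in\mathfrak{U}_{\mathrm{sm}}$, $x\in\mathbb{X}$. Here $\delta$ is chosen so that $\inf_{(x,u)\in(\mathcal{B}\times\mathbb{U})\cap\mathbb{K}}P(\mathcal{B}\,|\,x,u)>\delta$. (A1): either (i) $J(x)<\infty$ for some $x$ and $c$ is inf-compact on $\mathbb{K}$ (all sets $\{c\le\kappa\}$, $\kappa\in\mathbb{R}$, are compact); or (ii) $c$ is $\mathcal{K}$-inf-compact (inf-compact on $(K\times\mathbb{U})\cap\mathbb{K}$ for each compact $K\subset\mathbb{X}$) and (C) holds. Condition (C): there is a continuous one-one embedding of $\mathbb{K}$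 into a Polish space whose image has compact closure $\mathbb{K}^*$ ($\mathbb{K}$ being identified with its image), where $\mathbb{K}^*$ is taken to be the closure of $\mathbb{K}$ in $\mathbb{X}^*\times\mathbb{U}^*$ with $\mathbb{X}^*,\mathbb{U}^*$ compact dense embeddings of $\mathbb{X},\mathbb{U}$ into suitable Polish spaces, assumed to exist; and there are a compact $\widetilde K\subset\mathbb{K}$ and $\varepsilon_0>0$ with $c\ge\beta+\varepsilon_0$ on $\mathbb{K}\setminus\widetilde K$. (A2): there exists a $c$-stable $v\in\mathfrak{U}_{\mathrm{sm}}$ (defined below). Split chain. Let $\mathcal{X}=(\mathbb{X}\times\{0\})\cup(\mathcal{B}\times\{1\})$. For $\mu\in\mathfrak{P}(\mathbb{X})$ (and by linearity for finite measures) define $\breve\mu$ on $\mathcal{X}$ by $\breve\mu(A\times\{0\})=(1-\delta)\mu(A\cap\mathcal{B})+\mu(A\cap\mathcal{B}^c)$, $A\in\mathfrak{B}(\mathbb{X})$, and $\breve\mu(A\times\{1\})=\delta\mu(A)$, $A\in\mathfrak{B}(\mathcal{B})$; $\breve P(\cdot\,|\,x,u)$ is obtained from $P(\cdot\,|\,x,u)$ in this way. The split chain $\breve X_n=(X_n,i_n)$ on $\mathcal{X}$ has kernel $Q(\cdot\,|\,(x,i),u)$ equal to $\breve P(\cdot\,|\,x,u)$ if $i=0$, $x\notin\mathcal{B}$; to $\frac{1}{1-\delta}(\breve P(\cdot\,|\,x,u)-\delta\breve\nu)$ if $i=0$, $x\in\mathcal{B}$; and to $\breve\nu$ if $i=1$,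 $x\in\mathcal{B}$. Its cost is $\breve c((x,0),u)=c(x,u)$ for $x\in\mathcal{B}^c$, $\breve c((x,0),u)=\frac{c(x,u)}{1-\delta}$ for $x\in\mathcal{B}$, and $\breve c((x,1),u)=0$. A $v\in\mathfrak{U}_{\mathrm{sm}}$ controls the split chain by applying $v(\cdot\,|\,x)$ at $(x,i)$; $\breve c_v(x,i)=\int\breve c((x,i),u)v(du\,|\,x)$ and $\breve{\mathbb{E}}^v_{(x,i)}$ is the expectation started at $(x,i)$. Let $\breve\tau=\min\{n\ge1:\breve X_n\in\mathcal{B}\times\{1\}\}$. A $v\in\mathfrak{U}_{\mathrm{sm}}$ is $c$-stable if $x\mapsto\breve{\mathbb{E}}^v_{(x,0)}[\sum_{k=0}^{\breve\tau-1}\breve c_v(\breve X_k)]$ is bounded on every bounded subset of $\mathbb{X}$. Definition of $V_\star$. $\breve V^{(0)}_\star(x)=\inf_{v\in\mathfrak{U}_{\mathrm{sm}}}\breve{\mathbb{E}}^v_{(x,0)}\bigl[\sum_{k=0}^{\breve\tau-1}(\breve c_v(\breve X_k)-\beta)\bigr]$, and $V_\star(x)=(1-\delta)\breve V^{(0)}_\star(x)$ for $x\in\mathcal{B}$, $V_\star(x)=\breve V^{(0)}_\star(x)$ for $x\notin\mathcal{B}$. The function $V_\star\in\mathcal{L}(\mathbb{X})$ solves $V_\star(x)=\min_{u\in\mathcal{U}(x)}[c(x,u)-\beta+\int V_\star(y)P(dy\,|\,x,u)]$. *)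

theory Defs
  imports "HOL-Probability.Probability"
begin

section \<open>Function classes\<close>

definition lsc_on :: "'a::topological_space set \<Rightarrow> ('a \<Rightarrow> 'b::linorder) \<Rightarrow> bool" where
  "lsc_on S f \<longleftrightarrow> (\<forall>a. closedin (top_of_set S) {x \<in> S. f x \<le> a})"

definition lsc_bdd_below :: "('a::topological_space \<Rightarrow> real) set" where
  "lsc_bdd_below = {f. lsc_on UNIV f \<and> bdd_below (range f)}"

definition weighted_norm :: "('a \<Rightarrow> real) \<Rightarrow> ('a \<Rightarrow> real) \<Rightarrow> ereal" where
  "weighted_norm f g = (SUP x. ereal (\<bar>g x\<bar> / (1 + \<bar>f x\<bar>)))"

definition weighted_class :: "('a::topological_space \<Rightarrow> real) \<Rightarrow> ('a \<Rightarrow> real) set" where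
  "weighted_class f = {g \<in> borel_measurable borel. weighted_norm f g < \<infinity>}"

text \<open>The integral of the positive part minus that of the negative part; it is only used for
  functions that are bounded from below, integrated against probability measures.\<close>

definition ereal_integral :: "'a measure \<Rightarrow> ('a \<Rightarrow> ereal) \<Rightarrow> ereal" where
  "ereal_integral M f =
     enn2ereal (\<integral>\<^sup>+x. e2ennreal (f x) \<partial>M) - enn2ereal (\<integral>\<^sup>+x. e2ennreal (- f x) \<partial>M)"

section \<open>Processes and Markov chains\<close>

text \<open>Law (Ionescu-Tulcea) of a process with values in the measurable space \<open>S\<close>;
  \<open>step n \<omega>\<close> is the conditional law of the \<open>n\<close>-th coordinate given the
  coordinates \<open>\<omega> 0, \<dots>, \<omega> (n - 1)\<close>.\<close>

definition process_law ::
  "'a measure \<Rightarrow> (nat \<Rightarrow> (nat \<Rightarrow> 'a) \<Rightarrow> 'a measure) \<Rightarrow> (nat \<Rightarrow> 'a) measure" where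
  "process_law S step =
     projective_family.lim UNIV (Ionescu_Tulcea.CI step (\<lambda>_. S)) (\<lambda>_. S)"

definition chain_law ::
  "'a measure \<Rightarrow> ('a \<Rightarrow> 'a measure) \<Rightarrow> 'a measure \<Rightarrow> (nat \<Rightarrow> 'a) measure" where
  "chain_law S \<kappa> \<mu> =
     process_law S (\<lambda>n \<omega>. case n of 0 \<Rightarrow> \<mu> | Suc m \<Rightarrow> \<kappa> (\<omega> m))"

definition hitting_time :: "'a set \<Rightarrow> (nat \<Rightarrow> 'a) \<Rightarrow> enat" where
  "hitting_time A \<omega> = (INF n \<in> {n. 1 \<le> n \<and> \<omega> n \<in> A}. enat n)"

definition kernel_pow ::
  "('a::topological_space \<Rightarrow> 'a measure) \<Rightarrow> nat \<Rightarrow> 'a \<Rightarrow> 'a measure" where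
  "kernel_pow \<kappa> n x = ((\<lambda>\<mu>. \<mu> \<bind> \<kappa>) ^^ n) (return borel x)"

definition resolvent :: "('a::topological_space \<Rightarrow> 'a measure) \<Rightarrow> 'a \<Rightarrow> 'a measure" where
  "resolvent \<kappa> x = measure_of UNIV (sets borel)
     (\<lambda>A. \<Sum>n. ennreal ((1 / 2) ^ Suc n) * emeasure (kernel_pow \<kappa> (Suc n) x) A)"

definition irreducibility_measure ::
  "('a::topological_space \<Rightarrow> 'a measure) \<Rightarrow> 'a measure \<Rightarrow> bool" where
  "irreducibility_measure \<kappa> \<phi> \<longleftrightarrow>
     sets \<phi> = sets borel \<and> emeasure \<phi> UNIV \<noteq> 0 \<and>
     (\<forall>x. absolutely_continuous (resolvent \<kappa> x) \<phi>)"

definition maximal_irreducibility_measure ::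
  "('a::topological_space \<Rightarrow> 'a measure) \<Rightarrow> 'a measure \<Rightarrow> bool" where
  "maximal_irreducibility_measure \<kappa> \<phi> \<longleftrightarrow>
     irreducibility_measure \<kappa> \<phi> \<and>
     (\<forall>\<phi>'. irreducibility_measure \<kappa> \<phi>' \<longrightarrow> absolutely_continuous \<phi> \<phi>')"

definition harris_recurrent :: "('a::topological_space \<Rightarrow> 'a measure) \<Rightarrow> bool" where
  "harris_recurrent \<kappa> \<longleftrightarrow>
     (\<exists>\<phi>. maximal_irreducibility_measure \<kappa> \<phi> \<and>
        (\<forall>x. \<forall>A\<in>sets borel. emeasure \<phi> A > 0 \<longrightarrow>
           emeasure (chain_law borel \<kappa> (return borel x)) {\<omega>. hitting_time A \<omega> < \<infinity>} = 1))"

definition invariant_prob :: "('a::topological_space \<Rightarrow> 'a measure) \<Rightarrow> 'a measure \<Rightarrow> bool" where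
  "invariant_prob \<kappa> \<pi> \<longleftrightarrow> \<pi> \<in> space (prob_algebra borel) \<and> \<pi> \<bind> \<kappa> = \<pi>"

definition positive_harris :: "('a::topological_space \<Rightarrow> 'a measure) \<Rightarrow> bool" where
  "positive_harris \<kappa> \<longleftrightarrow> harris_recurrent \<kappa> \<and> (\<exists>\<pi>. invariant_prob \<kappa> \<pi>)"

section \<open>Markov decision processes\<close>

text \<open>Only the values of \<open>trans\<close> and \<open>cost\<close> on the graph \<open>gr\<close> of \<open>acts\<close> matter.
  Integrals and mixtures over actions at a state \<open>x\<close> are therefore taken over \<open>acts D x\<close>,
  and the state-action process lives on the measurable space \<open>grM\<close>.\<close>

record ('x, 'u) mdp =
  acts :: "'x \<Rightarrow> 'u set"
  trans :: "'x \<times> 'u \<Rightarrow> 'x measure"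
  cost :: "'x \<times> 'u \<Rightarrow> ennreal"

definition gr :: "('x, 'u) mdp \<Rightarrow> ('x \<times> 'u) set" where
  "gr D = {(x, u). u \<in> acts D x}"

definition grM :: "('x::polish_space, 'u::polish_space) mdp \<Rightarrow> ('x \<times> 'u) measure" where
  "grM D = restrict_space borel (gr D)"

definition is_mdp :: "('x::polish_space, 'u::polish_space) mdp \<Rightarrow> bool" where
  "is_mdp D \<longleftrightarrow>
     (\<forall>x. acts D x \<noteq> {} \<and> acts D x \<in> sets borel) \<and>
     (\<forall>F. closed F \<longrightarrow> {x. acts D x \<inter> F \<noteq> {}} \<in> sets borel) \<and>
     trans D \<in> grM D \<rightarrow>\<^sub>M prob_algebra borel \<and>
     cost D \<in> borel_measurable (grM D) \<and>
     (\<forall>k\<in>gr D. 1 \<le> cost D k)"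

definition stationary :: "('x::polish_space, 'u::polish_space) mdp \<Rightarrow> ('x \<Rightarrow> 'u measure) set" where
  "stationary D = {v \<in> borel \<rightarrow>\<^sub>M prob_algebra borel. \<forall>x. emeasure (v x) (acts D x) = 1}"

text \<open>The history \<open>(x\<^sub>0, u\<^sub>0, \<dots>, u\<^sub>t\<^sub>-\<^sub>1, x\<^sub>t)\<close> is encoded as the pair of the family
  \<open>(x\<^sub>i, u\<^sub>i)\<close>, \<open>i < t\<close>, and \<open>x\<^sub>t\<close>.\<close>

type_synonym ('x, 'u) strategy = "nat \<Rightarrow> (nat \<Rightarrow> 'x \<times> 'u) \<times> 'x \<Rightarrow> 'u measure"

definition strategies :: "('x::polish_space, 'u::polish_space) mdp \<Rightarrow> ('x, 'u) strategy set" where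
  "strategies D = {\<xi>. \<forall>t.
     \<xi> t \<in> PiM {0..<t} (\<lambda>_. grM D) \<Otimes>\<^sub>M borel \<rightarrow>\<^sub>M prob_algebra borel \<and>
     (\<forall>h\<in>space (PiM {0..<t} (\<lambda>_. grM D)). \<forall>x. emeasure (\<xi> t (h, x)) (acts D x) = 1)}"

definition stationary_strategy :: "('x \<Rightarrow> 'u measure) \<Rightarrow> ('x, 'u) strategy" where
  "stationary_strategy v = (\<lambda>t (h, x). v x)"

definition policy_step ::
  "('x::polish_space, 'u::polish_space) mdp \<Rightarrow> 'x measure \<Rightarrow> ('x, 'u) strategy \<Rightarrow>
     nat \<Rightarrow> (nat \<Rightarrow> 'x \<times> 'u) \<Rightarrow> ('x \<times> 'u) measure" where
  "policy_step D \<mu> \<xi> t h =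
     (case t of 0 \<Rightarrow> \<mu> | Suc s \<Rightarrow> trans D (h s)) \<bind>
     (\<lambda>x. distr (restrict_space (\<xi> t (h, x)) (acts D x)) (grM D) (\<lambda>u. (x, u)))"

definition policy_law ::
  "('x::polish_space, 'u::polish_space) mdp \<Rightarrow> 'x measure \<Rightarrow> ('x, 'u) strategy \<Rightarrow>
     (nat \<Rightarrow> 'x \<times> 'u) measure" where
  "policy_law D \<mu> \<xi> = process_law (grM D) (policy_step D \<mu> \<xi>)"

definition kernel_of ::
  "('x::polish_space, 'u::polish_space) mdp \<Rightarrow> ('x \<Rightarrow> 'u measure) \<Rightarrow> 'x \<Rightarrow> 'x measure" where
  "kernel_of D v x = restrict_space (v x) (acts D x) \<bind> (\<lambda>u. trans D (x, u))"

definition cost_of ::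
  "('x::polish_space, 'u::polish_space) mdp \<Rightarrow> ('x \<Rightarrow> 'u measure) \<Rightarrow> 'x \<Rightarrow> ennreal" where
  "cost_of D v x = (\<integral>\<^sup>+u\<in>acts D x. cost D (x, u) \<partial>v x)"

definition stabilizing ::
  "('x::polish_space, 'u::polish_space) mdp \<Rightarrow> ('x \<Rightarrow> 'u measure) \<Rightarrow> bool" where
  "stabilizing D v \<longleftrightarrow> v \<in> stationary D \<and>
     (\<forall>x. limsup (\<lambda>N. (\<integral>\<^sup>+\<omega>. (\<Sum>k<N. cost_of D v (fst (\<omega> k)))
        \<partial>policy_law D (return borel x) (stationary_strategy v)) / of_nat N) < \<infinity>)"

definition average_cost ::
  "('x::polish_space, 'u::polish_space) mdp \<Rightarrow> 'x measure \<Rightarrow> ('x, 'u) strategy \<Rightarrow> ennreal" where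
  "average_cost D \<mu> \<xi> =
     limsup (\<lambda>N. (\<integral>\<^sup>+\<omega>. (\<Sum>n<N. cost D (\<omega> n)) \<partial>policy_law D \<mu> \<xi>) / of_nat N)"

definition optimal_cost ::
  "('x::polish_space, 'u::polish_space) mdp \<Rightarrow> 'x measure \<Rightarrow> ennreal" where
  "optimal_cost D \<mu> = (INF \<xi>\<in>strategies D. average_cost D \<mu> \<xi>)"

definition beta :: "('x::polish_space, 'u::polish_space) mdp \<Rightarrow> ennreal" where
  "beta D = (INF \<mu>\<in>space (prob_algebra borel). optimal_cost D \<mu>)"

section \<open>Standing assumptions\<close>

definition basic_assms :: "('x::polish_space, 'u::polish_space) mdp \<Rightarrow> bool" where
  "basic_assms D \<longleftrightarrow>
     (\<forall>f::'x \<Rightarrow> real. f \<in> borel_measurable borel \<longrightarrow> bounded (range f) \<longrightarrow>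
        continuous_on (gr D) (\<lambda>k. \<integral>y. f y \<partial>trans D k)) \<and>
     (\<forall>F. closed F \<longrightarrow> closed {x. acts D x \<inter> F \<noteq> {}}) \<and>
     (\<forall>x. closed (acts D x)) \<and>
     lsc_on (gr D) (cost D)"

text \<open>The strict inequality \<open>beta D < \<dots>\<close> forces \<open>beta D < \<infinity>\<close>.\<close>

definition A0 ::
  "('x::polish_space, 'u::polish_space) mdp \<Rightarrow> 'x set \<Rightarrow> 'x measure \<Rightarrow> real \<Rightarrow> bool" where
  "A0 D B \<nu> \<delta> \<longleftrightarrow>
     bounded B \<and> B \<in> sets borel \<and>
     beta D < (INF k\<in>{k \<in> gr D. fst k \<notin> B}. cost D k) \<and>
     \<nu> \<in> space (prob_algebra borel) \<and> emeasure \<nu> B = 1 \<and>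
     0 < \<delta> \<and>
     (\<forall>A\<in>sets borel. \<forall>(x, u)\<in>gr D.
        ennreal \<delta> * emeasure \<nu> A * indicator B x \<le> emeasure (trans D (x, u)) A) \<and>
     (\<forall>v\<in>stationary D. \<forall>x.
        (\<Sum>n. let L = policy_law D (return borel x) (stationary_strategy v) in
           emeasure L {\<omega> \<in> space L. fst (\<omega> (Suc n)) \<in> B}) > 0) \<and>
     ennreal \<delta> < (INF k\<in>{k \<in> gr D. fst k \<in> B}. emeasure (trans D k) B)"

definition inf_compact :: "('x::polish_space, 'u::polish_space) mdp \<Rightarrow> bool" where
  "inf_compact D \<longleftrightarrow> (\<forall>\<kappa>::real. compact {k \<in> gr D. cost D k \<le> ennreal \<kappa>})"

definition K_inf_compact :: "('x::polish_space, 'u::polish_space) mdp \<Rightarrow> bool" where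
  "K_inf_compact D \<longleftrightarrow>
     (\<forall>S. compact S \<longrightarrow> (\<forall>\<kappa>::real. compact {k \<in> gr D. fst k \<in> S \<and> cost D k \<le> ennreal \<kappa>}))"

text \<open>The types \<open>'xs\<close> and \<open>'us\<close> are the Polish spaces into which states and actions are embedded;
  the compactifications are the closures of the images. In a hypothesis of a theorem the
  universally quantified type variables act as an existential quantifier over Polish spaces.\<close>

definition condition_C ::
  "'xs::polish_space itself \<Rightarrow> 'us::polish_space itself \<Rightarrow>
     ('x::polish_space, 'u::polish_space) mdp \<Rightarrow> bool" where
  "condition_C _ _ D \<longleftrightarrow>
     (\<exists>(\<iota>X :: 'x \<Rightarrow> 'xs) (\<iota>U :: 'u \<Rightarrow> 'us).
        continuous_on UNIV \<iota>X \<and> inj \<iota>X \<and> compact (closure (range \<iota>X)) \<and>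
        continuous_on UNIV \<iota>U \<and> inj \<iota>U \<and> compact (closure (range \<iota>U)) \<and>
        compact (closure (map_prod \<iota>X \<iota>U ` gr D))) \<and>
     (\<exists>Kt \<epsilon>0. Kt \<subseteq> gr D \<and> compact Kt \<and> 0 < \<epsilon>0 \<and>
        (\<forall>k\<in>gr D - Kt. beta D + ennreal \<epsilon>0 \<le> cost D k))"

definition A1 ::
  "'xs::polish_space itself \<Rightarrow> 'us::polish_space itself \<Rightarrow>
     ('x::polish_space, 'u::polish_space) mdp \<Rightarrow> bool" where
  "A1 xs us D \<longleftrightarrow>
     ((\<exists>x. optimal_cost D (return borel x) < \<infinity>) \<and> inf_compact D) \<or>
     (K_inf_compact D \<and> condition_C xs us D)"

section \<open>The split chain\<close>

text \<open>The second component \<open>False\<close>, \<open>True\<close> stands for \<open>0\<close>, \<open>1\<close>.\<close>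

definition split_space :: "'x::polish_space set \<Rightarrow> ('x \<times> bool) measure" where
  "split_space B =
     restrict_space (borel \<Otimes>\<^sub>M count_space UNIV) (UNIV \<times> {False} \<union> B \<times> {True})"

definition split_measure ::
  "'x::polish_space set \<Rightarrow> real \<Rightarrow> 'x measure \<Rightarrow> ('x \<times> bool) measure" where
  "split_measure B \<delta> \<mu> = measure_of (space (split_space B)) (sets (split_space B))
     (\<lambda>S. ennreal (1 - \<delta>) * emeasure \<mu> ({x. (x, False) \<in> S} \<inter> B) +
          emeasure \<mu> ({x. (x, False) \<in> S} - B) +
          ennreal \<delta> * emeasure \<mu> {x. (x, True) \<in> S})"

definition split_trans ::
  "('x::polish_space, 'u::polish_space) mdp \<Rightarrow> 'x set \<Rightarrow> 'x measure \<Rightarrow> real \<Rightarrow>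
     'x \<times> bool \<Rightarrow> 'u \<Rightarrow> ('x \<times> bool) measure" where
  "split_trans D B \<nu> \<delta> = (\<lambda>(x, i) u.
     if i then split_measure B \<delta> \<nu>
     else if x \<in> B then
       scale_measure (ennreal (1 / (1 - \<delta>)))
         (diff_measure (split_measure B \<delta> (trans D (x, u)))
           (scale_measure (ennreal \<delta>) (split_measure B \<delta> \<nu>)))
     else split_measure B \<delta> (trans D (x, u)))"

definition split_kernel ::
  "('x::polish_space, 'u::polish_space) mdp \<Rightarrow> 'x set \<Rightarrow> 'x measure \<Rightarrow> real \<Rightarrow>
     ('x \<Rightarrow> 'u measure) \<Rightarrow> 'x \<times> bool \<Rightarrow> ('x \<times> bool) measure" where
  "split_kernel D B \<nu> \<delta> v z =
     restrict_space (v (fst z)) (acts D (fst z)) \<bind> split_trans D B \<nu> \<delta> z"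

definition split_cost ::
  "('x::polish_space, 'u::polish_space) mdp \<Rightarrow> 'x set \<Rightarrow> real \<Rightarrow> 'x \<times> bool \<Rightarrow> 'u \<Rightarrow> ennreal" where
  "split_cost D B \<delta> = (\<lambda>(x, i) u.
     if i then 0 else if x \<in> B then cost D (x, u) / ennreal (1 - \<delta>) else cost D (x, u))"

definition split_cost_of ::
  "('x::polish_space, 'u::polish_space) mdp \<Rightarrow> 'x set \<Rightarrow> real \<Rightarrow> ('x \<Rightarrow> 'u measure) \<Rightarrow>
     'x \<times> bool \<Rightarrow> ennreal" where
  "split_cost_of D B \<delta> v z =
     (\<integral>\<^sup>+u\<in>acts D (fst z). split_cost D B \<delta> z u \<partial>v (fst z))"

definition split_law ::
  "('x::polish_space, 'u::polish_space) mdp \<Rightarrow> 'x set \<Rightarrow> 'x measure \<Rightarrow> real \<Rightarrow>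
     ('x \<Rightarrow> 'u measure) \<Rightarrow> 'x \<times> bool \<Rightarrow> (nat \<Rightarrow> 'x \<times> bool) measure" where
  "split_law D B \<nu> \<delta> v z =
     chain_law (split_space B) (split_kernel D B \<nu> \<delta> v) (return (split_space B) z)"

text \<open>Expected sum of \<open>f \<ge> 0\<close> along the split chain up to (excluding) the first visit, at a time
  at least 1, to \<open>B \<times> {1}\<close>.\<close>

definition split_cycle_sum ::
  "('x::polish_space, 'u::polish_space) mdp \<Rightarrow> 'x set \<Rightarrow> 'x measure \<Rightarrow> real \<Rightarrow>
     ('x \<Rightarrow> 'u measure) \<Rightarrow> ('x \<times> bool \<Rightarrow> ennreal) \<Rightarrow> 'x \<times> bool \<Rightarrow> ennreal" where
  "split_cycle_sum D B \<nu> \<delta> v f z =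
     (\<integral>\<^sup>+\<omega>. (\<Sum>k. if enat k < hitting_time (B \<times> {True}) \<omega> then f (\<omega> k) else 0)
        \<partial>split_law D B \<nu> \<delta> v z)"

definition c_stable ::
  "('x::polish_space, 'u::polish_space) mdp \<Rightarrow> 'x set \<Rightarrow> 'x measure \<Rightarrow> real \<Rightarrow>
     ('x \<Rightarrow> 'u measure) \<Rightarrow> bool" where
  "c_stable D B \<nu> \<delta> v \<longleftrightarrow> v \<in> stationary D \<and>
     (\<forall>S. bounded S \<longrightarrow>
        (SUP x\<in>S. split_cycle_sum D B \<nu> \<delta> v (split_cost_of D B \<delta> v) (x, False)) < \<infinity>)"

definition A2 ::
  "('x::polish_space, 'u::polish_space) mdp \<Rightarrow> 'x set \<Rightarrow> 'x measure \<Rightarrow> real \<Rightarrow> bool" where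
  "A2 D B \<nu> \<delta> \<longleftrightarrow> (\<exists>v. c_stable D B \<nu> \<delta> v)"

text \<open>Subtraction on \<^typ>\<open>ennreal\<close> is truncated at 0, so the two terms below are the expectations of
  the sums of the positive and of the negative parts of \<open>split_cost_of D B \<delta> v - beta D\<close>.
  Under \<open>A0\<close> the second one is finite, uniformly in \<open>v\<close>: off \<open>B\<close> the cost exceeds \<open>beta D\<close>,
  and each visit to \<open>B \<times> {0}\<close> is followed by one to \<open>B \<times> {1}\<close> with probability bounded away from 0.\<close>

definition split_cycle_value ::
  "('x::polish_space, 'u::polish_space) mdp \<Rightarrow> 'x set \<Rightarrow> 'x measure \<Rightarrow> real \<Rightarrow>
     ('x \<Rightarrow> 'u measure) \<Rightarrow> 'x \<Rightarrow> ereal" where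
  "split_cycle_value D B \<nu> \<delta> v x =
     enn2ereal (split_cycle_sum D B \<nu> \<delta> v (\<lambda>z. split_cost_of D B \<delta> v z - beta D) (x, False)) -
     enn2ereal (split_cycle_sum D B \<nu> \<delta> v (\<lambda>z. beta D - split_cost_of D B \<delta> v z) (x, False))"

text \<open>The infimum is finite under \<open>A0\<close> and \<open>A2\<close>, so that the conversion to
  \<^typ>\<open>real\<close> loses nothing.\<close>

definition V_star ::
  "('x::polish_space, 'u::polish_space) mdp \<Rightarrow> 'x set \<Rightarrow> 'x measure \<Rightarrow> real \<Rightarrow> 'x \<Rightarrow> real" where
  "V_star D B \<nu> \<delta> x =
     (if x \<in> B then 1 - \<delta> else 1) *
     real_of_ereal (INF v\<in>stationary D. split_cycle_value D B \<nu> \<delta> v x)"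

section \<open>Value iteration\<close>

definition H2 ::
  "('x::polish_space, 'u::polish_space) mdp \<Rightarrow> 'x set \<Rightarrow> 'x measure \<Rightarrow> real \<Rightarrow> bool" where
  "H2 D B \<nu> \<delta> \<longleftrightarrow> (\<exists>\<theta>1 \<theta>2 :: real. 0 < \<theta>1 \<and> \<theta>1 < 1 \<and>
     (\<forall>x. ereal (\<theta>1 * V_star D B \<nu> \<delta> x - \<theta>2) \<le> enn2ereal (INF u\<in>acts D x. cost D (x, u))))"

definition bellman ::
  "('x::polish_space, 'u::polish_space) mdp \<Rightarrow> ('x \<Rightarrow> ereal) \<Rightarrow> 'x \<Rightarrow> 'u \<Rightarrow> ereal" where
  "bellman D f x u =
     enn2ereal (cost D (x, u)) - enn2ereal (beta D) + ereal_integral (trans D (x, u)) f"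

primrec value_iter ::
  "('x::polish_space, 'u::polish_space) mdp \<Rightarrow> ('x \<Rightarrow> real) \<Rightarrow> nat \<Rightarrow> 'x \<Rightarrow> ereal" where
  "value_iter D \<Phi>0 0 = (\<lambda>x. ereal (\<Phi>0 x))"
| "value_iter D \<Phi>0 (Suc n) = (\<lambda>x. INF u\<in>acts D x. bellman D (value_iter D \<Phi>0 n) x u)"

definition minimizing_selector ::
  "('x::polish_space, 'u::polish_space) mdp \<Rightarrow> ('x \<Rightarrow> ereal) \<Rightarrow> ('x \<Rightarrow> 'u) \<Rightarrow> bool" where
  "minimizing_selector D f w \<longleftrightarrow> w \<in> borel \<rightarrow>\<^sub>M borel \<and>
     (\<forall>x. is_arg_min (bellman D f x) (\<lambda>u. u \<in> acts D x) (w x))"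

definition dirac :: "('x \<Rightarrow> 'u::topological_space) \<Rightarrow> 'x \<Rightarrow> 'u measure" where
  "dirac w x = return borel (w x)"

end

(* The regeneration at B x {1} turns the split chain into a killed chain on the state space whose
   kernel is R = P - delta 1_B nu. In these terms V_star is, up to an additive constant, the value W
   of a positive total-cost problem for R; inf-compactness gives a minimizing selector u, and
   comparison with the definition of beta gives the value of nu(W). So W solves the average-cost
   optimality equation up to a constant.

   Under (H2), W is a geometric Lyapunov function, and h_n = Phi_n - W satisfies
   |h_n| <= C (1 - theta)^n W + C together with P_{v_n} h_n <= h_{n+1} <= P_u h_n. The numbers
   nu(h_n) obey a renewal inequality, hence converge, and the contraction of the killed kernels
   gives h_n -> kappa pointwise.

   Finally pi_n(c_n) - beta = pi_n(h_{n+1} - h_n). The integrand tends to 0 pointwise and is bounded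
   by a constant plus a null sequence times W. Since pi_n = pi_n P_{v_n}, since P(A | x, u) is
   continuous in (x, u), and since the sublevel sets of c are compact, Dini's theorem makes the
   pi_n-measure of the sets where the integrand is not small tend to 0. *)

theory Submission
  imports Defs
begin

section \<open>Renewal inequalities\<close>

text \<open>Subtracting \<beta> makes the cycle cost signed, so its infinite sum is no longer
  monotone. Adding \<open>\<alpha> * atom\<close> repairs this: along the killed chain
  \<open>atom\<close> sums to the probability of regeneration, which is 1 whenever the shifted total
  is finite, so every finite value moves by the same constant \<alpha>. With
  \<open>\<alpha> * \<delta> = \<beta> + \<epsilon>\<close> the shifted cost is at least \<epsilon>
  everywhere, and the value can be built by iterating upward from 0. Nothing in this construction
  refers to long-run averages. The only link is the number \<nu>(W): the killed and the original
  Bellman equation agree when it equals \<beta> + \<alpha>, and any other value would be a gain or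
  loss per regeneration that accumulates linearly in time. The selectors \<open>v n\<close> change
  with \<open>n\<close>, and for them optimality of \<open>W\<close> only bounds the mean of
  \<open>W\<close> after one step from below. A Lyapunov function for their killed kernels has to
  come from the iterates, for which the Bellman recursion is an equality; this is the shifted
  iterate \<open>L n\<close>.\<close>

lemma tendsto_convolution:
  fixes w b :: "nat \<Rightarrow> real"
  assumes w: "summable w" "\<And>j. 0 \<le> w j" and b: "\<And>n. \<bar>b n\<bar> \<le> M"
    and r: "filterlim r at_top sequentially" and lim: "\<And>j. (\<lambda>k. b (r k - j)) \<longlonglongrightarrow> L"
  shows "(\<lambda>k. \<Sum>j\<le>r k. w j * b (r k - j)) \<longlonglongrightarrow> suminf w * L"
proof -
  \<comment> \<open>Padding the finite sums by zeros turns them into series over all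
    \<open>j\<close>, to which Tannery's theorem applies with the dominating series
    \<open>w j * M\<close>.\<close>
  define t where "t j k = (if j \<le> r k then w j * b (r k - j) else 0)" for j k
  have ev: "eventually (\<lambda>k. j \<le> r k) sequentially" for j
    using r by (auto simp: filterlim_at_top)
  have 1: "(\<lambda>k. t j k) \<longlonglongrightarrow> w j * L" for j
  proof (rule Lim_transform_eventually)
    show "(\<lambda>k. w j * b (r k - j)) \<longlonglongrightarrow> w j * L"
      by (intro tendsto_intros lim)
    show "eventually (\<lambda>k. w j * b (r k - j) = t j k) sequentially"
      using ev[of j] by eventually_elim (simp add: t_def)
  qed
  have M0: "0 \<le> M"
    using b[of 0] by linarith
  have 2: "norm (t j k) \<le> w j * M" for j k
    using w(2)[of j] b[of "r k - j"] M0 by (auto simp: t_def abs_mult mult_left_mono)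
  have "(\<lambda>k. suminf (\<lambda>j. t j k)) \<longlonglongrightarrow> suminf (\<lambda>j. w j * L)"
  proof -
    have "summable (\<lambda>j. w j * M)"
      using w(1) by (rule summable_mult2)
    moreover have "eventually (\<lambda>(j, k). norm (t j k) \<le> w j * M) (at_top \<times>\<^sub>F sequentially)"
      using 2 by (intro always_eventually) auto
    ultimately show ?thesis
      using tannerys_theorem[OF 1, where M = "\<lambda>j. w j * M"] by simp
  qed
  also have "suminf (\<lambda>j. w j * L) = suminf w * L"
    by (rule suminf_mult2[OF w(1), symmetric])
  also have "suminf (\<lambda>j. t j k) = (\<Sum>j\<le>r k. w j * b (r k - j))" for k
  proof -
    have "suminf (\<lambda>j. t j k) = (\<Sum>j\<le>r k. t j k)"
      by (rule suminf_finite) (auto simp: t_def)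
    then show ?thesis
      by (simp add: t_def)
  qed
  then have "(\<lambda>k. suminf (\<lambda>j. t j k)) = (\<lambda>k. \<Sum>j\<le>r k. w j * b (r k - j))"
    by blast
  finally show ?thesis .
qed

text \<open>Think of \<open>p\<close> as the law of a waiting time and of \<open>F\<close> as its
  tail, so that \<open>p\<close> sums to 1. Let \<open>L\<close> be the limit superior of
  \<open>a\<close>. Since \<open>p 0 > 0\<close>, an index with value near \<open>L\<close> is
  preceded by values near \<open>L\<close>. The average of \<open>a\<close> with weights
  \<open>F\<close> decreases up to geometric errors, hence converges, and along such indices its
  limit is seen to be \<open>suminf F * L\<close>. The other terms of the average cannot exceed
  \<open>L\<close> in the limit, so \<open>a n\<close> itself cannot stay below
  \<open>L\<close>.\<close>

lemma renewal_inequality_convergent: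
  fixes a p F :: "nat \<Rightarrow> real"
  assumes p: "\<And>j. 0 \<le> p j" "0 < p 0"
    and F: "F 0 = 1" "\<And>j. F (Suc j) = F j - p j" "\<And>j. 0 \<le> F j" "\<And>j. F j \<le> C * \<gamma> ^ j"
    and \<gamma>: "0 < \<gamma>" "\<gamma> < 1"
    and a: "\<And>n. \<bar>a n\<bar> \<le> M"
    and renewal: "\<And>n. a (Suc n) \<le> (\<Sum>j\<le>n. p j * a (n - j)) + C * \<gamma> ^ n"
  shows "convergent a"
proof -
  have sF: "summable F"
  proof (rule summable_comparison_test')
    show "summable (\<lambda>j. C * \<gamma> ^ j)"
      using \<gamma> by (intro summable_mult summable_geometric) auto
    show "norm (F n) \<le> C * \<gamma> ^ n" if "n \<ge> 0" for n
      using F(3,4)[of n] by simp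
  qed
  have p_le: "p j \<le> F j" for j
    using F(2)[of j] F(3)[of "Suc j"] by linarith
  have sp: "summable p"
    using sF by (rule summable_comparison_test') (use p_le p in auto)
  have "(\<lambda>j. F j - F (Suc j)) sums (F 0 - 0)"
    using summable_LIMSEQ_zero[OF sF] by (rule telescope_sums')
  then have sum_p: "suminf p = 1"
    by (simp add: F(1,2) sums_iff)
  have M0: "0 \<le> M"
    using a[of 0] by linarith
  have C0: "0 \<le> C"
    using F(4)[of 0] F(1) by simp
  define u where "u n = (SUP k\<in>{n..}. a k)" for n
  have bdd: "bdd_above (a ` {n..})" for n
    using a by (intro bdd_aboveI2[where M = M]) (simp add: abs_le_iff)
  have a_le_u: "a k \<le> u n" if "n \<le> k" for k n
    unfolding u_def using that by (intro cSUP_upper bdd) auto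
  have u_ge: "- M \<le> u n" for n
    using a_le_u[of n n] a[of n] by simp
  have u_le: "u n \<le> M" for n
    unfolding u_def using a by (intro cSUP_least) (auto simp: abs_le_iff)
  have dec_u: "decseq u"
  proof (rule decseq_SucI)
    show "u (Suc n) \<le> u n" for n
      unfolding u_def by (intro cSUP_subset_mono bdd) auto
  qed
  obtain L where L: "u \<longlonglongrightarrow> L"
    using decseq_convergent[OF dec_u, of "- M"] u_ge by blast
  have "\<exists>k\<ge>n. u n - 1 / Suc n < a k" for n
  proof -
    have "u n - 1 / Suc n < (SUP k\<in>{n..}. a k)"
      by (simp add: u_def)
    then show ?thesis
      by (subst (asm) less_cSUP_iff) (auto intro: bdd)
  qed
  then obtain r where r: "\<And>n. n \<le> r n" "\<And>n. u n - 1 / Suc n < a (r n)"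
    by metis
  have r_top: "filterlim r at_top sequentially"
    by (rule filterlim_at_top_mono[OF filterlim_ident]) (use r in auto)
  have r_top': "filterlim (\<lambda>k. r k - j) at_top sequentially" for j
    using r_top by (rule filterlim_compose[OF filterlim_minus_const_nat_at_top])
  have u_sub: "(\<lambda>k. u (r k - j)) \<longlonglongrightarrow> L" for j
    using filterlim_compose[OF L r_top'] .
  \<comment> \<open>Bounding \<open>a\<close> by \<open>u\<close> in every term except
    \<open>j = 0\<close> leaves the first-order recursion
    \<open>a (Suc n) \<le> p 0 * a n + e n\<close>, whose error tends to
    \<open>(1 - p 0) * L\<close>.\<close>
  define e where "e n = (\<Sum>j\<le>n. p j * u (n - j)) - p 0 * u n + C * \<gamma> ^ n" for n
  have e_lim: "e \<longlonglongrightarrow> suminf p * L - p 0 * L + C * 0"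
    unfolding e_def
  proof (intro tendsto_intros)
    show "(\<lambda>n. \<Sum>j\<le>n. p j * u (n - j)) \<longlonglongrightarrow> suminf p * L"
    proof (rule tendsto_convolution[OF sp p(1), where M = M])
      show "\<bar>u n\<bar> \<le> M" for n
        using u_ge[of n] u_le[of n] by linarith
      show "filterlim (\<lambda>n. n::nat) at_top sequentially"
        by (rule filterlim_ident)
      show "(\<lambda>k. u (k - j)) \<longlonglongrightarrow> L" for j
        using L by (rule filterlim_compose[OF _ filterlim_minus_const_nat_at_top])
    qed
  qed (use L \<gamma> in \<open>auto intro: LIMSEQ_power_zero\<close>)
  have a_Suc_le: "a (Suc n) \<le> p 0 * a n + e n" for n
  proof -
    have "(\<Sum>j\<le>n. p j * a (n - j)) - p 0 * a n = (\<Sum>j\<in>{..n} - {0}. p j * a (n - j))"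
      by (subst sum_diff1) auto
    also have "\<dots> \<le> (\<Sum>j\<in>{..n} - {0}. p j * u (n - j))"
      by (intro sum_mono mult_left_mono a_le_u p) auto
    also have "\<dots> = (\<Sum>j\<le>n. p j * u (n - j)) - p 0 * u n"
      by (subst sum_diff1) auto
    finally show ?thesis
      using renewal[of n] by (simp add: e_def)
  qed
  text \<open>Along \<open>r\<close>, also every shift of \<open>a\<close> converges to its limsup, because \<open>p 0 > 0\<close>.\<close>
  have a_sub: "(\<lambda>k. a (r k - j)) \<longlonglongrightarrow> L" for j
  proof (induction j)
    case 0
    have "(\<lambda>k. u k - 1 / Suc k) \<longlonglongrightarrow> L - 0"
      using L LIMSEQ_inverse_real_of_nat by (intro tendsto_diff) (simp_all add: inverse_eq_divide)
    then have "(\<lambda>k. u k - 1 / Suc k) \<longlonglongrightarrow> L"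
      by simp
    then have "(\<lambda>k. a (r k)) \<longlonglongrightarrow> L"
      using u_sub[of 0]
      by (rule tendsto_sandwich[rotated 2]) (use r a_le_u in \<open>auto intro!: always_eventually less_imp_le\<close>)
    then show ?case
      by simp
  next
    case (Suc j)
    \<comment> \<open>The first-order recursion solved for the older term: a value near
      \<open>L\<close> at \<open>r k - j\<close> bounds the value one step earlier from below by
      something that tends to \<open>(L - (1 - p 0) * L) / p 0 = L\<close>.\<close>
    define lo where "lo k = (a (r k - j) - e (r k - Suc j)) / p 0" for k
    have "(\<lambda>k. lo k) \<longlonglongrightarrow> (L - (suminf p * L - p 0 * L + C * 0)) / p 0"
      unfolding lo_def using p by (intro tendsto_intros Suc filterlim_compose[OF e_lim r_top']) auto
    also have "(L - (suminf p * L - p 0 * L + C * 0)) / p 0 = L"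
      using p(2) by (simp add: sum_p)
    finally have lo: "lo \<longlonglongrightarrow> L" .
    have ev: "eventually (\<lambda>k. Suc j \<le> r k) sequentially"
      using r_top by (auto simp: filterlim_at_top)
    show ?case
    proof (rule tendsto_sandwich[OF _ _ lo u_sub[of "Suc j"]])
      show "eventually (\<lambda>k. lo k \<le> a (r k - Suc j)) sequentially"
        using ev
      proof eventually_elim
        case (elim k)
        then have "r k - j = Suc (r k - Suc j)"
          by simp
        then show ?case
          using a_Suc_le[of "r k - Suc j"] p(2) by (simp add: lo_def field_simps)
      qed
    qed (auto intro!: always_eventually a_le_u)
  qed
  \<comment> \<open>Summation by parts: as \<open>F j - F (Suc j) = p j\<close>, passing from
    \<open>A n\<close> to \<open>A (Suc n)\<close> adds \<open>a (Suc n)\<close> and removes exactly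
    the sum on the right of the renewal inequality.\<close>
  define A where "A n = (\<Sum>j\<le>n. F j * a (n - j))" for n
  have A_Suc: "A (Suc n) \<le> A n + C * \<gamma> ^ n" for n
  proof -
    have "A (Suc n) = a (Suc n) + (\<Sum>j\<le>n. F (Suc j) * a (n - j))"
      by (simp add: A_def sum.atMost_Suc_shift F(1) del: sum.atMost_Suc)
    also have "(\<Sum>j\<le>n. F (Suc j) * a (n - j)) = A n - (\<Sum>j\<le>n. p j * a (n - j))"
      by (simp add: A_def F(2) left_diff_distrib sum_subtractf)
    finally show ?thesis
      using renewal[of n] by simp
  qed
  \<comment> \<open>The added term is the tail of the geometric error series; its decrease pays for
    the error in \<open>A_Suc\<close>.\<close>
  define A' where "A' n = A n + C * \<gamma> ^ n / (1 - \<gamma>)" for n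
  have dec_A': "decseq A'"
  proof (rule decseq_SucI)
    fix n
    have "C * \<gamma> ^ n + C * \<gamma> ^ Suc n / (1 - \<gamma>) = C * \<gamma> ^ n / (1 - \<gamma>)"
      using \<gamma> by (simp add: field_simps)
    then show "A' (Suc n) \<le> A' n"
      using A_Suc[of n] unfolding A'_def by linarith
  qed
  have A'_ge: "- (suminf F * M) \<le> A' n" for n
  proof -
    have "\<bar>A n\<bar> \<le> (\<Sum>j\<le>n. F j * M)"
      unfolding A_def by (rule order_trans[OF sum_abs]) (auto intro!: sum_mono mult_left_mono F a simp: abs_mult F)
    also have "\<dots> \<le> suminf F * M"
      unfolding sum_distrib_right[symmetric]
      by (intro mult_right_mono sum_le_suminf sF M0) (auto simp: F)
    finally have "- (suminf F * M) \<le> A n"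
      by linarith
    moreover have "0 \<le> C * \<gamma> ^ n / (1 - \<gamma>)"
      using C0 \<gamma> by simp
    ultimately show ?thesis
      unfolding A'_def by linarith
  qed
  obtain l where "A' \<longlonglongrightarrow> l"
    using decseq_convergent[OF dec_A', of "- (suminf F * M)"] A'_ge by blast
  then have "(\<lambda>n. A' n - C * \<gamma> ^ n / (1 - \<gamma>)) \<longlonglongrightarrow> l - C * 0 / (1 - \<gamma>)"
    using \<gamma> by (intro tendsto_intros) auto
  then have A: "A \<longlonglongrightarrow> l"
    by (simp add: A'_def)
  have "(\<lambda>k. A (r k)) \<longlonglongrightarrow> suminf F * L"
    unfolding A_def using sF F(3) a r_top a_sub by (rule tendsto_convolution)
  moreover have "(\<lambda>k. A (r k)) \<longlonglongrightarrow> l"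
    using filterlim_compose[OF A r_top] .
  ultimately have l: "l = suminf F * L"
    by (metis LIMSEQ_unique)
  \<comment> \<open>The term \<open>j = 0\<close> of \<open>A n\<close> is \<open>a n\<close>,
    because \<open>F 0 = 1\<close>. The remaining terms are at most \<open>F j * u (n - j)\<close>,
    and their sum tends to \<open>suminf F * L - L\<close>, which leaves \<open>L\<close> for
    \<open>a n\<close>.\<close>
  define lo where "lo n = A n - ((\<Sum>j\<le>n. F j * u (n - j)) - u n)" for n
  have "lo \<longlonglongrightarrow> l - (suminf F * L - L)"
    unfolding lo_def
  proof (intro tendsto_intros A)
    show "(\<lambda>n. \<Sum>j\<le>n. F j * u (n - j)) \<longlonglongrightarrow> suminf F * L"
    proof (rule tendsto_convolution[OF sF F(3), where M = M])
      show "\<bar>u n\<bar> \<le> M" for n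
        using u_ge[of n] u_le[of n] by linarith
      show "filterlim (\<lambda>n. n::nat) at_top sequentially"
        by (rule filterlim_ident)
      show "(\<lambda>k. u (k - j)) \<longlonglongrightarrow> L" for j
        using L by (rule filterlim_compose[OF _ filterlim_minus_const_nat_at_top])
    qed
  qed (use L in auto)
  then have lo: "lo \<longlonglongrightarrow> L"
    by (simp add: l)
  have lo_le: "lo n \<le> a n" for n
  proof -
    have "A n - a n = (\<Sum>j\<in>{..n} - {0}. F j * a (n - j))"
      unfolding A_def by (subst sum_diff1) (auto simp: F)
    also have "\<dots> \<le> (\<Sum>j\<in>{..n} - {0}. F j * u (n - j))"
      by (intro sum_mono mult_left_mono a_le_u F) auto
    also have "\<dots> = (\<Sum>j\<le>n. F j * u (n - j)) - u n"
      by (subst sum_diff1) (auto simp: F)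
    finally show ?thesis
      by (simp add: lo_def)
  qed
  have "a \<longlonglongrightarrow> L"
    using lo L by (rule tendsto_sandwich[rotated 2]) (auto intro!: always_eventually lo_le a_le_u)
  then show ?thesis
    by (auto simp: convergent_def)
qed

section \<open>Measurable selection of minimizers\<close>

lemma decseq_compact_Inter_nonempty:
  fixes S :: "nat \<Rightarrow> 'a::t2_space set"
  assumes S: "\<And>n. compact (S n)" "\<And>n. S n \<noteq> {}" and dec: "decseq S"
  shows "(\<Inter>n. S n) \<noteq> {}"
proof -
  have "S 0 \<inter> (\<Inter>n\<in>UNIV. S n) \<noteq> {}"
  proof (rule compact_imp_fip_image)
    show "S 0 \<inter> (\<Inter>n\<in>I. S n) \<noteq> {}" if "finite I" for I
    proof -
      have "S (Max (insert 0 I)) \<subseteq> S 0 \<inter> (\<Inter>n\<in>I. S n)"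
        using that by (auto intro: decseqD[OF dec, THEN subsetD, of _ "Max (insert 0 I)"])
      then show ?thesis
        using S(2)[of "Max (insert 0 I)"] by blast
    qed
  qed (use S in \<open>auto intro: compact_imp_closed\<close>)
  then show ?thesis
    by blast
qed

text \<open>Successively intersecting the compact values with the first closed ball of radius
  \<open>2\<^sup>-\<^sup>n\<close>, centred at a point of a dense sequence, that meets them leaves a single point.\<close>

lemma compact_measurable_selector:
  fixes A :: "'a \<Rightarrow> 'b::polish_space set"
  assumes A: "\<And>x. x \<in> space M \<Longrightarrow> compact (A x)" "\<And>x. x \<in> space M \<Longrightarrow> A x \<noteq> {}"
    and meas: "\<And>F. closed F \<Longrightarrow> {x \<in> space M. A x \<inter> F \<noteq> {}} \<in> sets M"
  shows "\<exists>w \<in> M \<rightarrow>\<^sub>M borel. \<forall>x\<in>space M. w x \<in> A x"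
proof -
  obtain E :: "'b set" where E: "countable E" "\<And>X. open X \<Longrightarrow> X \<noteq> {} \<Longrightarrow> \<exists>e\<in>E. e \<in> X"
    by (rule countable_dense_setE) blast
  have E_ne: "E \<noteq> {}"
    using E(2)[of UNIV] by auto
  define e where "e = from_nat_into E"
  define b where "b n i = cball (e i) ((1 / 2) ^ n)" for n i
  define idx where "idx n S = (LEAST i. S \<inter> b n i \<noteq> {})" for n S
  define T where "T = rec_nat A (\<lambda>n S x. S x \<inter> b n (idx n (S x)))"
  have T_0: "T 0 = A" and T_Suc: "T (Suc n) x = T n x \<inter> b n (idx n (T n x))" for n x
    by (simp_all add: T_def)
  have meets: "\<exists>i. S \<inter> b n i \<noteq> {}" if "S \<noteq> {}" for S n
  proof -
    obtain s where s: "s \<in> S"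
      using \<open>S \<noteq> {}\<close> by auto
    obtain y where y: "y \<in> E" "y \<in> ball s ((1 / 2) ^ n)"
      using E(2)[OF open_ball, of s "(1 / 2) ^ n"] centre_in_ball[of s "(1 / 2) ^ n"] by fastforce
    then obtain i where "y = e i"
      unfolding e_def by (metis E(1) from_nat_into_surj)
    with s y show ?thesis
      by (auto simp: b_def dist_commute intro!: exI[of _ i] less_imp_le)
  qed
  have idx: "S \<inter> b n (idx n S) \<noteq> {}" if "S \<noteq> {}" for S n
    unfolding idx_def using meets[OF that] by (rule LeastI_ex)
  have T: "compact (T n x) \<and> T n x \<noteq> {}" if "x \<in> space M" for n x
  proof (induction n)
    case (Suc n)
    then show ?case
      using idx[of "T n x" n] by (simp add: T_Suc b_def compact_Int_closed)
  qed (use A that in \<open>simp add: T_0\<close>)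
  have T_meas: "{x \<in> space M. T n x \<inter> F \<noteq> {}} \<in> sets M" if "closed F" for n F
    using that
  proof (induction n arbitrary: F)
    case 0
    then show ?case
      using meas by (simp add: T_0)
  next
    case (Suc n)
    \<comment> \<open>Split by the value \<open>i\<close> of the least index: ball \<open>i\<close>
      is met and no earlier ball is. These are hitting conditions for closed sets, so the induction
      hypothesis covers them; it must range over all closed \<open>F\<close> because
      \<open>F\<close> gets intersected with balls.\<close>
    have "{x \<in> space M. T (Suc n) x \<inter> F \<noteq> {}} =
        (\<Union>i. {x \<in> space M. T n x \<inter> (b n i \<inter> F) \<noteq> {}} - (\<Union>j\<in>{..<i}. {x \<in> space M. T n x \<inter> b n j \<noteq> {}}))"
      (is "?L = ?R")
    proof (intro set_eqI iffI)
      fix x assume x: "x \<in> ?L"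
      then have "x \<in> {x \<in> space M. T n x \<inter> (b n (idx n (T n x)) \<inter> F) \<noteq> {}}"
        by (auto simp: T_Suc)
      moreover have "T n x \<inter> b n j = {}" if "j < idx n (T n x)" for j
        using not_less_Least[OF that[unfolded idx_def]] by simp
      ultimately show "x \<in> ?R"
        using x by blast
    next
      fix x assume "x \<in> ?R"
      then obtain i where i: "x \<in> space M" "T n x \<inter> (b n i \<inter> F) \<noteq> {}"
        "\<And>j. j < i \<Longrightarrow> T n x \<inter> b n j = {}"
        by blast
      then have "idx n (T n x) = i"
        unfolding idx_def by (intro Least_equality) (auto simp: not_less[symmetric])
      with i show "x \<in> ?L"
        by (auto simp: T_Suc)
    qed
    also have "\<dots> \<in> sets M"
    proof (rule sets.countable_UN'')
      have "{x \<in> space M. T n x \<inter> (b n i \<inter> F) \<noteq> {}} \<in> sets M" for i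
        using Suc.prems by (intro Suc.IH) (auto simp: b_def)
      moreover have "{x \<in> space M. T n x \<inter> b n j \<noteq> {}} \<in> sets M" for j
        by (rule Suc.IH) (auto simp: b_def)
      ultimately show "{x \<in> space M. T n x \<inter> (b n i \<inter> F) \<noteq> {}} -
          (\<Union>j\<in>{..<i}. {x \<in> space M. T n x \<inter> b n j \<noteq> {}}) \<in> sets M" for i
        by (simp add: sets.Diff sets.finite_UN)
    qed simp
    finally show ?case .
  qed
  have idx_meas: "(\<lambda>x. idx n (T n x)) \<in> M \<rightarrow>\<^sub>M count_space UNIV" for n
    unfolding idx_def
  proof (rule measurable_Least)
    show "(\<lambda>x. T n x \<inter> b n i \<noteq> {}) \<in> M \<rightarrow>\<^sub>M count_space UNIV" for i
      using T_meas[of "b n i" n] by (simp add: b_def pred_def)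
  qed
  have "\<exists>y. y \<in> (\<Inter>n. T n x)" if "x \<in> space M" for x
  proof -
    have "(\<Inter>n. T n x) \<noteq> {}"
      by (rule decseq_compact_Inter_nonempty) (use T[OF that] in \<open>auto intro!: decseq_SucI simp: T_Suc\<close>)
    then show ?thesis
      by blast
  qed
  then obtain w where w: "\<And>x n. x \<in> space M \<Longrightarrow> w x \<in> T n x"
    by (metis INT_E UNIV_I)
  \<comment> \<open>\<open>w\<close> was chosen pointwise, without regard to measurability. It
    becomes measurable as the limit of the ball centres, which depend measurably on \<open>x\<close>
    through a countable-valued index.\<close>
  have lim: "(\<lambda>n. e (idx n (T n x))) \<longlonglongrightarrow> w x" if "x \<in> space M" for x
  proof (rule metric_LIMSEQ_I)
    fix r :: real assume "0 < r"
    then obtain N where N: "(1 / 2) ^ N < r"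
      using real_arch_pow_inv[of r "1 / 2"] by auto
    have "dist (e (idx n (T n x))) (w x) < r" if "N \<le> n" for n
    proof -
      have "dist (e (idx n (T n x))) (w x) \<le> (1 / 2) ^ n"
        using w[OF \<open>x \<in> space M\<close>, of "Suc n"] by (simp add: T_Suc b_def)
      also have "\<dots> \<le> (1 / 2) ^ N"
        using that by (intro power_decreasing) auto
      finally show ?thesis
        using N by simp
    qed
    then show "\<exists>N. \<forall>n\<ge>N. dist (e (idx n (T n x))) (w x) < r"
      by blast
  qed
  have "w \<in> M \<rightarrow>\<^sub>M borel"
  proof (rule borel_measurable_LIMSEQ_metric)
    show "(\<lambda>x. e (idx n (T n x))) \<in> M \<rightarrow>\<^sub>M borel" for n
      using idx_meas[of n] by (rule measurable_compose) simp
  qed (rule lim)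
  then show ?thesis
    using w[of _ 0] by (auto simp: T_0)
qed

text \<open>The partial infima are measurable because projections of compact sets are compact.\<close>

lemma inf_compact_minimizer:
  fixes g :: "'a::polish_space \<times> 'b::polish_space \<Rightarrow> ennreal"
  assumes comp: "\<And>t. t < \<infinity> \<Longrightarrow> compact {k \<in> G. g k \<le> t}"
    and fin: "\<And>x. \<exists>u. (x, u) \<in> G \<and> g (x, u) < \<infinity>"
  shows "\<exists>w \<in> borel \<rightarrow>\<^sub>M borel. \<forall>x. (x, w x) \<in> G \<and> (\<forall>u. (x, u) \<in> G \<longrightarrow> g (x, w x) \<le> g (x, u))"
proof -
  define m where "m F x = (INF u\<in>{u. (x, u) \<in> G \<and> u \<in> F}. g (x, u))" for F x
  define A where "A x = {u. (x, u) \<in> G \<and> g (x, u) \<le> m UNIV x}" for x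
  have section_compact: "compact {u. (x, u) \<in> G \<and> g (x, u) \<le> t}" if "t < \<infinity>" for x t
  proof -
    have "{u. (x, u) \<in> G \<and> g (x, u) \<le> t} = snd ` ({k \<in> G. g k \<le> t} \<inter> ({x} \<times> UNIV))"
      by force
    also have "compact \<dots>"
      by (intro compact_continuous_image continuous_intros compact_Int_closed comp that closed_Times closed_UNIV closed_singleton)
    finally show ?thesis .
  qed
  \<comment> \<open>A finite infimum is attained: the actions in \<open>F\<close> that are optimal
    up to \<open>1 / Suc n\<close> form a decreasing sequence of nonempty compact sets, and a common
    point is optimal.\<close>
  have attain: "\<exists>u. (x, u) \<in> G \<and> u \<in> F \<and> g (x, u) \<le> m F x" if F: "closed F" and m: "m F x < \<infinity>" for F x
  proof -
    define S where "S n = {u. (x, u) \<in> G \<and> g (x, u) \<le> m F x + ennreal (1 / Suc n)} \<inter> F" for n :: nat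
    have "(\<Inter>n. S n) \<noteq> {}"
    proof (rule decseq_compact_Inter_nonempty)
      show "compact (S n)" for n
        unfolding S_def using m by (intro compact_Int_closed section_compact F) (simp add: less_top)
      show "S n \<noteq> {}" for n
      proof -
        have "m F x < m F x + ennreal (1 / Suc n)"
          using m by (cases "m F x") (auto simp: ennreal_plus[symmetric] ennreal_less_iff simp del: ennreal_plus)
        then obtain u where "(x, u) \<in> G" "u \<in> F" "g (x, u) < m F x + ennreal (1 / Suc n)"
          unfolding m_def by (auto simp: INF_less_iff)
        then show ?thesis
          by (auto simp: S_def less_imp_le)
      qed
      show "decseq S"
      proof (rule decseq_SucI)
        fix n
        have "m F x + ennreal (1 / Suc (Suc n)) \<le> m F x + ennreal (1 / Suc n)"
          by (intro add_left_mono ennreal_leI) (simp add: frac_le)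
        then show "S (Suc n) \<subseteq> S n"
          unfolding S_def by (auto intro: order_trans)
      qed
    qed
    then obtain u where u: "\<And>n. u \<in> S n"
      by blast
    have "g (x, u) \<le> m F x"
    proof (rule ennreal_le_epsilon)
      fix r :: real assume "0 < r"
      then obtain n where "1 / Suc n < r"
        using nat_approx_posE by blast
      then have "m F x + ennreal (1 / Suc n) \<le> m F x + ennreal r"
        by (intro add_left_mono ennreal_leI) simp
      then show "g (x, u) \<le> m F x + ennreal r"
        using u[of n] by (auto simp: S_def intro: order_trans)
    qed
    then show ?thesis
      using u[of 0] by (auto simp: S_def)
  qed
  have m_le: "m F x \<le> t \<longleftrightarrow> (\<exists>u. (x, u) \<in> G \<and> u \<in> F \<and> g (x, u) \<le> t)" if "closed F" "t < \<infinity>" for F x t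
  proof
    assume "m F x \<le> t"
    with attain[OF that(1), of x] that(2) show "\<exists>u. (x, u) \<in> G \<and> u \<in> F \<and> g (x, u) \<le> t"
      by (meson order_le_less_trans order_trans)
  next
    assume "\<exists>u. (x, u) \<in> G \<and> u \<in> F \<and> g (x, u) \<le> t"
    then show "m F x \<le> t"
      unfolding m_def by (auto intro: INF_lower2)
  qed
  have m_meas: "m F \<in> borel_measurable borel" if F: "closed F" for F
  proof (rule borel_measurableI_le)
    fix t :: ennreal
    show "{x \<in> space borel. m F x \<le> t} \<in> sets borel"
    proof (cases "t < \<infinity>")
      case True
      have "{x \<in> space borel. m F x \<le> t} = fst ` ({k \<in> G. g k \<le> t} \<inter> (UNIV \<times> F))"
        using m_le[OF F True] by force
      also have "compact \<dots>"
        by (intro compact_continuous_image continuous_intros compact_Int_closed comp True closed_Times closed_UNIV F)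
      finally show ?thesis
        by (auto intro: borel_closed compact_imp_closed)
    qed (simp add: less_top[symmetric])
  qed
  have m_fin: "m UNIV x < \<infinity>" for x
    using fin[of x] unfolding m_def by (auto simp: INF_less_iff)
  have "\<exists>w \<in> borel \<rightarrow>\<^sub>M borel. \<forall>x\<in>space borel. w x \<in> A x"
  proof (rule compact_measurable_selector)
    show "compact (A x)" for x
      unfolding A_def by (rule section_compact[OF m_fin])
    show "A x \<noteq> {}" for x
      using attain[OF _ m_fin, of x] by (auto simp: A_def)
    show "{x \<in> space borel. A x \<inter> F \<noteq> {}} \<in> sets borel" if "closed F" for F
    proof -
      \<comment> \<open>Some minimizer lies in \<open>F\<close> exactly when restricting the actions
        to \<open>F\<close> does not raise the infimum, which is a comparison of two measurable
        functions.\<close>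
      have "{x \<in> space borel. A x \<inter> F \<noteq> {}} = {x \<in> space borel. m F x \<le> m UNIV x}"
        using m_le[OF that m_fin] by (auto simp: A_def)
      also have "\<dots> \<in> sets borel"
        using m_meas[OF that] m_meas[of UNIV] by measurable
      finally show ?thesis .
    qed
  qed
  then obtain w where w: "w \<in> borel \<rightarrow>\<^sub>M borel" "\<And>x. w x \<in> A x"
    by auto
  have "g (x, w x) \<le> g (x, u)" if "(x, u) \<in> G" for x u
  proof -
    have "g (x, w x) \<le> m UNIV x"
      using w(2)[of x] by (simp add: A_def)
    also have "\<dots> \<le> g (x, u)"
      unfolding m_def using that by (auto intro: INF_lower)
    finally show ?thesis .
  qed
  then show ?thesis
    using w by (auto simp: A_def intro!: bexI[of _ w])
qed

section \<open>Laws of processes and taboo probabilities\<close>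

lemma Ionescu_Tulcea_steps:
  assumes "\<And>n. step n \<in> PiM {0..<n} (\<lambda>_. S) \<rightarrow>\<^sub>M prob_algebra S"
  shows "Ionescu_Tulcea step (\<lambda>_. S)"
proof (rule Ionescu_Tulcea.intro)
  show "step i \<in> PiM {0..<i} (\<lambda>_. S) \<rightarrow>\<^sub>M subprob_algebra S" for i
    using assms by (rule measurable_prob_algebraD)
  show "prob_space (step i x)" if "x \<in> space (PiM {0..<i} (\<lambda>_. S))" for i x
    using measurable_space[OF assms that] by (simp add: space_prob_algebra)
qed

lemma measurable_PiM_coord:
  "f \<in> S \<rightarrow>\<^sub>M N \<Longrightarrow> i \<in> I \<Longrightarrow> (\<lambda>\<omega>. f (\<omega> i)) \<in> PiM I (\<lambda>_. S) \<rightarrow>\<^sub>M N"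
  by (rule measurable_compose[OF measurable_component_singleton[of i I "\<lambda>_. S"]])

lemma process_law:
  assumes "\<And>n. step n \<in> PiM {0..<n} (\<lambda>_. S) \<rightarrow>\<^sub>M prob_algebra S"
  shows sets_process_law: "sets (process_law S step) = sets (PiM UNIV (\<lambda>_. S))"
    and prob_space_process_law: "prob_space (process_law S step)"
proof -
  interpret Ionescu_Tulcea step "\<lambda>_. S"
    using assms by (rule Ionescu_Tulcea_steps)
  show "sets (process_law S step) = sets (PiM UNIV (\<lambda>_. S))"
    by (simp add: process_law_def)
  have "emeasure PF.lim (PF.emb UNIV {} {\<lambda>_. undefined}) = emeasure (CI {}) {\<lambda>_. undefined}"
    by (rule lim) (simp_all add: PiM_empty)
  moreover have "emeasure (CI {}) (space (CI {})) = 1"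
    using PF.prob_space_P[of "{}"] by (intro prob_space.emeasure_space_1) simp
  moreover have "PF.emb UNIV {} {\<lambda>_. undefined} = space PF.lim"
    by (auto simp: prod_emb_def space_PiM restrict_def)
  moreover have "space (CI {}) = {\<lambda>_. undefined}"
    by (simp add: CI_def space_PiM_empty)
  ultimately have "emeasure PF.lim (space PF.lim) = 1"
    by metis
  then show "prob_space (process_law S step)"
    unfolding process_law_def by (rule prob_spaceI)
qed

text \<open>The conditioning step on which the later computations with process laws rest. A function
  of the first \<open>Suc n\<close> coordinates can be integrated against the iterated kernel
  \<open>C 0 (Suc n)\<close> in place of the limit measure, and the last factor of that kernel is
  \<open>step n\<close>.\<close>

lemma nn_integral_process_law_Suc:
  assumes step: "\<And>n. step n \<in> PiM {0..<n} (\<lambda>_. S) \<rightarrow>\<^sub>M prob_algebra S"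
    and f: "f \<in> borel_measurable (PiM {0..<Suc n} (\<lambda>_. S))"
  shows "(\<integral>\<^sup>+\<omega>. f (restrict \<omega> {0..<Suc n}) \<partial>process_law S step) =
    (\<integral>\<^sup>+\<omega>. (\<integral>\<^sup>+y. f ((restrict \<omega> {0..<n})(n := y)) \<partial>step n (restrict \<omega> {0..<n})) \<partial>process_law S step)"
proof -
  interpret Ionescu_Tulcea step "\<lambda>_. S"
    using step by (rule Ionescu_Tulcea_steps)
  \<comment> \<open>The marginal \<open>CI J\<close> is defined from the initial segment of length
    \<open>up_to J\<close> followed by a restriction to \<open>J\<close>. For \<open>{0..<m}\<close>
    the segment is the set itself, so the restriction disappears.\<close>
  have up_to_n: "up_to {0..<m} = m" for m
    by (rule antisym) (simp_all add: up_to_iff, metis atLeastLessThan_iff finite_atLeastLessThan le0 less_irrefl linorder_not_le up_to_less)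
  have CI: "CI {0..<m} = C 0 m (\<lambda>_. undefined)" for m
  proof -
    have u: "(\<lambda>_::nat. undefined) \<in> space (PiM {0..<0} (\<lambda>_. S))"
      by (simp add: space_PiM_empty)
    have "CI {0..<m} = distr (C 0 m (\<lambda>_. undefined)) (PiM {0..<0 + m} (\<lambda>_. S)) (\<lambda>f. restrict f {0..<0 + m})"
      by (simp add: CI_def up_to_n)
    also have "\<dots> = C 0 m (\<lambda>_. undefined)"
      by (rule distr_C[symmetric, OF order_refl u])
    finally show ?thesis .
  qed
  have lim_C: "(\<integral>\<^sup>+\<omega>. h (restrict \<omega> {0..<m}) \<partial>PF.lim) = (\<integral>\<^sup>+\<omega>. h \<omega> \<partial>C 0 m (\<lambda>_. undefined))"
    if h: "h \<in> borel_measurable (PiM {0..<m} (\<lambda>_. S))" for h :: "_ \<Rightarrow> ennreal" and m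
  proof -
    have "(\<lambda>\<omega>. restrict \<omega> {0..<m}) \<in> PF.lim \<rightarrow>\<^sub>M PiM {0..<m} (\<lambda>_. S)"
      by (simp add: measurable_cong_sets[OF PF.sets_lim refl] measurable_restrict_subset)
    then show ?thesis
      using h by (simp add: CI[symmetric] distr_lim[symmetric] nn_integral_distr)
  qed
  have 1: "(\<lambda>\<omega>. \<integral>\<^sup>+y. f (fun_upd \<omega> n y) \<partial>step n \<omega>) \<in> borel_measurable (PiM {0..<n} (\<lambda>_. S))"
  proof (rule nn_integral_measurable_subprob_algebra2)
    show "step n \<in> PiM {0..<n} (\<lambda>_. S) \<rightarrow>\<^sub>M subprob_algebra S"
      using step by (rule measurable_prob_algebraD)
    have "(\<lambda>(\<omega>, y). fun_upd \<omega> n y) \<in> PiM {0..<n} (\<lambda>_. S) \<Otimes>\<^sub>M S \<rightarrow>\<^sub>M PiM (insert n {0..<n}) (\<lambda>_. S)"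
      by (rule measurable_add_dim)
    then have "(\<lambda>p. f (case p of (\<omega>, y) \<Rightarrow> fun_upd \<omega> n y)) \<in> borel_measurable (PiM {0..<n} (\<lambda>_. S) \<Otimes>\<^sub>M S)"
      by (rule measurable_compose) (use f in \<open>simp add: atLeastLessThanSuc\<close>)
    then show "(\<lambda>(\<omega>, y). f (fun_upd \<omega> n y)) \<in> borel_measurable (PiM {0..<n} (\<lambda>_. S) \<Otimes>\<^sub>M S)"
      by (simp add: split_def)
  qed
  have u: "(\<lambda>_::nat. undefined) \<in> space (PiM {0..<0} (\<lambda>_. S))"
    by (simp add: space_PiM_empty)
  have "(\<integral>\<^sup>+\<omega>. f (restrict \<omega> {0..<Suc n}) \<partial>PF.lim) = (\<integral>\<^sup>+\<omega>. f \<omega> \<partial>(C 0 n (\<lambda>_. undefined) \<bind> eP n))"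
    using f by (simp add: lim_C)
  also have "\<dots> = (\<integral>\<^sup>+\<omega>. (\<integral>\<^sup>+\<omega>'. f \<omega>' \<partial>eP n \<omega>) \<partial>C 0 n (\<lambda>_. undefined))"
  proof (rule nn_integral_bind[OF f])
    show "eP n \<in> C 0 n (\<lambda>_. undefined) \<rightarrow>\<^sub>M subprob_algebra (PiM {0..<Suc n} (\<lambda>_. S))"
      using measurable_eP[of n] sets_C[OF u, of n] by (simp cong: measurable_cong_sets)
  qed
  also have "\<dots> = (\<integral>\<^sup>+\<omega>. (\<integral>\<^sup>+y. f (fun_upd \<omega> n y) \<partial>step n \<omega>) \<partial>C 0 n (\<lambda>_. undefined))"
    by (intro nn_integral_cong nn_integral_eP f) (simp add: space_C[OF u, simplified])
  also have "\<dots> = (\<integral>\<^sup>+\<omega>. (\<integral>\<^sup>+y. f ((restrict \<omega> {0..<n})(n := y)) \<partial>step n (restrict \<omega> {0..<n})) \<partial>PF.lim)"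
    using lim_C[OF 1] by simp
  finally show ?thesis
    by (simp add: process_law_def)
qed

lemma nn_integral_process_law_coord:
  assumes step: "\<And>n. step n \<in> PiM {0..<n} (\<lambda>_. S) \<rightarrow>\<^sub>M prob_algebra S"
    and f: "f \<in> borel_measurable S"
  shows "(\<integral>\<^sup>+\<omega>. f (\<omega> n) \<partial>process_law S step) =
    (\<integral>\<^sup>+\<omega>. (\<integral>\<^sup>+y. f y \<partial>step n (restrict \<omega> {0..<n})) \<partial>process_law S step)"
proof -
  have "(\<lambda>\<omega>. f (\<omega> n)) \<in> borel_measurable (PiM {0..<Suc n} (\<lambda>_. S))"
    by (rule measurable_PiM_coord[OF f]) simp
  from nn_integral_process_law_Suc[OF step this] show ?thesis
    by simp
qed

lemma chain_step_measurable:
  assumes "\<kappa> \<in> S \<rightarrow>\<^sub>M prob_algebra S" "\<mu> \<in> space (prob_algebra S)"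
  shows "(\<lambda>\<omega>. case n of 0 \<Rightarrow> \<mu> | Suc m \<Rightarrow> \<kappa> (\<omega> m)) \<in> PiM {0..<n} (\<lambda>_. S) \<rightarrow>\<^sub>M prob_algebra S"
proof (cases n)
  case 0
  then show ?thesis
    using assms by simp
next
  case (Suc m)
  then show ?thesis
    using assms(1) by (auto intro!: measurable_PiM_coord)
qed

text \<open>Time 0 is exempt from the constraint, in accordance with \<open>hitting_time\<close>,
  which starts counting at 1. The induction integrates out the last transition; this replaces
  \<open>f\<close> by its image under the taboo operator, so \<open>f\<close> has to stay
  arbitrary.\<close>

lemma nn_integral_chain_law_taboo:
  assumes \<kappa>: "\<kappa> \<in> S \<rightarrow>\<^sub>M prob_algebra S" and z: "z \<in> space S"
    and A: "A \<in> sets S" and f: "f \<in> borel_measurable S"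
  shows "(\<integral>\<^sup>+\<omega>. f (\<omega> n) * (\<Prod>j\<in>{1..n}. indicator A (\<omega> j)) \<partial>chain_law S \<kappa> (return S z)) =
    ((\<lambda>g x. \<integral>\<^sup>+y\<in>A. g y \<partial>\<kappa> x) ^^ n) f z"
  using f
proof (induction n arbitrary: f)
  let ?step = "\<lambda>n \<omega>. case n of 0 \<Rightarrow> return S z | Suc m \<Rightarrow> \<kappa> (\<omega> m)"
  have rz: "return S z \<in> space (prob_algebra S)"
    using z by (simp add: space_prob_algebra prob_space_return)
  note step = chain_step_measurable[OF \<kappa> rz]
  {
    case 0
    interpret prob_space "process_law S ?step"
      by (rule prob_space_process_law[OF step])
    have "(\<integral>\<^sup>+\<omega>. f (\<omega> 0) \<partial>process_law S ?step) = (\<integral>\<^sup>+\<omega>. (\<integral>\<^sup>+y. f y \<partial>return S z) \<partial>process_law S ?step)"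
      using nn_integral_process_law_coord[OF step 0, of 0] by simp
    also have "\<dots> = f z"
      using 0 z by (simp add: nn_integral_return emeasure_space_1)
    finally show ?case
      by (simp add: chain_law_def)
  next
    case (Suc n)
    let ?T = "\<lambda>g x. \<integral>\<^sup>+y\<in>A. g y \<partial>\<kappa> x"
    define F where "F \<omega> = f (\<omega> (Suc n)) * (\<Prod>j\<in>{1..Suc n}. indicator A (\<omega> j))" for \<omega> :: "nat \<Rightarrow> 'a"
    have F: "F \<in> borel_measurable (PiM {0..<Suc (Suc n)} (\<lambda>_. S))"
      unfolding F_def
      by (intro borel_measurable_times_ennreal borel_measurable_prod_ennreal
          measurable_PiM_coord[OF Suc.prems]
          measurable_PiM_coord[OF borel_measurable_indicator[OF A]]) auto
    have fA: "(\<lambda>y. f y * indicator A y) \<in> borel_measurable S"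
      using Suc.prems A by measurable
    have Tf: "?T f \<in> borel_measurable S"
      by (rule nn_integral_measurable_subprob_algebra2[OF _ measurable_prob_algebraD[OF \<kappa>]])
        (use fA in measurable)
    have F_upd: "F ((restrict \<omega> {0..<Suc n})(Suc n := y)) =
        (\<Prod>j\<in>{1..n}. indicator A (\<omega> j)) * (f y * indicator A y)" for \<omega> y
    proof -
      have "{1..Suc n} = insert (Suc n) {1..n}"
        by auto
      moreover have "(\<Prod>j\<in>{1..n}. indicator A (((restrict \<omega> {0..<Suc n})(Suc n := y)) j)) =
          (\<Prod>j\<in>{1..n}. indicator A (\<omega> j) :: ennreal)"
        by (rule prod.cong) auto
      ultimately show ?thesis
        unfolding F_def by (simp add: ac_simps)
    qed
    have "(\<integral>\<^sup>+\<omega>. f (\<omega> (Suc n)) * (\<Prod>j\<in>{1..Suc n}. indicator A (\<omega> j)) \<partial>process_law S ?step) =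
        (\<integral>\<^sup>+\<omega>. F (restrict \<omega> {0..<Suc (Suc n)}) \<partial>process_law S ?step)"
      by (rule nn_integral_cong) (auto simp: F_def intro!: arg_cong2[where f = "(*)"] prod.cong)
    also have "\<dots> = (\<integral>\<^sup>+\<omega>. (\<integral>\<^sup>+y. F ((restrict \<omega> {0..<Suc n})(Suc n := y)) \<partial>\<kappa> (\<omega> n)) \<partial>process_law S ?step)"
      using nn_integral_process_law_Suc[OF step F] by simp
    also have "\<dots> = (\<integral>\<^sup>+\<omega>. ?T f (\<omega> n) * (\<Prod>j\<in>{1..n}. indicator A (\<omega> j)) \<partial>process_law S ?step)"
    proof (rule nn_integral_cong)
      fix \<omega> assume "\<omega> \<in> space (process_law S ?step)"
      then have "\<omega> n \<in> space S"
        by (simp add: sets_eq_imp_space_eq[OF sets_process_law[OF step]] space_PiM PiE_iff)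
      then have "sets (\<kappa> (\<omega> n)) = sets S"
        using measurable_space[OF \<kappa>] by (simp add: space_prob_algebra)
      then have "(\<lambda>y. f y * indicator A y) \<in> borel_measurable (\<kappa> (\<omega> n))"
        using fA by (simp cong: measurable_cong_sets)
      then show "(\<integral>\<^sup>+y. F ((restrict \<omega> {0..<Suc n})(Suc n := y)) \<partial>\<kappa> (\<omega> n)) =
          ?T f (\<omega> n) * (\<Prod>j\<in>{1..n}. indicator A (\<omega> j))"
        unfolding F_upd by (subst nn_integral_cmult) (simp_all add: mult.commute)
    qed
    also have "\<dots> = (?T ^^ n) (?T f) z"
      using Suc.IH[OF Tf] by (simp add: chain_law_def)
    finally show ?case
      by (simp add: chain_law_def funpow_Suc_right del: funpow.simps)
  }
qed

lemma less_hitting_time_iff: "enat k < hitting_time A \<omega> \<longleftrightarrow> (\<forall>j\<in>{1..k}. \<omega> j \<notin> A)"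
proof
  assume k: "enat k < hitting_time A \<omega>"
  show "\<forall>j\<in>{1..k}. \<omega> j \<notin> A"
  proof (intro ballI notI)
    fix j assume "j \<in> {1..k}" "\<omega> j \<in> A"
    then have "hitting_time A \<omega> \<le> enat j"
      unfolding hitting_time_def by (intro INF_lower) auto
    with k have "enat k < enat j"
      by (rule less_le_trans)
    with \<open>j \<in> {1..k}\<close> show False
      by simp
  qed
next
  assume "\<forall>j\<in>{1..k}. \<omega> j \<notin> A"
  then have "enat (Suc k) \<le> hitting_time A \<omega>"
    unfolding hitting_time_def by (intro INF_greatest) (auto simp: not_less_eq_eq[symmetric])
  then show "enat k < hitting_time A \<omega>"
    by (simp add: Suc_ile_eq)
qed

text \<open>The \<open>k\<close>-th summand survives exactly on the paths that avoid
  \<open>A\<close> at times 1 to \<open>k\<close>, so the expected sum is the potential of the taboo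
  kernel.\<close>

lemma nn_integral_chain_law_hitting_time:
  assumes \<kappa>: "\<kappa> \<in> S \<rightarrow>\<^sub>M prob_algebra S" and z: "z \<in> space S"
    and A: "A \<in> sets S" and f: "f \<in> borel_measurable S"
  shows "(\<integral>\<^sup>+\<omega>. (\<Sum>k. if enat k < hitting_time A \<omega> then f (\<omega> k) else 0) \<partial>chain_law S \<kappa> (return S z)) =
    (\<Sum>k. ((\<lambda>g x. \<integral>\<^sup>+y\<in>space S - A. g y \<partial>\<kappa> x) ^^ k) f z)"
proof -
  have rz: "return S z \<in> space (prob_algebra S)"
    using z by (simp add: space_prob_algebra prob_space_return)
  have sets: "sets (chain_law S \<kappa> (return S z)) = sets (PiM UNIV (\<lambda>_. S))"
    unfolding chain_law_def by (rule sets_process_law[OF chain_step_measurable[OF \<kappa> rz]])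
  have cA: "space S - A \<in> sets S"
    using A by auto
  have eq: "(if enat k < hitting_time A \<omega> then f (\<omega> k) else 0) =
      f (\<omega> k) * (\<Prod>j\<in>{1..k}. indicator (space S - A) (\<omega> j))"
    if "\<omega> \<in> space (chain_law S \<kappa> (return S z))" for \<omega> k
  proof -
    have "\<omega> j \<in> space S" for j
      using that by (simp add: sets_eq_imp_space_eq[OF sets] space_PiM PiE_iff)
    then show ?thesis
      by (auto simp: less_hitting_time_iff intro!: prod_zero[symmetric] prod.neutral[symmetric] split: split_indicator)
  qed
  have meas: "(\<lambda>\<omega>. f (\<omega> k) * (\<Prod>j\<in>{1..k}. indicator (space S - A) (\<omega> j))) \<in>
      borel_measurable (chain_law S \<kappa> (return S z))" for k
    unfolding measurable_cong_sets[OF sets refl]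
    by (intro borel_measurable_times_ennreal borel_measurable_prod_ennreal
          measurable_PiM_coord[OF f]
          measurable_PiM_coord[OF borel_measurable_indicator[OF cA]]) auto
  have "(\<integral>\<^sup>+\<omega>. (\<Sum>k. if enat k < hitting_time A \<omega> then f (\<omega> k) else 0) \<partial>chain_law S \<kappa> (return S z)) =
      (\<integral>\<^sup>+\<omega>. (\<Sum>k. f (\<omega> k) * (\<Prod>j\<in>{1..k}. indicator (space S - A) (\<omega> j))) \<partial>chain_law S \<kappa> (return S z))"
    by (rule nn_integral_cong) (simp add: eq)
  also have "\<dots> = (\<Sum>k. \<integral>\<^sup>+\<omega>. f (\<omega> k) * (\<Prod>j\<in>{1..k}. indicator (space S - A) (\<omega> j)) \<partial>chain_law S \<kappa> (return S z))"
    by (rule nn_integral_suminf[OF meas])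
  finally show ?thesis
    using nn_integral_chain_law_taboo[OF \<kappa> z cA f] by simp
qed

section \<open>The killed kernel\<close>

text \<open>The killed kernel arises by subtracting measures. Writing the original kernel as a sum
  of the killed part and a multiple of \<nu> lets integrals be compared by addition alone, also when
  they are infinite.\<close>

lemma nn_integral_lincomb_measure:
  assumes sets: "sets N1 = sets M" "sets N2 = sets M"
    and em: "\<And>A. A \<in> sets M \<Longrightarrow> emeasure M A = a * emeasure N1 A + b * emeasure N2 A"
    and f: "f \<in> borel_measurable M"
  shows "(\<integral>\<^sup>+x. f x \<partial>M) = a * (\<integral>\<^sup>+x. f x \<partial>N1) + b * (\<integral>\<^sup>+x. f x \<partial>N2)"
  using f
proof (induction rule: borel_measurable_induct)
  case (cong f g)
  have "(\<integral>\<^sup>+x. f x \<partial>N) = (\<integral>\<^sup>+x. g x \<partial>N)" if "sets N = sets M" for N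
    using cong(3) sets_eq_imp_space_eq[OF that] by (intro nn_integral_cong) auto
  with cong(4) sets show ?case
    by simp
next
  case (set A)
  then show ?case
    using em sets by simp
next
  case (mult u c)
  have "u \<in> borel_measurable N1" "u \<in> borel_measurable N2"
    using mult(2) sets by (simp_all cong: measurable_cong_sets)
  then show ?case
    using mult by (simp add: nn_integral_cmult distrib_left ac_simps)
next
  case (add u v)
  have "u \<in> borel_measurable N1" "u \<in> borel_measurable N2"
    "v \<in> borel_measurable N1" "v \<in> borel_measurable N2"
    using add.hyps sets by (simp_all cong: measurable_cong_sets)
  then show ?case
    using add by (simp add: nn_integral_add distrib_left ac_simps)
next
  case (seq U)
  have U: "U i \<in> borel_measurable N1" "U i \<in> borel_measurable N2" for i
    using seq(1) sets by (simp_all cong: measurable_cong_sets)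
  have "(\<integral>\<^sup>+x. (SUP i. U i) x \<partial>M) = (SUP i. a * (\<integral>\<^sup>+x. U i x \<partial>N1) + b * (\<integral>\<^sup>+x. U i x \<partial>N2))"
    using seq by (simp add: SUP_apply image_comp nn_integral_monotone_convergence_SUP)
  also have "\<dots> = a * (SUP i. \<integral>\<^sup>+x. U i x \<partial>N1) + b * (SUP i. \<integral>\<^sup>+x. U i x \<partial>N2)"
    using incseqD[OF seq(3)]
    by (subst ennreal_SUP_add)
      (auto simp: SUP_mult_left_ennreal incseq_def le_fun_def intro!: mult_left_mono nn_integral_mono)
  also have "\<dots> = a * (\<integral>\<^sup>+x. (SUP i. U i) x \<partial>N1) + b * (\<integral>\<^sup>+x. (SUP i. U i) x \<partial>N2)"
    using seq(3) U by (simp add: SUP_apply image_comp nn_integral_monotone_convergence_SUP)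
  finally show ?case .
qed

text \<open>Cost and transition law are measurable only on the graph of the action sets. Pushing the
  action law forward to \<open>grM D\<close> makes them integrable there without choosing values off
  the graph.\<close>

definition state_action :: "('x::polish_space, 'u::polish_space) mdp \<Rightarrow> 'u measure \<Rightarrow> 'x \<Rightarrow> ('x \<times> 'u) measure" where
  "state_action D \<kappa> x = distr (restrict_space \<kappa> (acts D x)) (grM D) (\<lambda>u. (x, u))"

text \<open>The strict inequality in \<open>A0\<close> is unpacked into a positive margin
  \<epsilon>, which later becomes the uniform lower bound of the shifted cost.\<close>

locale mdp_setting =
  fixes D :: "('x::polish_space, 'u::polish_space) mdp"
    and B :: "'x set" and \<nu> :: "'x measure" and \<delta> \<epsilon> :: real
  assumes mdp: "is_mdp D" and basic: "basic_assms D" and A0: "A0 D B \<nu> \<delta>" and A2: "A2 D B \<nu> \<delta>"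
    and H2: "H2 D B \<nu> \<delta>" and inf_compact: "inf_compact D"
    and \<epsilon>: "0 < \<epsilon>" "\<And>k. k \<in> gr D \<Longrightarrow> fst k \<notin> B \<Longrightarrow> beta D + ennreal \<epsilon> \<le> cost D k"
begin

definition \<beta> :: real where "\<beta> = enn2real (beta D)"

lemma beta_eq: "beta D = ennreal \<beta>"
proof -
  have "beta D < \<infinity>"
    using A0 unfolding A0_def by (auto simp: less_top[symmetric])
  then show ?thesis
    by (simp add: \<beta>_def)
qed

lemma \<beta>_nonneg: "0 \<le> \<beta>"
  by (simp add: \<beta>_def)

lemma acts: "acts D x \<noteq> {}" "acts D x \<in> sets borel" "closed (acts D x)"
  using mdp basic by (auto simp: is_mdp_def basic_assms_def)

lemma gr_iff: "(x, u) \<in> gr D \<longleftrightarrow> u \<in> acts D x"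
  by (simp add: gr_def)

lemma space_grM: "space (grM D) = gr D"
  by (simp add: grM_def space_restrict_space)

lemma B_sets [measurable]: "B \<in> sets borel"
  using A0 by (simp add: A0_def)

lemma \<nu>_prob: "prob_space \<nu>" and \<nu>_sets: "sets \<nu> = sets borel" and \<nu>_B: "emeasure \<nu> B = 1"
  using A0 by (auto simp: A0_def space_prob_algebra)

lemma \<nu>_space: "space \<nu> = UNIV"
  using sets_eq_imp_space_eq[OF \<nu>_sets] by simp

lemma \<nu>_AE_B: "AE x in \<nu>. x \<in> B"
proof -
  interpret prob_space \<nu>
    by (rule \<nu>_prob)
  show ?thesis
    using \<nu>_B by (intro AE_prob_1) (simp add: measure_def)
qed

lemma trans_meas: "trans D \<in> grM D \<rightarrow>\<^sub>M prob_algebra borel"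
  and cost_meas: "cost D \<in> borel_measurable (grM D)"
  using mdp by (auto simp: is_mdp_def)

lemma trans_prob: "k \<in> gr D \<Longrightarrow> prob_space (trans D k)"
  and trans_sets: "k \<in> gr D \<Longrightarrow> sets (trans D k) = sets borel"
  and trans_space: "k \<in> gr D \<Longrightarrow> space (trans D k) = UNIV"
  using measurable_space[OF trans_meas] sets_eq_imp_space_eq[of "trans D k" borel]
  by (auto simp: space_grM space_prob_algebra)

lemma minorization:
  "k \<in> gr D \<Longrightarrow> A \<in> sets borel \<Longrightarrow>
    ennreal \<delta> * emeasure \<nu> A * indicator B (fst k) \<le> emeasure (trans D k) A"
  using A0 unfolding A0_def by (cases k) auto

lemma B_nonempty: "B \<noteq> {}"
  using \<nu>_B by auto

text \<open>The bound below 1 comes from \<open>\<delta> < P(B | x, u)\<close>, applied at a single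
  point of \<open>B\<close>; such a point exists because \<nu> charges \<open>B\<close>.\<close>

lemma \<delta>: "0 < \<delta>" "\<delta> < 1"
proof -
  show "0 < \<delta>"
    using A0 by (simp add: A0_def)
  obtain x u where "x \<in> B" "u \<in> acts D x"
    using B_nonempty acts by blast
  then have k: "(x, u) \<in> {k \<in> gr D. fst k \<in> B}"
    by (simp add: gr_iff)
  interpret prob_space "trans D (x, u)"
    using k by (intro trans_prob) auto
  have "ennreal \<delta> < (INF k\<in>{k \<in> gr D. fst k \<in> B}. emeasure (trans D k) B)"
    using A0 by (simp add: A0_def)
  also have "\<dots> \<le> emeasure (trans D (x, u)) B"
    using k by (rule INF_lower)
  also have "\<dots> \<le> 1"
    by (rule measure_le_1)
  finally show "\<delta> < 1"
    using \<open>0 < \<delta>\<close> by (simp add: ennreal_less_one_iff)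
qed

text \<open>The probability of regenerating at \<open>x\<close>. Its complement
  \<open>1 - atom x\<close> is the share of \<open>x\<close> that the splitting leaves on level
  0.\<close>

definition atom :: "'x \<Rightarrow> real" where "atom x = \<delta> * indicator B x"

lemma atom: "0 \<le> atom x" "atom x < 1" "x \<in> B \<Longrightarrow> atom x = \<delta>" "x \<notin> B \<Longrightarrow> atom x = 0"
  using \<delta> by (auto simp: atom_def split: split_indicator)

lemma atom_measurable [measurable]: "atom \<in> borel_measurable borel"
  unfolding atom_def by measurable

text \<open>The transition law with the regeneration removed. Up to normalization it governs the split
  chain outside \<open>B \<times> {1}\<close>.\<close>

definition killed :: "'x \<times> 'u \<Rightarrow> 'x measure" where
  "killed k = diff_measure (trans D k) (scale_measure (ennreal (atom (fst k))) \<nu>)"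

lemma killed_sets: "k \<in> gr D \<Longrightarrow> sets (killed k) = sets borel"
  by (simp add: killed_def trans_sets)

lemma killed_space: "k \<in> gr D \<Longrightarrow> space (killed k) = UNIV"
  by (simp add: killed_def trans_space)

lemma minorization': "k \<in> gr D \<Longrightarrow> A \<in> sets borel \<Longrightarrow>
    ennreal (atom (fst k)) * emeasure \<nu> A \<le> emeasure (trans D k) A"
  using minorization[of k A] \<delta> by (auto simp: atom_def split: split_indicator)

lemma emeasure_killed:
  assumes k: "k \<in> gr D" and A: "A \<in> sets borel"
  shows "emeasure (killed k) A = emeasure (trans D k) A - ennreal (atom (fst k)) * emeasure \<nu> A"
proof -
  interpret T: prob_space "trans D k"
    by (rule trans_prob[OF k])
  interpret N: prob_space \<nu>
    by (rule \<nu>_prob)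
  have "finite_measure (scale_measure (ennreal (atom (fst k))) \<nu>)"
    by (rule finite_measureI) (simp add: ennreal_mult_eq_top_iff)
  then show ?thesis
    unfolding killed_def using k A
    by (subst emeasure_diff_measure) (auto simp: trans_sets \<nu>_sets minorization' T.finite_measure_axioms)
qed

lemma emeasure_trans:
  assumes k: "k \<in> gr D" and A: "A \<in> sets borel"
  shows "emeasure (trans D k) A = emeasure (killed k) A + ennreal (atom (fst k)) * emeasure \<nu> A"
  using minorization'[OF k A] by (simp add: emeasure_killed[OF k A] diff_add_cancel_ennreal)

lemma nn_integral_trans:
  assumes k: "k \<in> gr D" and f: "f \<in> borel_measurable borel"
  shows "(\<integral>\<^sup>+y. f y \<partial>trans D k) = (\<integral>\<^sup>+y. f y \<partial>killed k) + ennreal (atom (fst k)) * (\<integral>\<^sup>+y. f y \<partial>\<nu>)"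
  using nn_integral_lincomb_measure[of "killed k" "trans D k" \<nu> 1 "ennreal (atom (fst k))" f] k f
  by (simp add: killed_sets trans_sets \<nu>_sets emeasure_trans cong: measurable_cong_sets)

lemma killed_subprob: "k \<in> gr D \<Longrightarrow> subprob_space (killed k)"
proof
  assume k: "k \<in> gr D"
  interpret prob_space "trans D k"
    by (rule trans_prob[OF k])
  have "emeasure (killed k) (space (killed k)) \<le> emeasure (trans D k) UNIV"
    using k by (simp add: killed_space emeasure_trans)
  then show "emeasure (killed k) (space (killed k)) \<le> 1"
    using measure_le_1[of UNIV] by (rule order_trans)
  show "space (killed k) \<noteq> {}"
    using k by (simp add: killed_space)
qed

lemma fst_grM [measurable]: "fst \<in> grM D \<rightarrow>\<^sub>M borel"
  unfolding grM_def by (intro measurable_restrict_space1) (simp add: borel_prod[symmetric])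

lemma killed_meas: "killed \<in> grM D \<rightarrow>\<^sub>M subprob_algebra borel"
proof (rule measurable_subprob_algebra)
  show "(\<lambda>k. emeasure (killed k) A) \<in> borel_measurable (grM D)" if A: "A \<in> sets borel" for A
  proof -
    have "(\<lambda>k. emeasure (trans D k) A - ennreal (atom (fst k)) * emeasure \<nu> A) \<in> borel_measurable (grM D)"
      using measurable_compose[OF measurable_prob_algebraD[OF trans_meas] measurable_emeasure_subprob_algebra[OF A]]
      by measurable
    then show ?thesis
      by (rule measurable_cong[THEN iffD1, rotated]) (simp add: emeasure_killed A space_grM)
  qed
qed (auto simp: space_grM killed_subprob killed_sets)

lemma nn_integral_killed_meas:
  "f \<in> borel_measurable borel \<Longrightarrow> (\<lambda>k. \<integral>\<^sup>+y. f y \<partial>killed k) \<in> borel_measurable (grM D)"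
  by (rule measurable_compose[OF killed_meas nn_integral_measurable_subprob_algebra])

lemma nn_integral_trans_meas:
  "f \<in> borel_measurable borel \<Longrightarrow> (\<lambda>k. \<integral>\<^sup>+y. f y \<partial>trans D k) \<in> borel_measurable (grM D)"
  by (rule measurable_compose[OF measurable_prob_algebraD[OF trans_meas] nn_integral_measurable_subprob_algebra])

lemma Pair_meas: "(\<lambda>u. (x, u)) \<in> restrict_space borel (acts D x) \<rightarrow>\<^sub>M grM D"
  unfolding grM_def
  by (intro measurable_restrict_space2 measurable_restrict_space1)
    (auto simp: space_restrict_space gr_iff borel_prod[symmetric])

lemma Pair_meas': "sets \<kappa> = sets borel \<Longrightarrow> (\<lambda>u. (x, u)) \<in> restrict_space \<kappa> (acts D x) \<rightarrow>\<^sub>M grM D"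
  by (subst measurable_cong_sets[OF sets_restrict_space_cong refl]) (auto intro: Pair_meas)

lemma nn_integral_state_action:
  assumes \<kappa>: "sets \<kappa> = sets borel" and f: "f \<in> borel_measurable (grM D)"
  shows "(\<integral>\<^sup>+k. f k \<partial>state_action D \<kappa> x) = (\<integral>\<^sup>+u\<in>acts D x. f (x, u) \<partial>\<kappa>)"
proof -
  have "(\<integral>\<^sup>+k. f k \<partial>state_action D \<kappa> x) = (\<integral>\<^sup>+u. f (x, u) \<partial>restrict_space \<kappa> (acts D x))"
    unfolding state_action_def by (rule nn_integral_distr[OF Pair_meas'[OF \<kappa>]]) (simp add: f)
  also have "\<dots> = (\<integral>\<^sup>+u\<in>acts D x. f (x, u) \<partial>\<kappa>)"
    using acts(2) \<kappa> by (subst nn_integral_restrict_space) (auto simp: sets_eq_imp_space_eq[OF \<kappa>])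
  finally show ?thesis .
qed

lemma state_action_prob:
  assumes \<kappa>: "sets \<kappa> = sets borel" "emeasure \<kappa> (acts D x) = 1"
  shows "prob_space (state_action D \<kappa> x)"
proof -
  have "prob_space (restrict_space \<kappa> (acts D x))"
    using \<kappa> acts(2) by (intro prob_space_restrict_space) auto
  then show ?thesis
    unfolding state_action_def by (rule prob_space.prob_space_distr[OF _ Pair_meas'[OF \<kappa>(1)]])
qed

text \<open>A measurable subset of the graph is the trace of a Borel set of the product. As the
  action law is concentrated on the admissible actions, the trace may be replaced by the Borel set,
  and measurability of sections in the full product suffices.\<close>

lemma state_action_meas:
  assumes \<kappa>: "\<kappa> \<in> N \<rightarrow>\<^sub>M prob_algebra borel" and s: "s \<in> N \<rightarrow>\<^sub>M borel"
    and 1: "\<And>n. n \<in> space N \<Longrightarrow> emeasure (\<kappa> n) (acts D (s n)) = 1"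
  shows "(\<lambda>n. state_action D (\<kappa> n) (s n)) \<in> N \<rightarrow>\<^sub>M prob_algebra (grM D)"
proof (rule measurable_prob_algebraI)
  have \<kappa>_sets: "sets (\<kappa> n) = sets borel" if "n \<in> space N" for n
    using measurable_space[OF \<kappa> that] by (simp add: space_prob_algebra)
  show prob: "prob_space (state_action D (\<kappa> n) (s n))" if "n \<in> space N" for n
    using \<kappa>_sets[OF that] 1[OF that] by (rule state_action_prob)
  show "(\<lambda>n. state_action D (\<kappa> n) (s n)) \<in> N \<rightarrow>\<^sub>M subprob_algebra (grM D)"
  proof (rule measurable_subprob_algebra)
    show "subprob_space (state_action D (\<kappa> n) (s n))" if "n \<in> space N" for n
      using prob[OF that] by (rule prob_space_imp_subprob_space)
    show "sets (state_action D (\<kappa> n) (s n)) = sets (grM D)" for n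
      by (simp add: state_action_def)
    fix A assume A: "A \<in> sets (grM D)"
    then obtain A' where A': "A' \<in> sets borel" "A = A' \<inter> gr D"
      by (auto simp: grM_def sets_restrict_space)
    then have A'_pair: "A' \<in> sets (borel \<Otimes>\<^sub>M borel)"
      by (simp add: borel_prod[symmetric])
    have "emeasure (state_action D (\<kappa> n) (s n)) A = (\<integral>\<^sup>+u. indicator A' (s n, u) \<partial>\<kappa> n)" if n: "n \<in> space N" for n
    proof -
      interpret prob_space "\<kappa> n"
        using measurable_space[OF \<kappa> n] by (simp add: space_prob_algebra)
      have "emeasure (state_action D (\<kappa> n) (s n)) A = (\<integral>\<^sup>+k. indicator A k \<partial>state_action D (\<kappa> n) (s n))"
        using A by (subst nn_integral_indicator) (auto simp: state_action_def)
      also have "\<dots> = (\<integral>\<^sup>+u\<in>acts D (s n). indicator A (s n, u) \<partial>\<kappa> n)"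
        using A by (intro nn_integral_state_action \<kappa>_sets[OF n]) auto
      also have "\<dots> = (\<integral>\<^sup>+u. indicator A' (s n, u) \<partial>\<kappa> n)"
      proof (rule nn_integral_cong_AE)
        have "AE u in \<kappa> n. u \<in> acts D (s n)"
          using 1[OF n] by (intro AE_prob_1) (simp add: measure_def)
        then show "AE u in \<kappa> n. indicator A (s n, u) * indicator (acts D (s n)) u = (indicator A' (s n, u) :: ennreal)"
          by eventually_elim (auto simp: A' gr_iff split: split_indicator)
      qed
      finally show ?thesis .
    qed
    moreover have "(\<lambda>n. \<integral>\<^sup>+u. indicator A' (s n, u) \<partial>\<kappa> n) \<in> borel_measurable N"
    proof (rule nn_integral_measurable_subprob_algebra2[OF _ measurable_prob_algebraD[OF \<kappa>]])
      show "(\<lambda>(n, u). indicator A' (s n, u)) \<in> borel_measurable (N \<Otimes>\<^sub>M borel)"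
        using s A'_pair by measurable
    qed
    ultimately show "(\<lambda>n. emeasure (state_action D (\<kappa> n) (s n)) A) \<in> borel_measurable N"
      by (simp cong: measurable_cong)
  qed
qed

lemma stationaryD:
  assumes "v \<in> stationary D"
  shows "v \<in> borel \<rightarrow>\<^sub>M prob_algebra borel" "sets (v x) = sets borel" "prob_space (v x)"
    "emeasure (v x) (acts D x) = 1" "AE u in v x. u \<in> acts D x"
proof -
  show v: "v \<in> borel \<rightarrow>\<^sub>M prob_algebra borel" and 1: "emeasure (v x) (acts D x) = 1"
    using assms by (auto simp: stationary_def)
  show "sets (v x) = sets borel" "prob_space (v x)"
    using measurable_space[OF v, of x] by (simp_all add: space_prob_algebra)
  then interpret prob_space "v x"
    by simp
  show "AE u in v x. u \<in> acts D x"
    using 1 by (intro AE_prob_1) (simp add: measure_def)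
qed

lemma stationary_state_action_meas:
  assumes "v \<in> stationary D"
  shows "(\<lambda>x. state_action D (v x) x) \<in> borel \<rightarrow>\<^sub>M prob_algebra (grM D)"
  by (rule state_action_meas) (use stationaryD[OF assms] in auto)

lemma nn_integral_stationary_meas:
  assumes v: "v \<in> stationary D" and f: "f \<in> borel_measurable (grM D)"
  shows "(\<lambda>x. \<integral>\<^sup>+k. f k \<partial>state_action D (v x) x) \<in> borel_measurable borel"
  by (rule measurable_compose[OF measurable_prob_algebraD[OF stationary_state_action_meas[OF v]]
        nn_integral_measurable_subprob_algebra[OF f]])

lemma cost_of_eq:
  "v \<in> stationary D \<Longrightarrow> cost_of D v x = (\<integral>\<^sup>+k. cost D k \<partial>state_action D (v x) x)"
  by (simp add: cost_of_def nn_integral_state_action[OF stationaryD(2) cost_meas])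

text \<open>The sub-Markov operator of the chain killed at regeneration; its powers give
  expectations on the event of survival.\<close>

definition R :: "('x \<Rightarrow> 'u measure) \<Rightarrow> ('x \<Rightarrow> ennreal) \<Rightarrow> 'x \<Rightarrow> ennreal" where
  "R v g x = (\<integral>\<^sup>+k. (\<integral>\<^sup>+y. g y \<partial>killed k) \<partial>state_action D (v x) x)"

lemma state_action_gr: "k \<in> space (state_action D \<kappa> x) \<Longrightarrow> k \<in> gr D"
  by (simp add: state_action_def space_grM)

lemma state_action_AE_fst:
  assumes v: "v \<in> stationary D"
  shows "AE k in state_action D (v x) x. fst k = x"
  unfolding state_action_def
  by (subst AE_distr_iff[OF Pair_meas'[OF stationaryD(2)[OF v]]]) (auto simp: fst_grM)

lemma R_meas: "v \<in> stationary D \<Longrightarrow> g \<in> borel_measurable borel \<Longrightarrow> R v g \<in> borel_measurable borel"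
  unfolding R_def[abs_def] by (intro nn_integral_stationary_meas nn_integral_killed_meas)

lemma R_funpow_meas:
  "v \<in> stationary D \<Longrightarrow> g \<in> borel_measurable borel \<Longrightarrow> (R v ^^ n) g \<in> borel_measurable borel"
  by (induction n) (auto intro: R_meas)

lemma R_mono: "(\<And>x. f x \<le> g x) \<Longrightarrow> R v f x \<le> R v g x"
  unfolding R_def by (intro nn_integral_mono)

lemma R_add:
  assumes v: "v \<in> stationary D" and f: "f \<in> borel_measurable borel" and g: "g \<in> borel_measurable borel"
  shows "R v (\<lambda>x. f x + g x) x = R v f x + R v g x"
proof -
  have "R v (\<lambda>x. f x + g x) x =
      (\<integral>\<^sup>+k. (\<integral>\<^sup>+y. f y \<partial>killed k) + (\<integral>\<^sup>+y. g y \<partial>killed k) \<partial>state_action D (v x) x)"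
    unfolding R_def
    by (intro nn_integral_cong nn_integral_add)
      (use f g in \<open>auto dest!: state_action_gr simp: killed_sets cong: measurable_cong_sets\<close>)
  also have "\<dots> = R v f x + R v g x"
    unfolding R_def
    by (rule nn_integral_add)
      (use f g nn_integral_killed_meas in \<open>auto simp: state_action_def cong: measurable_cong_sets\<close>)
  finally show ?thesis .
qed

lemma R_cmult:
  assumes v: "v \<in> stationary D" and f: "f \<in> borel_measurable borel"
  shows "R v (\<lambda>x. c * f x) x = c * R v f x"
proof -
  have "R v (\<lambda>x. c * f x) x = (\<integral>\<^sup>+k. c * (\<integral>\<^sup>+y. f y \<partial>killed k) \<partial>state_action D (v x) x)"
    unfolding R_def
    by (intro nn_integral_cong nn_integral_cmult)
      (use f in \<open>auto dest!: state_action_gr simp: killed_sets cong: measurable_cong_sets\<close>)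
  also have "\<dots> = c * R v f x"
    unfolding R_def
    by (rule nn_integral_cmult)
      (use f nn_integral_killed_meas in \<open>auto simp: state_action_def cong: measurable_cong_sets\<close>)
  finally show ?thesis .
qed

lemma R_funpow_add:
  assumes v: "v \<in> stationary D" and f: "f \<in> borel_measurable borel" and g: "g \<in> borel_measurable borel"
  shows "(R v ^^ n) (\<lambda>x. f x + g x) x = (R v ^^ n) f x + (R v ^^ n) g x"
proof (induction n arbitrary: x)
  case (Suc n)
  then have "(R v ^^ n) (\<lambda>x. f x + g x) = (\<lambda>x. (R v ^^ n) f x + (R v ^^ n) g x)"
    by blast
  then show ?case
    using R_add[OF v R_funpow_meas[OF v f, of n] R_funpow_meas[OF v g, of n]] by simp
qed simp

lemma R_funpow_cmult:
  assumes v: "v \<in> stationary D" and f: "f \<in> borel_measurable borel"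
  shows "(R v ^^ n) (\<lambda>x. c * f x) x = c * (R v ^^ n) f x"
proof (induction n arbitrary: x)
  case (Suc n)
  then have "(R v ^^ n) (\<lambda>x. c * f x) = (\<lambda>x. c * (R v ^^ n) f x)"
    by blast
  then show ?case
    using R_cmult[OF v R_funpow_meas[OF v f, of n]] by simp
qed simp

lemma R_funpow_mono: "(\<And>x. f x \<le> g x) \<Longrightarrow> (R v ^^ n) f x \<le> (R v ^^ n) g x"
  by (induction n arbitrary: x) (auto intro: R_mono)

text \<open>The transition law and \<nu> both have mass 1, so the mass that killing removes at
  \<open>x\<close> is exactly \<open>atom x\<close>. Summed along the chain this is the balance
  between survival and regeneration.\<close>

lemma R_one: 
  assumes v: "v \<in> stationary D"
  shows "R v (\<lambda>_. 1) x + ennreal (atom x) = 1"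
proof -
  interpret prob_space "state_action D (v x) x"
    using stationaryD[OF v] by (intro state_action_prob)
  interpret N: prob_space \<nu>
    by (rule \<nu>_prob)
  have meas: "(\<lambda>k. emeasure (killed k) UNIV) \<in> borel_measurable (state_action D (v x) x)"
    using nn_integral_killed_meas[of "\<lambda>_. 1"]
    by (simp add: state_action_def cong: measurable_cong_sets)
      (metis (no_types, lifting) killed_space measurable_cong space_grM)
  have "R v (\<lambda>_. 1) x = (\<integral>\<^sup>+k. emeasure (killed k) UNIV \<partial>state_action D (v x) x)"
    unfolding R_def by (intro nn_integral_cong) (auto dest!: state_action_gr simp: killed_space)
  then have "R v (\<lambda>_. 1) x + ennreal (atom x) =
      (\<integral>\<^sup>+k. emeasure (killed k) UNIV + ennreal (atom x) \<partial>state_action D (v x) x)"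
    using meas by (simp add: nn_integral_add emeasure_space_1)
  also have "\<dots> = (\<integral>\<^sup>+k. 1 \<partial>state_action D (v x) x)"
  proof (rule nn_integral_cong_AE)
    show "AE k in state_action D (v x) x. emeasure (killed k) UNIV + ennreal (atom x) = 1"
      using state_action_AE_fst[OF v, of x] AE_space
    proof eventually_elim
      case (elim k)
      then have k: "k \<in> gr D"
        by (simp add: state_action_gr)
      have "emeasure (trans D k) UNIV = 1" "emeasure \<nu> UNIV = 1"
        using prob_space.emeasure_space_1[OF trans_prob[OF k]] N.emeasure_space_1
        by (simp_all add: trans_space[OF k] \<nu>_space)
      then show ?case
        using emeasure_trans[OF k, of UNIV] elim by simp
    qed
  qed
  also have "\<dots> = 1"
    by (simp add: emeasure_space_1)
  finally show ?thesis .
qed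

end

section \<open>The split chain\<close>

context mdp_setting
begin

lemma space_split_space: "space (split_space B) = UNIV \<times> {False} \<union> B \<times> {True}"
  by (simp add: split_space_def space_restrict_space space_pair_measure)

lemma split_dom_sets: "UNIV \<times> {False} \<union> B \<times> {True} \<in> sets (borel \<Otimes>\<^sub>M count_space UNIV)"
  by (intro sets.Un pair_measureI) auto

lemma slice_sets:
  assumes "S \<in> sets (split_space B)"
  shows "{x. (x, i) \<in> S} \<in> sets borel"
proof -
  obtain S' where S': "S' \<in> sets (borel \<Otimes>\<^sub>M count_space UNIV)" "S = (UNIV \<times> {False} \<union> B \<times> {True}) \<inter> S'"
    using assms by (auto simp: split_space_def sets_restrict_space)
  have "S \<in> sets (borel \<Otimes>\<^sub>M count_space UNIV)"
    unfolding S'(2) by (intro sets.Int split_dom_sets S'(1))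
  from sets_Pair2[OF this, of i] show ?thesis
    by (simp add: vimage_def)
qed

lemma slice_True: "S \<in> sets (split_space B) \<Longrightarrow> {x. (x, True) \<in> S} \<subseteq> B"
  using sets.sets_into_space[of S "split_space B"] by (auto simp: space_split_space)

lemma split_space_top: "UNIV \<times> {False} \<union> B \<times> {True} \<in> sets (split_space B)"
  using sets.top[of "split_space B"] by (simp only: space_split_space)

lemma sets_split_measure [simp]: "sets (split_measure B \<delta> \<mu>) = sets (split_space B)"
  and space_split_measure [simp]: "space (split_measure B \<delta> \<mu>) = space (split_space B)"
  by (simp_all add: split_measure_def sets.sigma_sets_eq sets.space_closed)

lemma emeasure_split_measure:
  assumes \<mu>: "sets \<mu> = sets borel" and S: "S \<in> sets (split_space B)"
  shows "emeasure (split_measure B \<delta> \<mu>) S =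
     ennreal (1 - \<delta>) * emeasure \<mu> ({x. (x, False) \<in> S} \<inter> B) +
     emeasure \<mu> ({x. (x, False) \<in> S} - B) + ennreal \<delta> * emeasure \<mu> {x. (x, True) \<in> S}"
proof (rule emeasure_measure_of[OF split_measure_def])
  show "sets (split_space B) \<subseteq> Pow (space (split_space B))"
    by (rule sets.space_closed)
  show "S \<in> sets (split_measure B \<delta> \<mu>)"
    using S by simp
  show "positive (sets (split_measure B \<delta> \<mu>)) (\<lambda>S. ennreal (1 - \<delta>) * emeasure \<mu> ({x. (x, False) \<in> S} \<inter> B) +
          emeasure \<mu> ({x. (x, False) \<in> S} - B) + ennreal \<delta> * emeasure \<mu> {x. (x, True) \<in> S})"
    by (simp add: positive_def)
  show "countably_additive (sets (split_measure B \<delta> \<mu>)) (\<lambda>S. ennreal (1 - \<delta>) * emeasure \<mu> ({x. (x, False) \<in> S} \<inter> B) +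
          emeasure \<mu> ({x. (x, False) \<in> S} - B) + ennreal \<delta> * emeasure \<mu> {x. (x, True) \<in> S})"
    unfolding sets_split_measure
  proof (rule countably_additiveI)
    fix A :: "nat \<Rightarrow> ('x \<times> bool) set"
    assume A: "range A \<subseteq> sets (split_space B)" "disjoint_family A"
    have An: "A i \<in> sets (split_space B)" for i
      using A by auto
    have 1: "(\<Sum>i. emeasure \<mu> ({x. (x, False) \<in> A i} \<inter> B)) = emeasure \<mu> (\<Union>i. {x. (x, False) \<in> A i} \<inter> B)"
      using A(2) slice_sets[OF An] \<mu>
      by (intro suminf_emeasure) (auto simp: disjoint_family_on_def)
    have 2: "(\<Sum>i. emeasure \<mu> ({x. (x, False) \<in> A i} - B)) = emeasure \<mu> (\<Union>i. {x. (x, False) \<in> A i} - B)"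
      using A(2) slice_sets[OF An] \<mu>
      by (intro suminf_emeasure) (auto simp: disjoint_family_on_def)
    have 3: "(\<Sum>i. emeasure \<mu> {x. (x, True) \<in> A i}) = emeasure \<mu> (\<Union>i. {x. (x, True) \<in> A i})"
      using A(2) slice_sets[OF An] \<mu>
      by (intro suminf_emeasure) (auto simp: disjoint_family_on_def)
    have eq: "(\<Union>i. {x. (x, False) \<in> A i} \<inter> B) = {x. (x, False) \<in> (\<Union>i. A i)} \<inter> B"
      "(\<Union>i. {x. (x, False) \<in> A i} - B) = {x. (x, False) \<in> (\<Union>i. A i)} - B"
      "(\<Union>i. {x. (x, True) \<in> A i}) = {x. (x, True) \<in> (\<Union>i. A i)}"
      by auto
    show "(\<Sum>i. ennreal (1 - \<delta>) * emeasure \<mu> ({x. (x, False) \<in> A i} \<inter> B) +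
          emeasure \<mu> ({x. (x, False) \<in> A i} - B) + ennreal \<delta> * emeasure \<mu> {x. (x, True) \<in> A i}) =
        ennreal (1 - \<delta>) * emeasure \<mu> ({x. (x, False) \<in> (\<Union>i. A i)} \<inter> B) +
          emeasure \<mu> ({x. (x, False) \<in> (\<Union>i. A i)} - B) + ennreal \<delta> * emeasure \<mu> {x. (x, True) \<in> (\<Union>i. A i)}"
      by (simp only: suminf_add[symmetric] summableI ennreal_suminf_cmult 1 2 3 eq)
  qed
qed

lemma Pair_False_meas: "(\<lambda>x. (x, False)) \<in> borel \<rightarrow>\<^sub>M split_space B"
  unfolding split_space_def by (intro measurable_restrict_space2) auto

lemma fst_split_space [measurable]: "fst \<in> split_space B \<rightarrow>\<^sub>M borel"
  and snd_split_space [measurable]: "snd \<in> split_space B \<rightarrow>\<^sub>M count_space UNIV"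
  unfolding split_space_def by (auto intro!: measurable_restrict_space1)

lemma atom_set_sets: "B \<times> {True} \<in> sets (split_space B)"
proof -
  have "B \<times> {True} = (UNIV \<times> {False} \<union> B \<times> {True}) \<inter> (B \<times> {True})"
    by auto
  moreover have "B \<times> {True} \<in> sets (borel \<Otimes>\<^sub>M count_space UNIV)"
    by (rule pair_measureI) auto
  ultimately show ?thesis
    unfolding split_space_def sets_restrict_space by blast
qed

text \<open>Level 1 is where a cycle stops, so only level 0 contributes to a taboo transition; its
  share of the mass at \<open>x\<close> is \<open>1 - atom x\<close>.\<close>

lemma nn_integral_split_measure_False:
  assumes \<mu>: "sets \<mu> = sets borel" and g: "g \<in> borel_measurable (split_space B)"
  shows "(\<integral>\<^sup>+z\<in>space (split_space B) - B \<times> {True}. g z \<partial>split_measure B \<delta> \<mu>) =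
    (\<integral>\<^sup>+x. ennreal (1 - atom x) * g (x, False) \<partial>\<mu>)"
proof -
  let ?C = "space (split_space B) - B \<times> {True}"
  let ?N = "distr (density \<mu> (\<lambda>x. ennreal (1 - atom x))) (split_space B) (\<lambda>x. (x, False))"
  have C: "?C \<in> sets (split_space B)"
    using atom_set_sets by auto
  have meas1: "(\<lambda>x. ennreal (1 - atom x)) \<in> borel_measurable \<mu>"
    using \<mu> by (simp cong: measurable_cong_sets)
  have meas2: "(\<lambda>x. (x, False)) \<in> density \<mu> (\<lambda>x. ennreal (1 - atom x)) \<rightarrow>\<^sub>M split_space B"
    using Pair_False_meas \<mu> by (simp cong: measurable_cong_sets)
  have "density (split_measure B \<delta> \<mu>) (indicator ?C) = ?N"
  proof (rule measure_eqI)
    fix S assume "S \<in> sets (density (split_measure B \<delta> \<mu>) (indicator ?C))"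
    then have S: "S \<in> sets (split_space B)"
      by simp
    let ?S = "{x. (x, False) \<in> S}"
    have S': "?S \<in> sets borel"
      by (rule slice_sets[OF S])
    have slices: "{x. (x, False) \<in> S \<inter> ?C} = ?S" "{x. (x, True) \<in> S \<inter> ?C} = {}"
      using slice_True[OF S] by (auto simp: space_split_space)
    have "emeasure (density (split_measure B \<delta> \<mu>) (indicator ?C)) S =
        emeasure (split_measure B \<delta> \<mu>) (S \<inter> ?C)"
    proof -
      have "emeasure (density (split_measure B \<delta> \<mu>) (indicator ?C)) S =
          (\<integral>\<^sup>+z. indicator ?C z * indicator S z \<partial>split_measure B \<delta> \<mu>)"
        using S borel_measurable_indicator[OF C, where 'b = ennreal]
        by (subst emeasure_density) (simp_all add: measurable_cong_sets[OF sets_split_measure refl])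
      also have "\<dots> = (\<integral>\<^sup>+z. indicator (S \<inter> ?C) z \<partial>split_measure B \<delta> \<mu>)"
        by (intro nn_integral_cong) (auto split: split_indicator)
      also have "\<dots> = emeasure (split_measure B \<delta> \<mu>) (S \<inter> ?C)"
        using S C by (intro nn_integral_indicator) auto
      finally show ?thesis .
    qed
    also have "\<dots> = ennreal (1 - \<delta>) * emeasure \<mu> (?S \<inter> B) + emeasure \<mu> (?S - B)"
      by (simp only: emeasure_split_measure[OF \<mu> sets.Int[OF S C]] slices) simp
    also have "\<dots> = (\<integral>\<^sup>+x. ennreal (1 - \<delta>) * indicator (?S \<inter> B) x + indicator (?S - B) x \<partial>\<mu>)"
      using S' \<mu> by (simp add: nn_integral_add nn_integral_cmult)
    also have "\<dots> = (\<integral>\<^sup>+x. ennreal (1 - atom x) * indicator ?S x \<partial>\<mu>)"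
      by (rule nn_integral_cong) (auto simp: atom split: split_indicator)
    also have "\<dots> = emeasure (density \<mu> (\<lambda>x. ennreal (1 - atom x))) ?S"
      using S' \<mu> meas1 by (simp add: emeasure_density)
    also have "\<dots> = emeasure ?N S"
      using S \<mu> by (subst emeasure_distr[OF meas2]) (auto simp: vimage_def sets_eq_imp_space_eq[OF \<mu>])
    finally show "emeasure (density (split_measure B \<delta> \<mu>) (indicator ?C)) S = emeasure ?N S" .
  qed simp
  have g': "g \<in> borel_measurable (split_measure B \<delta> \<mu>)"
    using g by (simp cong: measurable_cong_sets)
  have "(\<integral>\<^sup>+z\<in>?C. g z \<partial>split_measure B \<delta> \<mu>) = (\<integral>\<^sup>+z. g z \<partial>density (split_measure B \<delta> \<mu>) (indicator ?C))"
    using g' borel_measurable_indicator[OF C, where 'b = ennreal]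
    by (subst nn_integral_density) (simp_all add: measurable_cong_sets[OF sets_split_measure refl] mult.commute)
  also have "\<dots> = (\<integral>\<^sup>+z. g z \<partial>?N)"
    by (simp add: \<open>density (split_measure B \<delta> \<mu>) (indicator ?C) = ?N\<close>)
  also have "\<dots> = (\<integral>\<^sup>+x. g (x, False) \<partial>density \<mu> (\<lambda>x. ennreal (1 - atom x)))"
    by (rule nn_integral_distr[OF meas2]) (simp add: g)
  also have "\<dots> = (\<integral>\<^sup>+x. ennreal (1 - atom x) * g (x, False) \<partial>\<mu>)"
  proof (rule nn_integral_density[OF meas1])
    show "(\<lambda>x. g (x, False)) \<in> borel_measurable \<mu>"
      using measurable_compose[OF Pair_False_meas g] \<mu> by (simp cong: measurable_cong_sets)
  qed
  finally show ?thesis .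
qed

text \<open>The killed measure has mass \<open>1 - atom\<close>, so normalizing it covers both cases
  of the split kernel on level 0 by one formula: the residual kernel divided by
  \<open>1 - \<delta>\<close> on \<open>B\<close>, the split of the original kernel
  elsewhere.\<close>

definition split_step :: "'x \<times> 'u \<Rightarrow> ('x \<times> bool) measure" where
  "split_step k = scale_measure (ennreal (1 / (1 - atom (fst k)))) (split_measure B \<delta> (killed k))"

lemma split_step_prob:
  assumes k: "k \<in> gr D"
  shows "prob_space (split_step k)"
proof
  interpret T: prob_space "trans D k"
    by (rule trans_prob[OF k])
  interpret N: prob_space \<nu>
    by (rule \<nu>_prob)
  let ?\<kappa> = "killed k"
  have "emeasure (split_measure B \<delta> ?\<kappa>) (space (split_space B)) =
      ennreal (1 - \<delta>) * emeasure ?\<kappa> B + emeasure ?\<kappa> (- B) + ennreal \<delta> * emeasure ?\<kappa> B"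
    using killed_sets[OF k] split_space_top
    by (subst emeasure_split_measure) (auto simp: space_split_space Compl_eq_Diff_UNIV)
  also have "\<dots> = (ennreal (1 - \<delta>) + ennreal \<delta>) * emeasure ?\<kappa> B + emeasure ?\<kappa> (- B)"
    by (simp add: distrib_right ac_simps del: ennreal_plus)
  also have "\<dots> = emeasure ?\<kappa> B + emeasure ?\<kappa> (- B)"
    using \<delta> by (simp add: ennreal_plus[symmetric] del: ennreal_plus)
  also have "\<dots> = emeasure ?\<kappa> UNIV"
    using killed_sets[OF k] by (subst plus_emeasure) auto
  also have "\<dots> = 1 - ennreal (atom (fst k))"
    using T.emeasure_space_1 N.emeasure_space_1 k
    by (simp add: emeasure_killed trans_space \<nu>_space)
  also have "\<dots> = ennreal (1 - atom (fst k))"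
    using atom by (simp add: ennreal_minus[symmetric] del: ennreal_minus)
  finally have "emeasure (split_step k) (space (split_space B)) =
      ennreal (1 / (1 - atom (fst k))) * ennreal (1 - atom (fst k))"
    by (simp add: split_step_def)
  also have "\<dots> = 1"
    using atom(2)[of "fst k"] by (simp add: ennreal_mult[symmetric])
  finally show "emeasure (split_step k) (space (split_step k)) = 1"
    by (simp add: split_step_def space_scale_measure)
qed

lemma split_step_meas: "split_step \<in> grM D \<rightarrow>\<^sub>M prob_algebra (split_space B)"
proof (rule measurable_prob_algebraI)
  show "prob_space (split_step k)" if "k \<in> space (grM D)" for k
    using that by (simp add: space_grM split_step_prob)
  show "split_step \<in> grM D \<rightarrow>\<^sub>M subprob_algebra (split_space B)"
  proof (rule measurable_subprob_algebra)
    show "subprob_space (split_step k)" if "k \<in> space (grM D)" for k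
      using that by (simp add: space_grM split_step_prob prob_space_imp_subprob_space)
    show "sets (split_step k) = sets (split_space B)" for k
      by (simp add: split_step_def)
    fix S assume S: "S \<in> sets (split_space B)"
    have killed_A: "(\<lambda>k. emeasure (killed k) A) \<in> borel_measurable (grM D)" if "A \<in> sets borel" for A
      using measurable_compose[OF killed_meas measurable_emeasure_subprob_algebra[OF that]] .
    note [measurable] = killed_A[OF sets.Int[OF slice_sets[OF S, of False] B_sets]]
      killed_A[OF sets.Diff[OF slice_sets[OF S, of False] B_sets]] killed_A[OF slice_sets[OF S, of True]]
    have "(\<lambda>k. ennreal (1 / (1 - atom (fst k))) * (ennreal (1 - \<delta>) * emeasure (killed k) ({x. (x, False) \<in> S} \<inter> B) +
         emeasure (killed k) ({x. (x, False) \<in> S} - B) + ennreal \<delta> * emeasure (killed k) {x. (x, True) \<in> S}))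
      \<in> borel_measurable (grM D)"
      by measurable
    then show "(\<lambda>k. emeasure (split_step k) S) \<in> borel_measurable (grM D)"
      by (rule measurable_cong[THEN iffD1, rotated])
        (simp add: split_step_def emeasure_split_measure[OF killed_sets S] space_grM)
  qed
qed

text \<open>Splitting is linear in the measure, so splitting and removing the multiple of \<nu> can
  be interchanged. Finiteness of the split measures is what permits subtraction.\<close>

lemma split_trans_False:
  assumes u: "u \<in> acts D x"
  shows "split_trans D B \<nu> \<delta> (x, False) u = split_step (x, u)"
proof (rule measure_eqI)
  have k: "(x, u) \<in> gr D"
    using u by (simp add: gr_iff)
  interpret T: prob_space "trans D (x, u)"
    by (rule trans_prob[OF k])
  interpret N: prob_space \<nu>
    by (rule \<nu>_prob)
  show "sets (split_trans D B \<nu> \<delta> (x, False) u) = sets (split_step (x, u))"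
    by (auto simp: split_trans_def split_step_def)
  fix S assume "S \<in> sets (split_trans D B \<nu> \<delta> (x, False) u)"
  then have S: "S \<in> sets (split_space B)"
    by (auto simp: split_trans_def split: if_splits)
  have lin: "emeasure (split_measure B \<delta> (trans D (x, u))) S =
      emeasure (split_measure B \<delta> (killed (x, u))) S + ennreal (atom x) * emeasure (split_measure B \<delta> \<nu>) S"
    if S: "S \<in> sets (split_space B)" for S
    using S k slice_sets[OF S]
    by (simp add: emeasure_split_measure trans_sets killed_sets \<nu>_sets emeasure_trans distrib_left ac_simps)
  have fin: "emeasure (split_measure B \<delta> \<nu>) S \<noteq> \<top>" "emeasure (split_measure B \<delta> (trans D (x, u))) S \<noteq> \<top>"
    if S: "S \<in> sets (split_space B)" for S
    using S k by (simp_all add: emeasure_split_measure trans_sets \<nu>_sets ennreal_mult_eq_top_iff)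
  show "emeasure (split_trans D B \<nu> \<delta> (x, False) u) S = emeasure (split_step (x, u)) S"
  proof (cases "x \<in> B")
    case True
    have "emeasure (diff_measure (split_measure B \<delta> (trans D (x, u)))
           (scale_measure (ennreal \<delta>) (split_measure B \<delta> \<nu>))) S =
        emeasure (split_measure B \<delta> (trans D (x, u))) S - ennreal \<delta> * emeasure (split_measure B \<delta> \<nu>) S"
      using S fin lin True
      by (subst emeasure_diff_measure)
        (auto intro!: finite_measureI simp: atom ennreal_mult_eq_top_iff space_scale_measure)
    also have "\<dots> = emeasure (split_measure B \<delta> (killed (x, u))) S"
      using lin[OF S] fin[OF S] True by (simp add: atom ennreal_mult_eq_top_iff)
    finally show ?thesis
      using True by (simp add: split_trans_def split_step_def atom)
  next
    case False
    then show ?thesis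
      using lin[OF S] by (simp add: split_trans_def split_step_def atom)
  qed
qed

lemma split_\<nu>_prob: "prob_space (split_measure B \<delta> \<nu>)"
proof (rule prob_spaceI)
  interpret prob_space \<nu>
    by (rule \<nu>_prob)
  have "emeasure \<nu> B + emeasure \<nu> (- B) = emeasure \<nu> UNIV"
    by (subst plus_emeasure) (auto simp: \<nu>_sets)
  then have "1 + emeasure \<nu> (- B) = 1 + 0"
    using emeasure_space_1 by (simp add: \<nu>_B \<nu>_space)
  then have "emeasure \<nu> (- B) = 0"
    by (subst (asm) ennreal_add_left_cancel) simp
  moreover have "emeasure (split_measure B \<delta> \<nu>) (space (split_space B)) =
      ennreal (1 - \<delta>) * emeasure \<nu> B + emeasure \<nu> (- B) + ennreal \<delta> * emeasure \<nu> B"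
    using split_space_top
    by (subst emeasure_split_measure[OF \<nu>_sets]) (auto simp: space_split_space Compl_eq_Diff_UNIV)
  ultimately show "emeasure (split_measure B \<delta> \<nu>) (space (split_measure B \<delta> \<nu>)) = 1"
    using \<delta> by (simp add: \<nu>_B ennreal_plus[symmetric] del: ennreal_plus)
qed

lemma split_kernel_True:
  assumes v: "v \<in> stationary D"
  shows "split_kernel D B \<nu> \<delta> v (x, True) = split_measure B \<delta> \<nu>"
proof -
  have r: "prob_space (restrict_space (v x) (acts D x))"
    using acts(2) stationaryD[OF v] by (intro prob_space_restrict_space) auto
  have "split_kernel D B \<nu> \<delta> v (x, True) = restrict_space (v x) (acts D x) \<bind> (\<lambda>_. split_measure B \<delta> \<nu>)"
    by (simp add: split_kernel_def split_trans_def)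
  also have "\<dots> = split_measure B \<delta> \<nu>"
    by (rule bind_const'[OF r prob_space_imp_subprob_space[OF split_\<nu>_prob]])
  finally show ?thesis .
qed

lemma split_kernel_False:
  assumes v: "v \<in> stationary D"
  shows "split_kernel D B \<nu> \<delta> v (x, False) = state_action D (v x) x \<bind> split_step"
proof -
  have r: "prob_space (restrict_space (v x) (acts D x))"
    using acts(2) stationaryD[OF v] by (intro prob_space_restrict_space) auto
  have "split_kernel D B \<nu> \<delta> v (x, False) = restrict_space (v x) (acts D x) \<bind> (\<lambda>u. split_step (x, u))"
    unfolding split_kernel_def fst_conv
    by (intro bind_cong refl split_trans_False) (simp add: space_restrict_space)
  also have "\<dots> = state_action D (v x) x \<bind> split_step"
    unfolding state_action_def
    by (subst bind_distr[OF Pair_meas'[OF stationaryD(2)[OF v]] measurable_prob_algebraD[OF split_step_meas]])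
      (use prob_space.not_empty[OF r] in \<open>auto simp: comp_def\<close>)
  finally show ?thesis .
qed

lemma split_kernel_meas:
  assumes v: "v \<in> stationary D"
  shows "split_kernel D B \<nu> \<delta> v \<in> split_space B \<rightarrow>\<^sub>M prob_algebra (split_space B)"
proof -
  have 1: "(\<lambda>x. state_action D (v x) x \<bind> split_step) \<in> borel \<rightarrow>\<^sub>M prob_algebra (split_space B)"
    by (rule measurable_bind_prob_space[OF stationary_state_action_meas[OF v] split_step_meas])
  have p: "split_measure B \<delta> \<nu> \<in> space (prob_algebra (split_space B))"
    using split_\<nu>_prob by (simp add: space_prob_algebra)
  have "(\<lambda>z. if snd z then split_measure B \<delta> \<nu> else state_action D (v (fst z)) (fst z) \<bind> split_step)
      \<in> split_space B \<rightarrow>\<^sub>M prob_algebra (split_space B)"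
    by (intro measurable_If measurable_const p measurable_compose[OF fst_split_space 1]) measurable
  moreover have "split_kernel D B \<nu> \<delta> v =
      (\<lambda>z. if snd z then split_measure B \<delta> \<nu> else state_action D (v (fst z)) (fst z) \<bind> split_step)"
    using split_kernel_True[OF v] split_kernel_False[OF v] by (auto simp: fun_eq_iff)
  ultimately show ?thesis
    by simp
qed

text \<open>The weight \<open>1 - atom\<close> intertwines the split chain, stopped at level 1, with
  the killed kernel: at the starting point it cancels the normalization of
  \<open>split_step\<close>, and at the end point it reappears as the share of level 0. This removes
  the split space from all later computations.\<close>

lemma taboo_step_False:
  assumes v: "v \<in> stationary D" and g: "g \<in> borel_measurable (split_space B)"
  shows "ennreal (1 - atom x) *
      (\<integral>\<^sup>+z\<in>space (split_space B) - B \<times> {True}. g z \<partial>split_kernel D B \<nu> \<delta> v (x, False)) =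
    R v (\<lambda>y. ennreal (1 - atom y) * g (y, False)) x"
proof -
  let ?C = "space (split_space B) - B \<times> {True}"
  have gC: "(\<lambda>z. g z * indicator ?C z) \<in> borel_measurable (split_space B)"
    using g atom_set_sets by measurable
  have gF: "(\<lambda>y. ennreal (1 - atom y) * g (y, False)) \<in> borel_measurable borel"
    using measurable_compose[OF Pair_False_meas g] by measurable
  have step_meas: "split_step \<in> state_action D (v x) x \<rightarrow>\<^sub>M subprob_algebra (split_space B)"
    using measurable_prob_algebraD[OF split_step_meas] by (simp add: state_action_def cong: measurable_cong_sets)
  have int_meas: "(\<lambda>k. \<integral>\<^sup>+z\<in>?C. g z \<partial>split_step k) \<in> borel_measurable (state_action D (v x) x)"
    by (rule measurable_compose[OF step_meas nn_integral_measurable_subprob_algebra[OF gC]])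
  have "ennreal (1 - atom x) * (\<integral>\<^sup>+z\<in>?C. g z \<partial>split_kernel D B \<nu> \<delta> v (x, False)) =
      ennreal (1 - atom x) * (\<integral>\<^sup>+k. (\<integral>\<^sup>+z\<in>?C. g z \<partial>split_step k) \<partial>state_action D (v x) x)"
    unfolding split_kernel_False[OF v] by (subst nn_integral_bind[OF gC step_meas]) simp
  also have "\<dots> = (\<integral>\<^sup>+k. ennreal (1 - atom x) * (\<integral>\<^sup>+z\<in>?C. g z \<partial>split_step k) \<partial>state_action D (v x) x)"
    by (rule nn_integral_cmult[OF int_meas, symmetric])
  also have "\<dots> = R v (\<lambda>y. ennreal (1 - atom y) * g (y, False)) x"
    unfolding R_def
  proof (rule nn_integral_cong_AE)
    show "AE k in state_action D (v x) x. ennreal (1 - atom x) * (\<integral>\<^sup>+z\<in>?C. g z \<partial>split_step k) =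
        (\<integral>\<^sup>+y. ennreal (1 - atom y) * g (y, False) \<partial>killed k)"
      using state_action_AE_fst[OF v, of x] AE_space
    proof eventually_elim
      case (elim k)
      then have k: "k \<in> gr D"
        by (simp add: state_action_gr)
      have "(\<integral>\<^sup>+z\<in>?C. g z \<partial>split_step k) =
          ennreal (1 / (1 - atom x)) * (\<integral>\<^sup>+z\<in>?C. g z \<partial>split_measure B \<delta> (killed k))"
        unfolding split_step_def elim(1)
        by (rule nn_integral_scale_measure) (use gC in \<open>simp cong: measurable_cong_sets\<close>)
      also have "\<dots> = ennreal (1 / (1 - atom x)) * (\<integral>\<^sup>+y. ennreal (1 - atom y) * g (y, False) \<partial>killed k)"
        by (simp add: nn_integral_split_measure_False[OF killed_sets[OF k] g])
      finally show ?case
        using atom(2)[of x] by (simp add: mult.assoc[symmetric] ennreal_mult[symmetric])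
    qed
  qed
  finally show ?thesis .
qed

lemma taboo_funpow:
  assumes v: "v \<in> stationary D" and f: "f \<in> borel_measurable (split_space B)"
  defines "T \<equiv> \<lambda>g z. \<integral>\<^sup>+y\<in>space (split_space B) - B \<times> {True}. g y \<partial>split_kernel D B \<nu> \<delta> v z"
  shows "(T ^^ n) f \<in> borel_measurable (split_space B)"
    and "ennreal (1 - atom x) * (T ^^ n) f (x, False) = (R v ^^ n) (\<lambda>y. ennreal (1 - atom y) * f (y, False)) x"
proof -
  have T: "T g \<in> borel_measurable (split_space B)" if g: "g \<in> borel_measurable (split_space B)" for g
  proof -
    have "(\<lambda>z. g z * indicator (space (split_space B) - B \<times> {True}) z) \<in> borel_measurable (split_space B)"
      using g atom_set_sets by measurable
    then show ?thesis
      unfolding T_def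
      by (rule measurable_compose[OF measurable_prob_algebraD[OF split_kernel_meas[OF v]]
            nn_integral_measurable_subprob_algebra])
  qed
  show meas: "(T ^^ n) f \<in> borel_measurable (split_space B)" for n
    by (induction n) (auto intro: T f)
  show "ennreal (1 - atom x) * (T ^^ n) f (x, False) = (R v ^^ n) (\<lambda>y. ennreal (1 - atom y) * f (y, False)) x"
  proof (induction n arbitrary: x)
    case (Suc n)
    then have "(R v ^^ n) (\<lambda>y. ennreal (1 - atom y) * f (y, False)) =
        (\<lambda>x. ennreal (1 - atom x) * (T ^^ n) f (x, False))"
      by auto
    then show ?case
      using taboo_step_False[OF v meas[of n], of x] by (simp add: T_def)
  qed simp
qed

text \<open>The iterated intertwining. The weight on the left is the prefactor in the definition of
  \<open>V_star\<close>, and the weight inside cancels the factor \<open>1 / (1 - \<delta>)\<close>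
  of the split cost.\<close>

lemma split_cycle_sum_eq:
  assumes v: "v \<in> stationary D" and f: "f \<in> borel_measurable (split_space B)"
  shows "ennreal (1 - atom x) * split_cycle_sum D B \<nu> \<delta> v f (x, False) =
    (\<Sum>n. (R v ^^ n) (\<lambda>y. ennreal (1 - atom y) * f (y, False)) x)"
proof -
  have "split_cycle_sum D B \<nu> \<delta> v f (x, False) =
    (\<Sum>n. ((\<lambda>g z. \<integral>\<^sup>+y\<in>space (split_space B) - B \<times> {True}. g y \<partial>split_kernel D B \<nu> \<delta> v z) ^^ n) f (x, False))"
    unfolding split_cycle_sum_def split_law_def
    by (rule nn_integral_chain_law_hitting_time[OF split_kernel_meas[OF v] _ atom_set_sets f])
      (simp add: space_split_space)
  then show ?thesis
    by (simp add: taboo_funpow(2)[OF v f, symmetric] ennreal_suminf_cmult)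
qed

end

section \<open>Total cost up to regeneration\<close>

lemma ennreal_suminf_finite_tendsto_0:
  fixes f :: "nat \<Rightarrow> ennreal"
  assumes "(\<Sum>n. f n) < \<infinity>"
  shows "f \<longlonglongrightarrow> 0"
proof -
  have "f n \<le> (\<Sum>n. f n)" for n
    using sum_le_suminf[of f "{n}"] by (simp add: summableI)
  then have fin: "f n = ennreal (enn2real (f n))" for n
    using assms by (metis ennreal_enn2real infinity_ennreal_def order_le_less_trans)
  then have "(\<Sum>n. ennreal (enn2real (f n))) \<noteq> top"
    using assms by (metis (no_types, lifting) infinity_ennreal_def less_irrefl suminf_cong)
  then have "summable (\<lambda>n. enn2real (f n))"
    by (intro summable_suminf_not_top) auto
  then have "(\<lambda>n. ennreal (enn2real (f n))) \<longlonglongrightarrow> ennreal 0"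
    by (intro tendsto_ennrealI summable_LIMSEQ_zero)
  then show ?thesis
    using fin by (simp add: fun_eq_iff[symmetric])
qed

section \<open>Compact sublevel sets of the one-step cost\<close>

context mdp_setting
begin

lemma trans_bounded_continuous:
  fixes f :: "'x \<Rightarrow> real"
  assumes "f \<in> borel_measurable borel" "bounded (range f)"
  shows "continuous_on (gr D) (\<lambda>k. \<integral>y. f y \<partial>trans D k)"
  using basic assms by (auto simp: basic_assms_def)

lemma cost_ge_1: "k \<in> gr D \<Longrightarrow> 1 \<le> cost D k"
  using mdp by (auto simp: is_mdp_def)

text \<open>A sum is at most \<open>t\<close> when for every level \<open>q\<close> either the cost
  is at most \<open>q\<close> or \<phi> is at most \<open>t - q\<close>. This exhibits the sublevel
  set as an intersection of closed subsets of one compact sublevel set of the cost.\<close>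

lemma compact_sublevel_continuous:
  assumes \<phi>: "continuous_on (gr D) \<phi>" "\<And>k. k \<in> gr D \<Longrightarrow> 0 \<le> \<phi> k"
  shows "compact {k \<in> gr D. cost D k + ennreal (\<phi> k) \<le> ennreal t}"
proof -
  let ?K = "\<lambda>q. {k \<in> gr D. cost D k \<le> ennreal q}"
  have K: "compact (?K q)" for q
    using inf_compact by (simp add: inf_compact_def)
  have cl: "closed {k \<in> ?K t. \<phi> k \<le> c}" for c
  proof -
    have "closed (?K t \<inter> \<phi> -` {..c})"
      using \<phi>(1) by (intro continuous_closed_preimage compact_imp_closed K closed_atMost) (auto elim: continuous_on_subset)
    also have "?K t \<inter> \<phi> -` {..c} = {k \<in> ?K t. \<phi> k \<le> c}"
      by auto
    finally show ?thesis .
  qed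
  have iff: "cost D k + ennreal (\<phi> k) \<le> ennreal t \<longleftrightarrow>
      cost D k \<le> ennreal t \<and> (\<forall>q. cost D k \<le> ennreal q \<or> \<phi> k \<le> t - q)" if k: "k \<in> gr D" for k
  proof (cases "cost D k" rule: ennreal_cases)
    case (real c)
    have c1: "1 \<le> c"
      using cost_ge_1[OF k] real by (simp add: ennreal_1[symmetric] del: ennreal_1)
    have le: "cost D k \<le> ennreal q \<longleftrightarrow> c \<le> q" for q
      using c1 real by (auto simp: ennreal_le_iff2)
    have "cost D k + ennreal (\<phi> k) \<le> ennreal t \<longleftrightarrow> c + \<phi> k \<le> t"
      using c1 real \<phi>(2)[OF k] by (auto simp: ennreal_plus[symmetric] ennreal_le_iff2 simp del: ennreal_plus)
    also have "\<dots> \<longleftrightarrow> c \<le> t \<and> (\<forall>q. c \<le> q \<or> \<phi> k \<le> t - q)"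
    proof
      assume *: "c \<le> t \<and> (\<forall>q. c \<le> q \<or> \<phi> k \<le> t - q)"
      \<comment> \<open>If the claim failed, the midpoint of \<open>c\<close> and
        \<open>t - \<phi> k\<close> would be a level violating both alternatives.\<close>
      show "c + \<phi> k \<le> t"
        using *[THEN conjunct2, rule_format, of "(c + t - \<phi> k) / 2"] by (auto simp: field_simps)
    qed (use \<phi>(2)[OF k] in auto)
    finally show ?thesis
      by (simp add: le)
  next
    case top
    then show ?thesis
      by (simp add: top_unique)
  qed
  have "{k \<in> gr D. cost D k + ennreal (\<phi> k) \<le> ennreal t} =
      ?K t \<inter> (\<Inter>q. ?K q \<union> {k \<in> ?K t. \<phi> k \<le> t - q})"
    by (auto simp: iff)
  also have "compact \<dots>"
    by (intro compact_Int_closed K closed_INT ballI closed_Un cl compact_imp_closed)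
  finally show ?thesis .
qed

text \<open>Strong continuity speaks of bounded functions only. Truncating \<open>f\<close> at
  \<open>j\<close> gives continuous integrals, and by monotone convergence the sublevel set for
  \<open>f\<close> is the intersection of those for the truncations.\<close>

lemma compact_sublevel:
  assumes f: "f \<in> borel_measurable borel" and t: "t < \<infinity>"
  shows "compact {k \<in> gr D. cost D k + (\<integral>\<^sup>+y. f y \<partial>trans D k) \<le> t}"
proof -
  obtain t' where t': "t = ennreal t'"
    using t by (cases t) auto
  define g where "g j y = enn2real (min (f y) (of_nat j))" for j :: nat and y
  have g_meas: "g j \<in> borel_measurable borel" for j
    unfolding g_def using f by measurable
  have g_eq: "ennreal (g j y) = min (f y) (of_nat j)" for j y
    unfolding g_def by (intro ennreal_enn2real) (simp add: min_less_iff_disj of_nat_less_top)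
  have g_bd: "0 \<le> g j y" "g j y \<le> j" for j y
  proof -
    have "ennreal (g j y) \<le> ennreal (real j)"
      by (simp add: g_eq ennreal_of_nat_eq_real_of_nat)
    then show "g j y \<le> j"
      by simp
  qed (simp add: g_def)
  define \<phi> where "\<phi> j k = (\<integral>y. g j y \<partial>trans D k)" for j k
  have \<phi>: "ennreal (\<phi> j k) = (\<integral>\<^sup>+y. min (f y) (of_nat j) \<partial>trans D k)" if k: "k \<in> gr D" for j k
  proof -
    interpret prob_space "trans D k"
      by (rule trans_prob[OF k])
    have "integrable (trans D k) (g j)"
      by (rule integrable_const_bound[of _ "real j"])
        (use g_bd g_meas in \<open>auto simp: measurable_cong_sets[OF trans_sets[OF k] refl]\<close>)
    then show ?thesis
      unfolding \<phi>_def by (subst nn_integral_eq_integral[symmetric]) (auto simp: g_bd g_eq)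
  qed
  have sup: "(\<integral>\<^sup>+y. f y \<partial>trans D k) = (SUP j. \<integral>\<^sup>+y. min (f y) (of_nat j) \<partial>trans D k)" if k: "k \<in> gr D" for k
  proof -
    have "f y = (SUP j. min (f y) (of_nat j))" for y
      by (subst inf_min[symmetric], subst inf_SUP[symmetric]) (simp add: ennreal_SUP_of_nat_eq_top)
    then have "(\<integral>\<^sup>+y. f y \<partial>trans D k) = (\<integral>\<^sup>+y. (SUP j. min (f y) (of_nat j)) \<partial>trans D k)"
      by simp
    also have "\<dots> = (SUP j. \<integral>\<^sup>+y. min (f y) (of_nat j) \<partial>trans D k)"
      using f by (intro nn_integral_monotone_convergence_SUP)
        (auto simp: incseq_def le_fun_def measurable_cong_sets[OF trans_sets[OF k] refl] min.coboundedI2)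
    finally show ?thesis .
  qed
  have "{k \<in> gr D. cost D k + (\<integral>\<^sup>+y. f y \<partial>trans D k) \<le> t} =
      (\<Inter>j. {k \<in> gr D. cost D k + ennreal (\<phi> j k) \<le> ennreal t'})"
  proof -
    have "cost D k + (\<integral>\<^sup>+y. f y \<partial>trans D k) \<le> t \<longleftrightarrow> (\<forall>j. cost D k + ennreal (\<phi> j k) \<le> ennreal t')"
      if k: "k \<in> gr D" for k
      unfolding sup[OF k] by (simp add: SUP_le_iff \<phi>[OF k] t' ennreal_SUP_add_right)
    then show ?thesis
      by auto
  qed
  also have "\<dots> = {k \<in> gr D. cost D k + ennreal (\<phi> 0 k) \<le> ennreal t'} \<inter>
      (\<Inter>j. {k \<in> gr D. cost D k + ennreal (\<phi> j k) \<le> ennreal t'})"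
    by auto
  also have "compact \<dots>"
  proof -
    have "compact {k \<in> gr D. cost D k + ennreal (\<phi> j k) \<le> ennreal t'}" for j
    proof (rule compact_sublevel_continuous)
      show "continuous_on (gr D) (\<phi> j)"
        unfolding \<phi>_def using g_bd
        by (intro trans_bounded_continuous g_meas boundedI[of _ "real j"]) auto
      show "0 \<le> \<phi> j k" for k
        unfolding \<phi>_def by (intro integral_nonneg_AE) (simp add: g_bd)
    qed
    then show ?thesis
      by (intro compact_Int_closed closed_INT ballI compact_imp_closed)
  qed
  finally show ?thesis .
qed

text \<open>The cost of the split chain minus \<open>\<beta>\<close>, transferred to the killed kernel and shifted
  by \<open>\<alpha> * atom\<close>, the shift being chosen such that the result is positive.\<close>

definition \<alpha> :: real where "\<alpha> = (\<beta> + \<epsilon>) / \<delta>"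

definition cost' :: "'x \<times> 'u \<Rightarrow> ennreal" where
  "cost' k = cost D k + ennreal (\<beta> * \<delta> + \<beta> + \<epsilon>) * indicator B (fst k) - ennreal \<beta>"

lemma \<alpha>: "0 < \<alpha>" "\<alpha> * \<delta> = \<beta> + \<epsilon>"
  using \<delta> \<epsilon> \<beta>_nonneg by (simp_all add: \<alpha>_def)

lemma cost_off_B: "k \<in> gr D \<Longrightarrow> fst k \<notin> B \<Longrightarrow> ennreal (\<beta> + \<epsilon>) \<le> cost D k"
  using \<epsilon> \<beta>_nonneg by (simp add: beta_eq)

text \<open>The truncated subtraction in \<open>cost'\<close> is a genuine one. On \<open>B\<close>
  the weighted cycle cost is \<open>c - (1 - \<delta>) * \<beta>\<close>, and adding
  \<open>\<alpha> * \<delta> = \<beta> + \<epsilon>\<close> produces the coefficient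
  \<open>\<beta> * \<delta> + \<beta> + \<epsilon>\<close> next to \<open>- \<beta>\<close>; off
  \<open>B\<close> the cost exceeds \<beta> by itself.\<close>

lemma cost'_add: "k \<in> gr D \<Longrightarrow> cost' k + ennreal \<beta> =
    cost D k + ennreal (\<beta> * \<delta> + \<beta> + \<epsilon>) * indicator B (fst k)"
  unfolding cost'_def
proof (rule diff_add_cancel_ennreal)
  assume k: "k \<in> gr D"
  show "ennreal \<beta> \<le> cost D k + ennreal (\<beta> * \<delta> + \<beta> + \<epsilon>) * indicator B (fst k)"
  proof (cases "fst k \<in> B")
    case True
    have "ennreal \<beta> \<le> ennreal (\<beta> * \<delta> + \<beta> + \<epsilon>)"
      using \<beta>_nonneg \<delta> \<epsilon> by (intro ennreal_leI) simp
    also have "\<dots> \<le> cost D k + ennreal (\<beta> * \<delta> + \<beta> + \<epsilon>) * indicator B (fst k)"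
      using True by simp
    finally show ?thesis .
  next
    case False
    have "ennreal \<beta> \<le> ennreal (\<beta> + \<epsilon>)"
      using \<epsilon> by (intro ennreal_leI) simp
    with cost_off_B[OF k False] False show ?thesis
      by simp
  qed
qed

lemma cost'_ge: "k \<in> gr D \<Longrightarrow> ennreal \<epsilon> \<le> cost' k"
proof -
  assume k: "k \<in> gr D"
  have "ennreal \<beta> + ennreal \<epsilon> \<le> ennreal \<beta> + cost' k"
  proof (cases "fst k \<in> B")
    case True
    have "ennreal (\<beta> + \<epsilon>) \<le> ennreal (\<beta> * \<delta> + \<beta> + \<epsilon>)"
      using \<beta>_nonneg \<delta> \<epsilon> by (intro ennreal_leI) simp
    also have "\<dots> \<le> cost' k + ennreal \<beta>"
      using True by (simp add: cost'_add[OF k])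
    finally show ?thesis
      using \<beta>_nonneg \<epsilon> by (simp add: add.commute)
  next
    case False
    then show ?thesis
      using cost_off_B[OF k False] cost'_add[OF k] \<beta>_nonneg \<epsilon> by (simp add: add.commute)
  qed
  then show ?thesis
    by (simp add: ennreal_add_left_cancel_le)
qed

lemma cost'_meas: "cost' \<in> borel_measurable (grM D)"
proof -
  have "(\<lambda>k. ennreal (\<beta> * \<delta> + \<beta> + \<epsilon>) * indicator B (fst k)) \<in> borel_measurable (grM D)"
    by measurable
  with cost_meas show ?thesis
    unfolding cost'_def[abs_def] by measurable
qed

section \<open>Totals along the killed chain\<close>

definition cost'_of :: "('x \<Rightarrow> 'u measure) \<Rightarrow> 'x \<Rightarrow> ennreal" where
  "cost'_of v x = (\<integral>\<^sup>+k. cost' k \<partial>state_action D (v x) x)"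

definition total :: "('x \<Rightarrow> 'u measure) \<Rightarrow> ('x \<Rightarrow> ennreal) \<Rightarrow> 'x \<Rightarrow> ennreal" where
  "total v f x = (\<Sum>n. (R v ^^ n) f x)"

lemma cost'_of_meas: "v \<in> stationary D \<Longrightarrow> cost'_of v \<in> borel_measurable borel"
  unfolding cost'_of_def[abs_def] by (rule nn_integral_stationary_meas[OF _ cost'_meas])

lemma cost_of_meas: "v \<in> stationary D \<Longrightarrow> cost_of D v \<in> borel_measurable borel"
  using nn_integral_stationary_meas[OF _ cost_meas, of v] by (simp add: cost_of_eq cong: measurable_cong)

lemma total_add:
  assumes "v \<in> stationary D" "f \<in> borel_measurable borel" "g \<in> borel_measurable borel"
  shows "total v (\<lambda>x. f x + g x) x = total v f x + total v g x"
  by (simp add: total_def R_funpow_add[OF assms] suminf_add[symmetric])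

lemma total_cmult:
  assumes "v \<in> stationary D" "f \<in> borel_measurable borel"
  shows "total v (\<lambda>x. c * f x) x = c * total v f x"
  by (simp add: total_def R_funpow_cmult[OF assms])

lemma total_mono: "(\<And>x. f x \<le> g x) \<Longrightarrow> total v f x \<le> total v g x"
  unfolding total_def by (intro suminf_le summableI R_funpow_mono)

lemma R_suminf:
  assumes v: "v \<in> stationary D" and f: "\<And>n. f n \<in> borel_measurable borel"
  shows "R v (\<lambda>x. \<Sum>n. f n x) x = (\<Sum>n. R v (f n) x)"
proof -
  have "R v (\<lambda>x. \<Sum>n. f n x) x = (\<integral>\<^sup>+k. (\<Sum>n. \<integral>\<^sup>+y. f n y \<partial>killed k) \<partial>state_action D (v x) x)"
    unfolding R_def
    by (intro nn_integral_cong nn_integral_suminf)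
      (use f in \<open>auto dest!: state_action_gr simp: killed_sets cong: measurable_cong_sets\<close>)
  also have "\<dots> = (\<Sum>n. R v (f n) x)"
    unfolding R_def
    by (rule nn_integral_suminf)
      (use f nn_integral_killed_meas in \<open>auto simp: state_action_def cong: measurable_cong_sets\<close>)
  finally show ?thesis .
qed

lemma total_unfold:
  assumes v: "v \<in> stationary D" and f: "f \<in> borel_measurable borel"
  shows "total v f x = f x + R v (total v f) x"
proof -
  have "total v f x = f x + (\<Sum>n. (R v ^^ Suc n) f x)"
    unfolding total_def using suminf_offset[of "\<lambda>n. (R v ^^ n) f x" 1] by (simp add: summableI)
  also have "(\<Sum>n. (R v ^^ Suc n) f x) = R v (total v f) x"
    unfolding total_def[abs_def] using R_suminf[OF v R_funpow_meas[OF v f]] by simp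
  finally show ?thesis .
qed

text \<open>The total of \<open>atom\<close> is the probability of ever regenerating: by
  \<open>R_one\<close> its partial sums and the surviving mass add up to 1. A finite expected
  lifetime, the total of the constant 1, makes the surviving mass vanish in the limit.\<close>

lemma atom_total:
  assumes v: "v \<in> stationary D"
  shows "total v (\<lambda>x. ennreal (atom x)) x \<le> 1"
    and "total v (\<lambda>_. 1) x < \<infinity> \<Longrightarrow> total v (\<lambda>x. ennreal (atom x)) x = 1"
proof -
  have sum: "(\<Sum>k<n. (R v ^^ k) (\<lambda>x. ennreal (atom x)) x) + (R v ^^ n) (\<lambda>_. 1) x = 1" for n
  proof (induction n)
    case (Suc n)
    have "(R v ^^ n) (\<lambda>_. 1) x = (R v ^^ n) (\<lambda>x. R v (\<lambda>_. 1) x + ennreal (atom x)) x"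
      using R_one[OF v] by simp
    also have "\<dots> = (R v ^^ n) (R v (\<lambda>_. 1)) x + (R v ^^ n) (\<lambda>x. ennreal (atom x)) x"
      by (rule R_funpow_add[OF v]) (auto intro: R_meas v)
    finally show ?case
      using Suc by (simp add: funpow_swap1 ac_simps)
  qed simp
  have "(\<Sum>k<n. (R v ^^ k) (\<lambda>x. ennreal (atom x)) x) \<le> 1" for n
    using sum[of n] by (metis le_iff_add)
  then show "total v (\<lambda>x. ennreal (atom x)) x \<le> 1"
    unfolding total_def by (intro suminf_le_const summableI)
  assume "total v (\<lambda>_. 1) x < \<infinity>"
  then have "(\<lambda>n. (R v ^^ n) (\<lambda>_. 1) x) \<longlonglongrightarrow> 0"
    unfolding total_def by (rule ennreal_suminf_finite_tendsto_0)
  then have "(\<lambda>n. (\<Sum>k<n. (R v ^^ k) (\<lambda>x. ennreal (atom x)) x) + (R v ^^ n) (\<lambda>_. 1) x)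
      \<longlonglongrightarrow> total v (\<lambda>x. ennreal (atom x)) x + 0"
    unfolding total_def by (intro tendsto_add summable_LIMSEQ summableI)
  then have "(\<lambda>n::nat. 1 :: ennreal) \<longlonglongrightarrow> total v (\<lambda>x. ennreal (atom x)) x"
    by (simp add: sum)
  then show "total v (\<lambda>x. ennreal (atom x)) x = 1"
    by (metis LIMSEQ_unique tendsto_const)
qed

end

lemma (in prob_space) AE_exists:
  assumes "AE x in M. P x"
  shows "\<exists>x\<in>space M. P x"
proof (rule ccontr)
  assume "\<not> ?thesis"
  with assms have "AE x in M. False"
    by (auto elim!: AE_mp intro!: AE_I2)
  then show False
    using AE_False by simp
qed

context mdp_setting
begin

lemma nn_integral_state_action_dirac:
  assumes w: "w x \<in> acts D x" and f: "f \<in> borel_measurable (grM D)"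
  shows "(\<integral>\<^sup>+k. f k \<partial>state_action D (dirac w x) x) = f (x, w x)"
proof -
  have "(\<lambda>u. f (x, u)) \<in> borel_measurable (restrict_space borel (acts D x))"
    by (rule measurable_compose[OF Pair_meas f])
  then have "(\<lambda>u. f (x, u) * indicator (acts D x) u) \<in> borel_measurable borel"
    using acts(2) by (simp add: borel_measurable_restrict_space_iff_ennreal)
  then show ?thesis
    using w f by (simp add: nn_integral_state_action dirac_def nn_integral_return)
qed

lemma dirac_stationary:
  assumes "w \<in> borel \<rightarrow>\<^sub>M borel" "\<And>x. w x \<in> acts D x"
  shows "dirac w \<in> stationary D"
proof -
  have "dirac w \<in> borel \<rightarrow>\<^sub>M prob_algebra borel"
    unfolding dirac_def[abs_def] by (rule measurable_compose[OF assms(1) measurable_return_prob_space])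
  then show ?thesis
    using assms acts(2) by (auto simp: stationary_def dirac_def emeasure_return)
qed

lemma R_dirac:
  "w x \<in> acts D x \<Longrightarrow> f \<in> borel_measurable borel \<Longrightarrow> R (dirac w) f x = (\<integral>\<^sup>+y. f y \<partial>killed (x, w x))"
  unfolding R_def by (subst nn_integral_state_action_dirac) (auto intro: nn_integral_killed_meas)

lemma cost'_of_dirac: "w x \<in> acts D x \<Longrightarrow> cost'_of (dirac w) x = cost' (x, w x)"
  unfolding cost'_of_def by (subst nn_integral_state_action_dirac) (auto intro: cost'_meas)

text \<open>The shift in a form that can be summed along the killed chain: every term stands on the
  side where it is nonnegative.\<close>

lemma cost'_of_add:
  assumes v: "v \<in> stationary D"
  shows "cost'_of v x + ennreal ((1 - atom x) * \<beta>) = cost_of D v x + ennreal \<alpha> * ennreal (atom x)"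
proof -
  let ?M = "state_action D (v x) x"
  interpret prob_space ?M
    using stationaryD[OF v] by (intro state_action_prob)
  have meas: "cost' \<in> borel_measurable ?M" "cost D \<in> borel_measurable ?M"
    using cost'_meas cost_meas by (simp_all add: state_action_def)
  have "cost'_of v x + ennreal \<beta> = (\<integral>\<^sup>+k. cost' k + ennreal \<beta> \<partial>?M)"
    using meas by (simp add: cost'_of_def nn_integral_add emeasure_space_1)
  also have "\<dots> = (\<integral>\<^sup>+k. cost D k + ennreal (\<beta> * \<delta> + \<beta> + \<epsilon>) * indicator B x \<partial>?M)"
  proof (rule nn_integral_cong_AE)
    show "AE k in ?M. cost' k + ennreal \<beta> = cost D k + ennreal (\<beta> * \<delta> + \<beta> + \<epsilon>) * indicator B x"
      using state_action_AE_fst[OF v, of x] AE_space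
    proof eventually_elim
      case (elim k)
      then show ?case
        using cost'_add[OF state_action_gr[OF elim(2)]] by simp
    qed
  qed
  also have "\<dots> = cost_of D v x + ennreal (\<beta> * \<delta> + \<beta> + \<epsilon>) * indicator B x"
    using meas by (simp add: cost_of_eq[OF v] nn_integral_add emeasure_space_1)
  also have "ennreal (\<beta> * \<delta> + \<beta> + \<epsilon>) * indicator B x = ennreal \<alpha> * ennreal (atom x) + ennreal (\<beta> * atom x)"
    using \<alpha> \<beta>_nonneg \<delta> \<epsilon>
    by (auto simp: atom_def ennreal_mult[symmetric] ennreal_plus[symmetric] algebra_simps simp del: ennreal_plus split: split_indicator)
  finally have "ennreal (\<beta> * atom x) + (cost'_of v x + ennreal ((1 - atom x) * \<beta>)) =
      ennreal (\<beta> * atom x) + (cost_of D v x + ennreal \<alpha> * ennreal (atom x))"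
  proof -
    have "0 \<le> \<beta> * atom x" "0 \<le> (1 - atom x) * \<beta>"
      using atom(1,2)[of x] \<beta>_nonneg by (auto intro!: mult_nonneg_nonneg)
    then have "ennreal \<beta> = ennreal (\<beta> * atom x) + ennreal ((1 - atom x) * \<beta>)"
      by (subst ennreal_plus[symmetric]) (simp_all add: left_diff_distrib mult.commute[of \<beta>])
    moreover assume "cost'_of v x + ennreal \<beta> = cost_of D v x + (ennreal \<alpha> * ennreal (atom x) + ennreal (\<beta> * atom x))"
    ultimately show ?thesis
      by (simp only: ac_simps)
  qed
  then show ?thesis
    by (subst (asm) ennreal_add_left_cancel) simp
qed

abbreviation J :: "('x \<Rightarrow> 'u measure) \<Rightarrow> 'x \<Rightarrow> ennreal" where
  "J v \<equiv> total v (cost'_of v)"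

lemma split_cost_of_True: "split_cost_of D B \<delta> v (x, True) = 0"
  by (simp add: split_cost_of_def split_cost_def)

lemma split_cost_of_False:
  assumes v: "v \<in> stationary D"
  shows "split_cost_of D B \<delta> v (x, False) = cost_of D v x * ennreal (1 / (1 - atom x))"
proof -
  have m: "(\<lambda>u. cost D (x, u) * indicator (acts D x) u) \<in> borel_measurable (v x)"
    using measurable_compose[OF Pair_meas cost_meas, of x] acts(2)
    by (simp add: borel_measurable_restrict_space_iff_ennreal measurable_cong_sets[OF stationaryD(2)[OF v] refl])
  have "split_cost_of D B \<delta> v (x, False) =
      (\<integral>\<^sup>+u. cost D (x, u) * indicator (acts D x) u * ennreal (1 / (1 - atom x)) \<partial>v x)"
    unfolding split_cost_of_def split_cost_def fst_conv prod.case using \<delta>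
    by (intro nn_integral_cong)
      (auto simp: atom divide_ennreal_def inverse_ennreal inverse_eq_divide ac_simps)
  also have "\<dots> = cost_of D v x * ennreal (1 / (1 - atom x))"
    unfolding cost_of_def by (rule nn_integral_multc[OF m])
  finally show ?thesis .
qed

lemma split_cost_of_meas:
  assumes v: "v \<in> stationary D"
  shows "split_cost_of D B \<delta> v \<in> borel_measurable (split_space B)"
proof -
  have "split_cost_of D B \<delta> v =
      (\<lambda>z. if snd z then 0 else cost_of D v (fst z) * ennreal (1 / (1 - atom (fst z))))"
    using split_cost_of_True split_cost_of_False[OF v] by (auto simp: fun_eq_iff)
  moreover have "\<dots> \<in> borel_measurable (split_space B)"
    using measurable_compose[OF fst_split_space cost_of_meas[OF v]] by measurable
  ultimately show ?thesis
    by simp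
qed

lemma scaled_split_cost_of:
  assumes v: "v \<in> stationary D"
  shows "ennreal (1 - atom x) * split_cost_of D B \<delta> v (x, False) = cost_of D v x"
  using atom[of x]
  by (simp add: split_cost_of_False[OF v] mult.left_commute[of "ennreal (1 - atom x)"] ennreal_mult[symmetric])

text \<open>Carries \<open>A2\<close> over to the killed problem. The bound is uniform on
  \<open>B\<close> because \<open>B\<close> is bounded, and uniformity there is what makes \<nu>(W)
  finite, since \<nu> lives on \<open>B\<close>.\<close>

lemma ex_stable: "\<exists>v C. v \<in> stationary D \<and> (\<forall>x. J v x < \<infinity>) \<and> C < \<infinity> \<and> (\<forall>x\<in>B. J v x \<le> C)"
proof -
  obtain v where v: "v \<in> stationary D"
    and stable: "\<And>S. bounded S \<Longrightarrow> (SUP x\<in>S. split_cycle_sum D B \<nu> \<delta> v (split_cost_of D B \<delta> v) (x, False)) < \<infinity>"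
    using A2 by (auto simp: A2_def c_stable_def)
  let ?s = "\<lambda>x. split_cycle_sum D B \<nu> \<delta> v (split_cost_of D B \<delta> v) (x, False)"
  have J_le: "J v x \<le> ?s x + ennreal \<alpha>" for x
  proof -
    have "J v x \<le> total v (\<lambda>x. cost_of D v x + ennreal \<alpha> * ennreal (atom x)) x"
      by (intro total_mono) (metis cost'_of_add[OF v] le_iff_add)
    also have "\<dots> = total v (cost_of D v) x + ennreal \<alpha> * total v (\<lambda>x. ennreal (atom x)) x"
      by (subst total_add[OF v]) (auto simp: total_cmult[OF v] cost_of_meas[OF v])
    also have "total v (cost_of D v) x = ennreal (1 - atom x) * ?s x"
      unfolding split_cycle_sum_eq[OF v split_cost_of_meas[OF v]] scaled_split_cost_of[OF v] total_def ..
    also have "\<dots> \<le> 1 * ?s x"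
      using atom(1)[of x] by (intro mult_right_mono) simp_all
    also have "ennreal \<alpha> * total v (\<lambda>x. ennreal (atom x)) x \<le> ennreal \<alpha> * 1"
      by (intro mult_left_mono atom_total v) simp
    finally show ?thesis
      by simp
  qed
  have "bounded B"
    using A0 by (simp add: A0_def)
  from stable[OF this] have "(SUP x\<in>B. ?s x) + ennreal \<alpha> < \<infinity>"
    by simp
  moreover have "J v x \<le> (SUP x\<in>B. ?s x) + ennreal \<alpha>" if "x \<in> B" for x
    using J_le[of x] SUP_upper[OF that, of ?s] by (meson add_right_mono order_trans)
  moreover have "J v x < \<infinity>" for x
    using stable[of "{x}"] J_le[of x] by (auto simp: less_top[symmetric] top_unique)
  ultimately show ?thesis
    using v by blast
qed

section \<open>The Bellman operator of the killed problem and its iteration from 0\<close>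

definition bell :: "('x \<Rightarrow> ennreal) \<Rightarrow> 'x \<Rightarrow> ennreal" where
  "bell f x = (INF u\<in>acts D x. cost' (x, u) + (\<integral>\<^sup>+y. f y \<partial>killed (x, u)))"

lemma bell_le: "k \<in> gr D \<Longrightarrow> bell f (fst k) \<le> cost' k + (\<integral>\<^sup>+y. f y \<partial>killed k)"
  unfolding bell_def by (cases k) (auto simp: gr_iff intro: INF_lower)

lemma bell_mono: "(\<And>x. f x \<le> g x) \<Longrightarrow> bell f x \<le> bell g x"
  unfolding bell_def by (intro INF_mono) (auto intro!: add_left_mono nn_integral_mono)

lemma bell_le_stationary:
  assumes v: "v \<in> stationary D" and f: "f \<in> borel_measurable borel"
  shows "bell f x \<le> cost'_of v x + R v f x"
proof -
  let ?M = "state_action D (v x) x"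
  interpret prob_space ?M
    using stationaryD[OF v] by (intro state_action_prob)
  have "bell f x = (\<integral>\<^sup>+k. bell f x \<partial>?M)"
    by (simp add: emeasure_space_1)
  also have "\<dots> \<le> (\<integral>\<^sup>+k. cost' k + (\<integral>\<^sup>+y. f y \<partial>killed k) \<partial>?M)"
  proof (rule nn_integral_mono_AE)
    show "AE k in ?M. bell f x \<le> cost' k + (\<integral>\<^sup>+y. f y \<partial>killed k)"
      using state_action_AE_fst[OF v, of x] AE_space
    proof eventually_elim
      case (elim k)
      then show ?case
        using bell_le[OF state_action_gr[OF elim(2)], of f] by simp
    qed
  qed
  also have "\<dots> = cost'_of v x + R v f x"
    unfolding cost'_of_def R_def using cost'_meas nn_integral_killed_meas[OF f]
    by (intro nn_integral_add) (auto simp: state_action_def)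
  finally show ?thesis .
qed

text \<open>Arranged with sums only, so that no infinite quantity is subtracted. Apart from the two
  one-step costs to be compared, all terms depend on the state alone.\<close>

lemma bellman_killed_trans:
  assumes k: "k \<in> gr D" and f: "f \<in> borel_measurable borel"
  shows "cost' k + (\<integral>\<^sup>+y. f y \<partial>killed k) + (ennreal \<beta> + ennreal (atom (fst k)) * (\<integral>\<^sup>+y. f y \<partial>\<nu>)) =
    ennreal (\<beta> * \<delta> + \<beta> + \<epsilon>) * indicator B (fst k) + (cost D k + (\<integral>\<^sup>+y. f y \<partial>trans D k))"
proof -
  have "cost' k + (\<integral>\<^sup>+y. f y \<partial>killed k) + (ennreal \<beta> + ennreal (atom (fst k)) * (\<integral>\<^sup>+y. f y \<partial>\<nu>)) =
      (cost' k + ennreal \<beta>) + ((\<integral>\<^sup>+y. f y \<partial>killed k) + ennreal (atom (fst k)) * (\<integral>\<^sup>+y. f y \<partial>\<nu>))"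
    by (simp only: ac_simps)
  then show ?thesis
    by (simp only: cost'_add[OF k] nn_integral_trans[OF k f, symmetric]) (simp only: ac_simps)
qed

text \<open>Minimizing over the actions at a fixed state does not see the terms that depend on the
  state only; so the minimization can be carried out with the unkilled kernel, for which the
  sublevel sets are compact.\<close>

lemma bell_selector:
  assumes f: "f \<in> borel_measurable borel" and v: "v \<in> stationary D"
    and fv: "\<And>x. f x \<le> J v x" and Jv: "\<And>x. J v x < \<infinity>" and fin: "(\<integral>\<^sup>+y. f y \<partial>\<nu>) < \<infinity>"
  shows "\<exists>w \<in> borel \<rightarrow>\<^sub>M borel. \<forall>x. w x \<in> acts D x \<and>
    bell f x = cost' (x, w x) + (\<integral>\<^sup>+y. f y \<partial>killed (x, w x))"
proof -
  let ?g = "\<lambda>k. cost D k + (\<integral>\<^sup>+y. f y \<partial>trans D k)"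
  let ?h = "\<lambda>k. cost' k + (\<integral>\<^sup>+y. f y \<partial>killed k)"
  let ?c = "\<lambda>x. ennreal \<beta> + ennreal (atom x) * (\<integral>\<^sup>+y. f y \<partial>\<nu>)"
  have c: "?c x < \<infinity>" for x
    using fin by (simp add: ennreal_mult_less_top)
  have "\<exists>w \<in> borel \<rightarrow>\<^sub>M borel. \<forall>x. (x, w x) \<in> gr D \<and> (\<forall>u. (x, u) \<in> gr D \<longrightarrow> ?g (x, w x) \<le> ?g (x, u))"
  proof (rule inf_compact_minimizer)
    show "compact {k \<in> gr D. ?g k \<le> t}" if "t < \<infinity>" for t
      using f that by (rule compact_sublevel)
    show "\<exists>u. (x, u) \<in> gr D \<and> ?g (x, u) < \<infinity>" for x
    proof -
      let ?M = "state_action D (v x) x"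
      interpret prob_space ?M
        using stationaryD[OF v] by (intro state_action_prob)
      have meas: "?h \<in> borel_measurable ?M"
        using cost'_meas nn_integral_killed_meas[OF f] by (simp add: state_action_def)
      have "(\<integral>\<^sup>+k. ?h k \<partial>?M) = cost'_of v x + R v f x"
        unfolding cost'_of_def R_def using cost'_meas nn_integral_killed_meas[OF f]
        by (intro nn_integral_add) (auto simp: state_action_def)
      also have "\<dots> \<le> cost'_of v x + R v (J v) x"
        by (intro add_left_mono R_mono fv)
      also have "\<dots> = J v x"
        by (rule total_unfold[OF v cost'_of_meas[OF v], symmetric])
      finally have "(\<integral>\<^sup>+k. ?h k \<partial>?M) \<noteq> \<infinity>"
        using Jv[of x] by (auto simp: top_unique)
      \<comment> \<open>A stable policy has a finite mean one-step value, so almost every action it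
        uses has a finite value, and in particular some action has.\<close>
      then have "AE k in ?M. ?h k \<noteq> \<infinity>"
        by (rule nn_integral_PInf_AE[OF meas])
      then have "AE k in ?M. ?h k \<noteq> \<infinity> \<and> fst k = x"
        using state_action_AE_fst[OF v, of x] by eventually_elim simp
      from AE_exists[OF this] obtain k where k: "k \<in> gr D" "?h k \<noteq> \<infinity>" "fst k = x"
        using state_action_gr by blast
      have "ennreal (\<beta> * \<delta> + \<beta> + \<epsilon>) * indicator B (fst k) + ?g k < \<infinity>"
        using bellman_killed_trans[OF k(1) f, symmetric] k(2) c[of x] k(3) by (simp add: less_top[symmetric])
      with k(1,3) show ?thesis
        by (intro exI[of _ "snd k"]) auto
    qed
  qed
  then obtain w where w: "w \<in> borel \<rightarrow>\<^sub>M borel" "\<And>x. (x, w x) \<in> gr D"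
    "\<And>x u. (x, u) \<in> gr D \<Longrightarrow> ?g (x, w x) \<le> ?g (x, u)"
    by blast
  have "bell f x = ?h (x, w x)" for x
  proof (rule antisym)
    show "bell f x \<le> ?h (x, w x)"
      using bell_le[OF w(2), of f x] by simp
    show "?h (x, w x) \<le> bell f x"
      unfolding bell_def
    proof (rule INF_greatest)
      fix u assume "u \<in> acts D x"
      then have k: "(x, u) \<in> gr D"
        by (simp add: gr_iff)
      have "?h (x, w x) + ?c x \<le> ?h (x, u) + ?c x"
        using bellman_killed_trans[OF w(2) f, of x] bellman_killed_trans[OF k f] w(3)[OF k]
        by (simp add: add_left_mono)
      then have "?c x + ?h (x, w x) \<le> ?c x + ?h (x, u)"
        by (simp add: add.commute)
      then show "?h (x, w x) \<le> ?h (x, u)"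
        using c[of x] by (simp only: ennreal_add_left_cancel_le) auto
    qed
  qed
  with w show ?thesis
    by (auto simp: gr_iff)
qed

definition Wn :: "nat \<Rightarrow> 'x \<Rightarrow> ennreal" where "Wn n = (bell ^^ n) (\<lambda>_. 0)"

definition W :: "'x \<Rightarrow> ennreal" where "W x = (SUP n. Wn n x)"

lemma Wn_Suc: "Wn (Suc n) x = bell (Wn n) x"
  by (simp add: Wn_def)

lemma Wn_mono: "Wn n x \<le> Wn (Suc n) x"
  by (induction n arbitrary: x) (auto simp: Wn_Suc intro: bell_mono, simp add: Wn_def)

text \<open>The two claims are proved together: measurability of the infimum is obtained from a
  minimizing selector, and the existence of the selector relies on the bound by the finite total
  cost of a stable policy.\<close>

lemma Wn_meas_le: "Wn n \<in> borel_measurable borel \<and> (\<forall>v\<in>stationary D. \<forall>x. Wn n x \<le> J v x)"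
proof (induction n)
  case 0
  then show ?case
    by (simp add: Wn_def)
next
  case (Suc n)
  obtain v C where v: "v \<in> stationary D" "\<And>x. J v x < \<infinity>" "C < \<infinity>" "\<And>x. x \<in> B \<Longrightarrow> J v x \<le> C"
    using ex_stable by blast
  interpret N: prob_space \<nu>
    by (rule \<nu>_prob)
  have "(\<integral>\<^sup>+y. Wn n y \<partial>\<nu>) \<le> (\<integral>\<^sup>+y. C \<partial>\<nu>)"
  proof (rule nn_integral_mono_AE)
    show "AE y in \<nu>. Wn n y \<le> C"
      using \<nu>_AE_B by eventually_elim (use v Suc in \<open>meson order_trans\<close>)
  qed
  then have fin: "(\<integral>\<^sup>+y. Wn n y \<partial>\<nu>) < \<infinity>"
    using v(3) by (simp add: N.emeasure_space_1 order_le_less_trans)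
  obtain w where w: "w \<in> borel \<rightarrow>\<^sub>M borel" "\<And>x. w x \<in> acts D x"
    "\<And>x. bell (Wn n) x = cost' (x, w x) + (\<integral>\<^sup>+y. Wn n y \<partial>killed (x, w x))"
    using bell_selector[OF _ v(1) _ v(2) fin] Suc v(1) by blast
  have "Wn (Suc n) = (\<lambda>x. cost'_of (dirac w) x + R (dirac w) (Wn n) x)"
    using Suc w(2) by (simp add: fun_eq_iff Wn_Suc w(3) cost'_of_dirac R_dirac)
  also have "\<dots> \<in> borel_measurable borel"
    using Suc by (intro borel_measurable_add cost'_of_meas R_meas dirac_stationary w) auto
  finally have "Wn (Suc n) \<in> borel_measurable borel" .
  moreover have "Wn (Suc n) x \<le> J v x" if v: "v \<in> stationary D" for v x
  proof -
    have "Wn (Suc n) x \<le> cost'_of v x + R v (Wn n) x"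
      unfolding Wn_Suc using Suc by (intro bell_le_stationary v) simp
    also have "\<dots> \<le> cost'_of v x + R v (J v) x"
      using Suc v by (intro add_left_mono R_mono) simp
    also have "\<dots> = J v x"
      by (rule total_unfold[OF v cost'_of_meas[OF v], symmetric])
    finally show ?thesis .
  qed
  ultimately show ?case
    by blast
qed

lemma W_meas [measurable]: "W \<in> borel_measurable borel"
  unfolding W_def[abs_def] using Wn_meas_le by (intro borel_measurable_SUP) auto

lemma W_le_J: "v \<in> stationary D \<Longrightarrow> W x \<le> J v x"
  unfolding W_def using Wn_meas_le by (intro SUP_least) auto

lemma W_finite: "W x < \<infinity>" and nn_integral_W_\<nu>: "(\<integral>\<^sup>+y. W y \<partial>\<nu>) < \<infinity>"
proof -
  obtain v C where v: "v \<in> stationary D" "\<And>x. J v x < \<infinity>" "C < \<infinity>" "\<And>x. x \<in> B \<Longrightarrow> J v x \<le> C"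
    using ex_stable by blast
  interpret N: prob_space \<nu>
    by (rule \<nu>_prob)
  show "W x < \<infinity>"
    using W_le_J[OF v(1)] v(2) by (rule order_le_less_trans)
  have "(\<integral>\<^sup>+y. W y \<partial>\<nu>) \<le> (\<integral>\<^sup>+y. C \<partial>\<nu>)"
  proof (rule nn_integral_mono_AE)
    show "AE y in \<nu>. W y \<le> C"
      using \<nu>_AE_B by eventually_elim (use v W_le_J[OF v(1)] in \<open>meson order_trans\<close>)
  qed
  then show "(\<integral>\<^sup>+y. W y \<partial>\<nu>) < \<infinity>"
    using v(3) by (simp add: N.emeasure_space_1 order_le_less_trans)
qed

lemma Wn_incseq: "incseq Wn"
  by (rule incseq_SucI) (auto simp: le_fun_def Wn_mono)

lemma nn_integral_W_killed: "k \<in> gr D \<Longrightarrow> (\<integral>\<^sup>+y. W y \<partial>killed k) = (SUP n. \<integral>\<^sup>+y. Wn n y \<partial>killed k)"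
  unfolding W_def using Wn_incseq Wn_meas_le
  by (intro nn_integral_monotone_convergence_SUP) (auto simp: measurable_cong_sets[OF killed_sets refl])

lemma W_le:
  assumes k: "k \<in> gr D"
  shows "W (fst k) \<le> cost' k + (\<integral>\<^sup>+y. W y \<partial>killed k)"
  unfolding W_def
proof (rule SUP_least)
  fix n
  have "Wn n (fst k) \<le> bell (Wn n) (fst k)"
    using Wn_mono[of n "fst k"] by (simp add: Wn_Suc)
  also have "\<dots> \<le> cost' k + (\<integral>\<^sup>+y. Wn n y \<partial>killed k)"
    by (rule bell_le[OF k])
  also have "\<dots> \<le> cost' k + (\<integral>\<^sup>+y. (SUP n. Wn n y) \<partial>killed k)"
    by (intro add_left_mono nn_integral_mono SUP_upper) simp
  finally show "Wn n (fst k) \<le> cost' k + (\<integral>\<^sup>+y. (SUP n. Wn n y) \<partial>killed k)" .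
qed

text \<open>The infimum over actions is interchanged with the increasing limit. The actions whose
  \<open>n\<close>-th one-step value is at most \<open>W x\<close> form nonempty compact sets that
  decrease with \<open>n\<close>; an action in all of them keeps the limiting value below
  \<open>W x\<close>.\<close>

lemma bell_W_le: "bell W x \<le> W x"
proof -
  let ?h = "\<lambda>n u. cost' (x, u) + (\<integral>\<^sup>+y. Wn n y \<partial>killed (x, u))"
  let ?c = "\<lambda>n. ennreal \<beta> + ennreal (atom x) * (\<integral>\<^sup>+y. Wn n y \<partial>\<nu>)"
  let ?d = "ennreal (\<beta> * \<delta> + \<beta> + \<epsilon>) * indicator B x"
  define S where "S n = {u \<in> acts D x. ?h n u \<le> W x}" for n
  obtain v C where v: "v \<in> stationary D" "\<And>x. J v x < \<infinity>" "C < \<infinity>" "\<And>x. x \<in> B \<Longrightarrow> J v x \<le> C"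
    using ex_stable by blast
  have fin: "(\<integral>\<^sup>+y. Wn n y \<partial>\<nu>) < \<infinity>" for n
  proof -
    have "(\<integral>\<^sup>+y. Wn n y \<partial>\<nu>) \<le> (\<integral>\<^sup>+y. W y \<partial>\<nu>)"
      unfolding W_def by (intro nn_integral_mono SUP_upper) simp
    then show ?thesis
      using nn_integral_W_\<nu> by (rule order_le_less_trans)
  qed
  have Wn: "Wn n \<in> borel_measurable borel" for n
    using Wn_meas_le by simp
  have S_ne: "S n \<noteq> {}" for n
  proof -
    obtain w where w: "\<And>x. w x \<in> acts D x"
      "\<And>x. bell (Wn n) x = cost' (x, w x) + (\<integral>\<^sup>+y. Wn n y \<partial>killed (x, w x))"
      using bell_selector[OF Wn v(1) _ v(2) fin, of n] Wn_meas_le v(1) by blast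
    have "?h n (w x) = Wn (Suc n) x"
      by (simp add: Wn_Suc w(2))
    also have "\<dots> \<le> W x"
      unfolding W_def by (rule SUP_upper) simp
    finally show ?thesis
      using w(1) by (auto simp: S_def)
  qed
  have iff: "?h n u \<le> W x \<longleftrightarrow> ?d + (cost D (x, u) + (\<integral>\<^sup>+y. Wn n y \<partial>trans D (x, u))) \<le> W x + ?c n"
    if u: "u \<in> acts D x" for n u
  proof -
    have k: "(x, u) \<in> gr D"
      using u by (simp add: gr_iff)
    have "?c n < \<infinity>"
      using fin by (simp add: ennreal_mult_less_top)
    then have "?h n u \<le> W x \<longleftrightarrow> ?c n + ?h n u \<le> ?c n + W x"
      by (subst ennreal_add_left_cancel_le) auto
    also have "?c n + ?h n u = ?h n u + ?c n"
      by (rule add.commute)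
    also have "\<dots> = ?d + (cost D (x, u) + (\<integral>\<^sup>+y. Wn n y \<partial>trans D (x, u)))"
      using bellman_killed_trans[OF k Wn, of n] by simp
    also have "?c n + W x = W x + ?c n"
      by (rule add.commute)
    finally show ?thesis .
  qed
  have S_compact: "compact (S n)" for n
  proof -
    \<comment> \<open>Solving the condition in \<open>iff\<close> for the unkilled one-step cost
      needs \<open>?d\<close> to be at most the right-hand side; any element of \<open>S n\<close>
      witnesses this.\<close>
    define t where "t = W x + ?c n - ?d"
    have t: "t < \<infinity>"
      using W_finite[of x] fin[of n] by (simp add: t_def ennreal_mult_less_top diff_less_top_ennreal)
    have d: "?d \<le> W x + ?c n"
    proof -
      obtain u where "u \<in> S n"
        using S_ne by blast
      then have "?d + (cost D (x, u) + (\<integral>\<^sup>+y. Wn n y \<partial>trans D (x, u))) \<le> W x + ?c n"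
        using iff by (auto simp: S_def)
      then show ?thesis
        by (rule order_trans[rotated]) simp
    qed
    have "?d + y \<le> W x + ?c n \<longleftrightarrow> y \<le> t" for y
    proof -
      have "W x + ?c n = ?d + t"
        using d unfolding t_def by (rule ennreal_ineq_diff_add)
      then show ?thesis
        by (simp only: ennreal_add_left_cancel_le) (simp split: split_indicator)
    qed
    then have "S n = snd ` ({k \<in> gr D. cost D k + (\<integral>\<^sup>+y. Wn n y \<partial>trans D k) \<le> t} \<inter> ({x} \<times> UNIV))"
      using iff unfolding S_def by (force simp: gr_iff)
    also have "compact \<dots>"
      by (intro compact_continuous_image continuous_intros compact_Int_closed compact_sublevel Wn t
          closed_Times closed_UNIV closed_singleton)
    finally show ?thesis .
  qed
  have "decseq S"
  proof (rule decseq_SucI)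
    fix n
    have mono: "?h n u \<le> ?h (Suc n) u" for u
      by (intro add_left_mono nn_integral_mono Wn_mono)
    then show "S (Suc n) \<subseteq> S n"
      unfolding S_def by (blast intro: order_trans[OF mono])
  qed
  then have "(\<Inter>n. S n) \<noteq> {}"
    by (rule decseq_compact_Inter_nonempty[OF S_compact S_ne])
  then obtain u where u: "\<And>n. u \<in> S n"
    by blast
  then have k: "(x, u) \<in> gr D"
    by (auto simp: S_def gr_iff)
  have "bell W x \<le> cost' (x, u) + (\<integral>\<^sup>+y. W y \<partial>killed (x, u))"
    using bell_le[OF k, of W] by simp
  also have "\<dots> = (SUP n. ?h n u)"
    by (simp add: nn_integral_W_killed[OF k] ennreal_SUP_add_right)
  also have "\<dots> \<le> W x"
    using u by (intro SUP_least) (auto simp: S_def)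
  finally show ?thesis .
qed

lemma W_selector:
  obtains w where "w \<in> borel \<rightarrow>\<^sub>M borel" "\<And>x. w x \<in> acts D x"
    "\<And>x. W x = cost' (x, w x) + (\<integral>\<^sup>+y. W y \<partial>killed (x, w x))"
proof -
  obtain v C where v: "v \<in> stationary D" "\<And>x. J v x < \<infinity>" "C < \<infinity>" "\<And>x. x \<in> B \<Longrightarrow> J v x \<le> C"
    using ex_stable by blast
  obtain w where w: "w \<in> borel \<rightarrow>\<^sub>M borel" "\<And>x. w x \<in> acts D x"
    "\<And>x. bell W x = cost' (x, w x) + (\<integral>\<^sup>+y. W y \<partial>killed (x, w x))"
    using bell_selector[OF W_meas v(1) W_le_J[OF v(1)] v(2) nn_integral_W_\<nu>] by blast
  have "W x = bell W x" for x
  proof (rule antisym[OF _ bell_W_le])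
    have "(x, w x) \<in> gr D"
      using w(2) by (simp add: gr_iff)
    from W_le[OF this] show "W x \<le> bell W x"
      by (simp add: w(3))
  qed
  with w that show thesis
    by metis
qed

text \<open>Unrolling the fixed point equation \<open>n\<close> times leaves the nonnegative
  remainder \<open>R^n W\<close>; dropping it bounds all partial sums of the cost by
  \<open>W x\<close>. The reverse inequality holds for every stationary policy.\<close>

lemma J_selector:
  assumes w: "w \<in> borel \<rightarrow>\<^sub>M borel" "\<And>x. w x \<in> acts D x"
    "\<And>x. W x = cost' (x, w x) + (\<integral>\<^sup>+y. W y \<partial>killed (x, w x))"
  shows "J (dirac w) x = W x"
proof (rule antisym)
  note v = dirac_stationary[OF w(1,2)]
  have "W y = cost'_of (dirac w) y + R (dirac w) W y" for y
    by (subst w(3)) (simp add: cost'_of_dirac R_dirac w(2))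
  then have unfold: "W = (\<lambda>x. cost'_of (dirac w) x + R (dirac w) W x)"
    by blast
  have "(\<Sum>k<n. (R (dirac w) ^^ k) (cost'_of (dirac w)) x) + (R (dirac w) ^^ n) W x = W x" for n
  proof (induction n)
    case (Suc n)
    have "(R (dirac w) ^^ n) W x = (R (dirac w) ^^ n) (\<lambda>x. cost'_of (dirac w) x + R (dirac w) W x) x"
      by (subst unfold) simp
    also have "\<dots> = (R (dirac w) ^^ n) (cost'_of (dirac w)) x + (R (dirac w) ^^ n) (R (dirac w) W) x"
      by (rule R_funpow_add[OF v cost'_of_meas[OF v] R_meas[OF v W_meas]])
    finally show ?case
      using Suc by (simp add: funpow_swap1 ac_simps)
  qed simp
  then have "(\<Sum>k<n. (R (dirac w) ^^ k) (cost'_of (dirac w)) x) \<le> W x" for n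
    by (metis le_iff_add)
  then show "J (dirac w) x \<le> W x"
    unfolding total_def by (intro suminf_le_const summableI)
  show "W x \<le> J (dirac w) x"
    by (rule W_le_J[OF v])
qed

end

text \<open>With truncated subtraction \<open>c - b\<close> and \<open>b - c\<close> are the
  positive and the negative part of a difference. The identity trades them for the shifted quantity
  \<open>c'\<close> without forming a signed number.\<close>

lemma ennreal_diff_shift:
  fixes b c c' t :: ennreal
  assumes "c' + b = c + t" "b < \<infinity>" "t < \<infinity>"
  shows "c - b + t = c' + (b - c)"
proof (cases "b \<le> c")
  case True
  then have "c = b + (c - b)"
    by (rule ennreal_ineq_diff_add)
  then have "b + c' = b + (c - b + t)"
    using assms(1) by (metis add.assoc add.commute)
  then have "c' = c - b + t"
    using assms(2) by (subst (asm) ennreal_add_left_cancel) auto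
  moreover have "b - c = 0"
    using True assms(2) by (simp add: diff_eq_0_ennreal)
  ultimately show ?thesis
    by simp
next
  case False
  then have "c \<le> b" "c < \<infinity>"
    using assms(2) by auto
  then have "b = c + (b - c)"
    by (intro ennreal_ineq_diff_add)
  then have "c + (c' + (b - c)) = c + t"
    using assms(1) by (metis add.assoc add.commute)
  then have "c' + (b - c) = t"
    using \<open>c < \<infinity>\<close> by (subst (asm) ennreal_add_left_cancel) auto
  moreover have "c - b = 0"
    using \<open>c \<le> b\<close> \<open>c < \<infinity>\<close> by (simp add: diff_eq_0_ennreal)
  ultimately show ?thesis
    by simp
qed

section \<open>The relative value function as a shifted total cost\<close>

context mdp_setting
begin

lemma cost'_of_ge:
  assumes v: "v \<in> stationary D"
  shows "ennreal \<epsilon> \<le> cost'_of v x"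
proof -
  let ?M = "state_action D (v x) x"
  interpret prob_space ?M
    using stationaryD[OF v] by (intro state_action_prob)
  have "ennreal \<epsilon> = (\<integral>\<^sup>+k. ennreal \<epsilon> \<partial>?M)"
    by (simp add: emeasure_space_1)
  also have "\<dots> \<le> cost'_of v x"
    unfolding cost'_of_def by (intro nn_integral_mono cost'_ge state_action_gr)
  finally show ?thesis .
qed

text \<open>Summing the shift gives \<open>P + \<alpha> * A = J + N\<close> for the totals
  \<open>P\<close>, \<open>N\<close> of the positive and the negative part and \<open>A\<close> of
  \<open>atom\<close>. \<open>N\<close> is finite since the negative part lives on \<open>B\<close>,
  where it is at most \<open>\<beta> / \<delta>\<close> times \<open>atom\<close>. A finite
  \<open>J\<close> bounds the expected lifetime by \<open>J / \<epsilon>\<close>; then regeneration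
  is certain, \<open>A = 1\<close>, and \<open>P - N = J - \<alpha>\<close>.\<close>

lemma split_cycle_value_J:
  assumes v: "v \<in> stationary D"
  shows "J v x < \<infinity> \<Longrightarrow> split_cycle_value D B \<nu> \<delta> v x = ereal ((enn2real (J v x) - \<alpha>) / (1 - atom x))"
    and "J v x = \<infinity> \<Longrightarrow> split_cycle_value D B \<nu> \<delta> v x = \<infinity>"
proof -
  let ?b = "\<lambda>y. ennreal ((1 - atom y) * \<beta>)"
  let ?c = "cost_of D v"
  let ?Sp = "split_cycle_sum D B \<nu> \<delta> v (\<lambda>z. split_cost_of D B \<delta> v z - beta D) (x, False)"
  let ?Sn = "split_cycle_sum D B \<nu> \<delta> v (\<lambda>z. beta D - split_cost_of D B \<delta> v z) (x, False)"
  let ?P = "total v (\<lambda>y. ?c y - ?b y) x" and ?N = "total v (\<lambda>y. ?b y - ?c y) x"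
  let ?A = "total v (\<lambda>y. ennreal (atom y)) x"
  note [measurable] = cost_of_meas[OF v] cost'_of_meas[OF v] split_cost_of_meas[OF v]
  have b: "ennreal (1 - atom y) * beta D = ?b y" for y
    using atom[of y] \<beta>_nonneg by (simp add: beta_eq ennreal_mult)
  have "ennreal (1 - atom y) * (split_cost_of D B \<delta> v (y, False) - beta D) = ?c y - ?b y" for y
    by (subst ennreal_right_diff_distrib) (simp_all add: scaled_split_cost_of[OF v] b)
  then have Sp: "ennreal (1 - atom x) * ?Sp = ?P"
    by (subst split_cycle_sum_eq[OF v]) (simp_all add: total_def)
  have "ennreal (1 - atom y) * (beta D - split_cost_of D B \<delta> v (y, False)) = ?b y - ?c y" for y
    by (subst ennreal_right_diff_distrib) (simp_all add: scaled_split_cost_of[OF v] b)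
  then have Sn: "ennreal (1 - atom x) * ?Sn = ?N"
    by (subst split_cycle_sum_eq[OF v]) (simp_all add: total_def)
  have eq: "?P + ennreal \<alpha> * ?A = J v x + ?N"
  proof -
    have "?c y - ?b y + ennreal \<alpha> * ennreal (atom y) = cost'_of v y + (?b y - ?c y)" for y
      by (rule ennreal_diff_shift[OF cost'_of_add[OF v]]) (simp_all add: ennreal_mult_less_top)
    then have "total v (\<lambda>y. ?c y - ?b y + ennreal \<alpha> * ennreal (atom y)) x =
        total v (\<lambda>y. cost'_of v y + (?b y - ?c y)) x"
      by simp
    then show ?thesis
      by (simp add: total_add[OF v] total_cmult[OF v])
  qed
  have N: "?N < \<infinity>"
  proof -
    have "?b y - ?c y \<le> ennreal (\<beta> / \<delta>) * ennreal (atom y)" for y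
    proof (cases "y \<in> B")
      case True
      have "?b y - ?c y \<le> ?b y"
        by simp
      also have "\<dots> \<le> ennreal \<beta>"
        using atom[of y] \<beta>_nonneg by (intro ennreal_leI mult_left_le_one_le) auto
      also have "\<dots> = ennreal (\<beta> / \<delta>) * ennreal (atom y)"
        using True \<delta> \<beta>_nonneg by (simp add: atom ennreal_mult[symmetric])
      finally show ?thesis .
    next
      case False
      then have "?c y = cost'_of v y + ?b y"
        using cost'_of_add[OF v, of y] by (simp add: atom)
      then have "?b y \<le> ?c y"
        by simp
      then show ?thesis
        by (simp add: diff_eq_0_ennreal)
    qed
    then have "?N \<le> total v (\<lambda>y. ennreal (\<beta> / \<delta>) * ennreal (atom y)) x"
      by (rule total_mono)
    also have "\<dots> \<le> ennreal (\<beta> / \<delta>) * 1"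
      using mult_left_mono[OF atom_total(1)[OF v, of x], of "ennreal (\<beta> / \<delta>)"] by (simp add: total_cmult[OF v])
    finally show ?thesis
      by (simp add: order_le_less_trans)
  qed
  have r: "0 < 1 - atom x"
    using atom[of x] by simp
  have Sn_fin: "?Sn < \<infinity>"
    using N r unfolding Sn[symmetric] by (auto simp: ennreal_mult_less_top)
  have A: "?A \<le> 1"
    by (rule atom_total[OF v])
  then have \<alpha>A: "ennreal \<alpha> * ?A < \<infinity>"
    by (auto simp: ennreal_mult_less_top intro: order_le_less_trans)
  {
    assume "J v x = \<infinity>"
    then have "?P = \<infinity>"
      using eq \<alpha>A by (auto simp: ennreal_add_eq_top)
    then have "?Sp = \<infinity>"
      unfolding Sp[symmetric] by (auto simp: ennreal_mult_eq_top_iff)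
    then show "split_cycle_value D B \<nu> \<delta> v x = \<infinity>"
      using Sn_fin by (cases "?Sn") (auto simp: split_cycle_value_def)
  next
    assume Jf: "J v x < \<infinity>"
    have "ennreal \<epsilon> * total v (\<lambda>_. 1) x = total v (\<lambda>y. ennreal \<epsilon> * 1) x"
      by (rule total_cmult[OF v, symmetric]) simp
    also have "\<dots> \<le> J v x"
      using cost'_of_ge[OF v] by (intro total_mono) simp
    finally have "ennreal \<epsilon> * total v (\<lambda>_. 1) x < \<infinity>"
      using Jf by (rule order_le_less_trans)
    then have "total v (\<lambda>_. 1) x < \<infinity>"
      using \<epsilon>(1) by (auto simp: ennreal_mult_less_top)
    then have "?A = 1"
      by (rule atom_total(2)[OF v])
    with eq have eq': "ennreal (1 - atom x) * ?Sp + ennreal \<alpha> = J v x + ennreal (1 - atom x) * ?Sn"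
      by (simp add: Sp Sn)
    moreover obtain j where j: "J v x = ennreal j" "0 \<le> j"
      using Jf by (cases "J v x") auto
    moreover obtain n where n: "?Sn = ennreal n" "0 \<le> n"
      using Sn_fin by (cases "?Sn") auto
    moreover have "ennreal (1 - atom x) * ?Sp < \<infinity>"
      using eq' j n by (metis ennreal_add_eq_top ennreal_mult_eq_top_iff ennreal_neq_top infinity_ennreal_def less_top)
    then obtain p where p: "?Sp = ennreal p" "0 \<le> p"
      using r by (cases "?Sp") (auto simp: ennreal_mult_less_top)
    ultimately have "(1 - atom x) * p + \<alpha> = j + (1 - atom x) * n"
      using r \<alpha>(1) by (simp add: ennreal_mult[symmetric] ennreal_plus[symmetric] del: ennreal_plus)
    then have "p - n = (j - \<alpha>) / (1 - atom x)"
      using r by (simp add: field_simps)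
    then show "split_cycle_value D B \<nu> \<delta> v x = ereal ((enn2real (J v x) - \<alpha>) / (1 - atom x))"
      by (simp add: split_cycle_value_def p n j)
  }
qed

lemma V_star_W: "V_star D B \<nu> \<delta> x = enn2real (W x) - \<alpha>"
proof -
  have r: "0 < 1 - atom x"
    using atom[of x] by simp
  obtain w where w: "w \<in> borel \<rightarrow>\<^sub>M borel" "\<And>x. w x \<in> acts D x"
    "\<And>x. W x = cost' (x, w x) + (\<integral>\<^sup>+y. W y \<partial>killed (x, w x))"
    by (rule W_selector) (rule that)
  have "(INF v\<in>stationary D. split_cycle_value D B \<nu> \<delta> v x) = ereal ((enn2real (W x) - \<alpha>) / (1 - atom x))"
  proof (rule antisym)
    have "split_cycle_value D B \<nu> \<delta> (dirac w) x = ereal ((enn2real (W x) - \<alpha>) / (1 - atom x))"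
      using split_cycle_value_J(1)[OF dirac_stationary[OF w(1,2)]] J_selector[OF w] W_finite by simp
    then show "(INF v\<in>stationary D. split_cycle_value D B \<nu> \<delta> v x) \<le> ereal ((enn2real (W x) - \<alpha>) / (1 - atom x))"
      using INF_lower[OF dirac_stationary[OF w(1,2)], of "\<lambda>v. split_cycle_value D B \<nu> \<delta> v x"] by simp
    show "ereal ((enn2real (W x) - \<alpha>) / (1 - atom x)) \<le> (INF v\<in>stationary D. split_cycle_value D B \<nu> \<delta> v x)"
    proof (rule INF_greatest)
      fix v assume v: "v \<in> stationary D"
      show "ereal ((enn2real (W x) - \<alpha>) / (1 - atom x)) \<le> split_cycle_value D B \<nu> \<delta> v x"
      proof (cases "J v x < \<infinity>")
        case True
        then have "enn2real (W x) \<le> enn2real (J v x)"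
          using W_le_J[OF v] by (intro enn2real_mono) auto
        then show ?thesis
          using r by (simp add: split_cycle_value_J(1)[OF v True] divide_right_mono)
      next
        case False
        then have "J v x = \<infinity>"
          by (simp add: less_top[symmetric])
        then show ?thesis
          by (simp add: split_cycle_value_J(2)[OF v])
      qed
    qed
  qed
  moreover have "(if x \<in> B then 1 - \<delta> else 1) = 1 - atom x"
    by (simp add: atom)
  ultimately show ?thesis
    using r by (simp add: V_star_def)
qed

end

section \<open>The optimality equation\<close>

context mdp_setting
begin

lemma policy_step_eq: "policy_step D \<mu> \<xi> t h =
    (case t of 0 \<Rightarrow> \<mu> | Suc s \<Rightarrow> trans D (h s)) \<bind> (\<lambda>x. state_action D (\<xi> t (h, x)) x)"
  by (simp add: policy_step_def state_action_def)

lemma state_law_meas: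
  assumes \<mu>: "\<mu> \<in> space (prob_algebra borel)"
  shows "(\<lambda>h. case t of 0 \<Rightarrow> \<mu> | Suc s \<Rightarrow> trans D (h s)) \<in> PiM {0..<t} (\<lambda>_. grM D) \<rightarrow>\<^sub>M prob_algebra borel"
proof (cases t)
  case 0
  then show ?thesis
    using \<mu> by simp
next
  case (Suc s)
  then show ?thesis
    using measurable_PiM_coord[OF trans_meas, of s "{0..<Suc s}"] by simp
qed

lemma strategy_kernel_meas:
  assumes \<xi>: "\<xi> \<in> strategies D"
  shows "(\<lambda>(h, x). state_action D (\<xi> t (h, x)) x) \<in>
    PiM {0..<t} (\<lambda>_. grM D) \<Otimes>\<^sub>M borel \<rightarrow>\<^sub>M prob_algebra (grM D)"
proof -
  have "(\<lambda>p. state_action D (\<xi> t p) (snd p)) \<in> PiM {0..<t} (\<lambda>_. grM D) \<Otimes>\<^sub>M borel \<rightarrow>\<^sub>M prob_algebra (grM D)"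
    using \<xi> by (intro state_action_meas) (auto simp: strategies_def space_pair_measure)
  then show ?thesis
    by (simp add: split_def)
qed

lemma policy_step_meas:
  assumes \<mu>: "\<mu> \<in> space (prob_algebra borel)" and \<xi>: "\<xi> \<in> strategies D"
  shows "policy_step D \<mu> \<xi> t \<in> PiM {0..<t} (\<lambda>_. grM D) \<rightarrow>\<^sub>M prob_algebra (grM D)"
  unfolding policy_step_eq[abs_def]
  by (rule measurable_bind_prob_space2[OF state_law_meas[OF \<mu>] strategy_kernel_meas[OF \<xi>]])

lemma nn_integral_policy_step:
  assumes \<mu>: "\<mu> \<in> space (prob_algebra borel)" and \<xi>: "\<xi> \<in> strategies D"
    and h: "h \<in> space (PiM {0..<t} (\<lambda>_. grM D))" and g: "g \<in> borel_measurable (grM D)"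
  shows "(\<integral>\<^sup>+k. g k \<partial>policy_step D \<mu> \<xi> t h) =
    (\<integral>\<^sup>+x. (\<integral>\<^sup>+k. g k \<partial>state_action D (\<xi> t (h, x)) x) \<partial>(case t of 0 \<Rightarrow> \<mu> | Suc s \<Rightarrow> trans D (h s)))"
proof -
  let ?X = "case t of 0 \<Rightarrow> \<mu> | Suc s \<Rightarrow> trans D (h s)"
  have "?X \<in> space (prob_algebra borel)"
    using measurable_space[OF state_law_meas[OF \<mu>] h] .
  then have X: "sets ?X = sets borel"
    by (simp add: space_prob_algebra)
  have "(\<lambda>x. state_action D (\<xi> t (h, x)) x) \<in> borel \<rightarrow>\<^sub>M prob_algebra (grM D)"
    using measurable_compose[OF measurable_Pair1'[OF h] strategy_kernel_meas[OF \<xi>]] by simp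
  then have "(\<lambda>x. state_action D (\<xi> t (h, x)) x) \<in> ?X \<rightarrow>\<^sub>M subprob_algebra (grM D)"
    by (intro measurable_prob_algebraD) (simp add: measurable_cong_sets[OF X refl])
  then show ?thesis
    unfolding policy_step_eq by (rule nn_integral_bind[OF g])
qed

lemma policy_law_sets:
  assumes "\<mu> \<in> space (prob_algebra borel)" "\<xi> \<in> strategies D"
  shows "sets (policy_law D \<mu> \<xi>) = sets (PiM UNIV (\<lambda>_. grM D))"
  unfolding policy_law_def by (rule sets_process_law[OF policy_step_meas[OF assms]])

lemma policy_law_prob:
  assumes "\<mu> \<in> space (prob_algebra borel)" "\<xi> \<in> strategies D"
  shows "prob_space (policy_law D \<mu> \<xi>)"
  unfolding policy_law_def by (rule prob_space_process_law[OF policy_step_meas[OF assms]])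

lemma policy_law_gr:
  assumes "\<mu> \<in> space (prob_algebra borel)" "\<xi> \<in> strategies D" "\<omega> \<in> space (policy_law D \<mu> \<xi>)"
  shows "\<omega> n \<in> gr D"
  using assms(3) sets_eq_imp_space_eq[OF policy_law_sets[OF assms(1,2)]]
  by (simp add: space_PiM PiE_iff space_grM)

lemma policy_law_coord_meas:
  assumes "\<mu> \<in> space (prob_algebra borel)" "\<xi> \<in> strategies D" "g \<in> grM D \<rightarrow>\<^sub>M N"
  shows "(\<lambda>\<omega>. g (\<omega> n)) \<in> policy_law D \<mu> \<xi> \<rightarrow>\<^sub>M N"
  unfolding measurable_cong_sets[OF policy_law_sets[OF assms(1,2)] refl]
  by (rule measurable_PiM_coord[OF assms(3)]) simp

lemma restrict_in_space:
  assumes "\<mu> \<in> space (prob_algebra borel)" "\<xi> \<in> strategies D" "\<omega> \<in> space (policy_law D \<mu> \<xi>)"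
  shows "restrict \<omega> {0..<n} \<in> space (PiM {0..<n} (\<lambda>_. grM D))"
  using policy_law_gr[OF assms] by (simp add: space_PiM PiE_iff space_grM)

lemma strategy_prob:
  assumes "\<xi> \<in> strategies D" "h \<in> space (PiM {0..<t} (\<lambda>_. grM D))"
  shows "sets (\<xi> t (h, x)) = sets borel" "emeasure (\<xi> t (h, x)) (acts D x) = 1"
    "prob_space (state_action D (\<xi> t (h, x)) x)"
proof -
  have "\<xi> t (h, x) \<in> space (prob_algebra borel)"
    using assms measurable_space[of "\<xi> t" "PiM {0..<t} (\<lambda>_. grM D) \<Otimes>\<^sub>M borel" "prob_algebra borel" "(h, x)"]
    by (auto simp: strategies_def space_pair_measure)
  then show 1: "sets (\<xi> t (h, x)) = sets borel"
    by (simp add: space_prob_algebra)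
  show 2: "emeasure (\<xi> t (h, x)) (acts D x) = 1"
    using assms by (auto simp: strategies_def)
  show "prob_space (state_action D (\<xi> t (h, x)) x)"
    by (rule state_action_prob[OF 1 2])
qed

lemma AE_state_action_fst:
  assumes "sets \<kappa> = sets borel"
  shows "AE k in state_action D \<kappa> x. fst k = x"
  unfolding state_action_def
  by (subst AE_distr_iff[OF Pair_meas'[OF assms]]) (auto simp: fst_grM)

text \<open>The action at a given time is drawn after the state and leaves it unchanged, so the mean
  of a function of the next state depends on the strategy only through the law of the current
  pair.\<close>

lemma nn_integral_policy_law_state:
  assumes \<mu>: "\<mu> \<in> space (prob_algebra borel)" and \<xi>: "\<xi> \<in> strategies D" and f: "f \<in> borel_measurable borel"
  shows "(\<integral>\<^sup>+\<omega>. f (fst (\<omega> 0)) \<partial>policy_law D \<mu> \<xi>) = (\<integral>\<^sup>+x. f x \<partial>\<mu>)"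
    and "(\<integral>\<^sup>+\<omega>. f (fst (\<omega> (Suc n))) \<partial>policy_law D \<mu> \<xi>) =
      (\<integral>\<^sup>+\<omega>. (\<integral>\<^sup>+y. f y \<partial>trans D (\<omega> n)) \<partial>policy_law D \<mu> \<xi>)"
proof -
  have f': "(\<lambda>k. f (fst k)) \<in> borel_measurable (grM D)"
    using f by measurable
  have step: "(\<integral>\<^sup>+\<omega>. f (fst (\<omega> t)) \<partial>policy_law D \<mu> \<xi>) =
      (\<integral>\<^sup>+\<omega>. (\<integral>\<^sup>+x. f x \<partial>(case t of 0 \<Rightarrow> \<mu> | Suc s \<Rightarrow> trans D (\<omega> s))) \<partial>policy_law D \<mu> \<xi>)" for t
  proof -
    have "(\<integral>\<^sup>+\<omega>. f (fst (\<omega> t)) \<partial>policy_law D \<mu> \<xi>) =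
        (\<integral>\<^sup>+\<omega>. (\<integral>\<^sup>+k. f (fst k) \<partial>policy_step D \<mu> \<xi> t (restrict \<omega> {0..<t})) \<partial>policy_law D \<mu> \<xi>)"
      unfolding policy_law_def
      by (rule nn_integral_process_law_coord[OF policy_step_meas[OF \<mu> \<xi>] f'])
    also have "\<dots> = (\<integral>\<^sup>+\<omega>. (\<integral>\<^sup>+x. f x \<partial>(case t of 0 \<Rightarrow> \<mu> | Suc s \<Rightarrow> trans D (\<omega> s))) \<partial>policy_law D \<mu> \<xi>)"
    proof (rule nn_integral_cong)
      fix \<omega> assume "\<omega> \<in> space (policy_law D \<mu> \<xi>)"
      then have h: "restrict \<omega> {0..<t} \<in> space (PiM {0..<t} (\<lambda>_. grM D))"
        by (rule restrict_in_space[OF \<mu> \<xi>])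
      have "(\<integral>\<^sup>+k. f (fst k) \<partial>state_action D (\<xi> t (restrict \<omega> {0..<t}, x)) x) = f x" for x
      proof -
        interpret prob_space "state_action D (\<xi> t (restrict \<omega> {0..<t}, x)) x"
          by (rule strategy_prob[OF \<xi> h])
        have "(\<integral>\<^sup>+k. f (fst k) \<partial>state_action D (\<xi> t (restrict \<omega> {0..<t}, x)) x) =
            (\<integral>\<^sup>+k. f x \<partial>state_action D (\<xi> t (restrict \<omega> {0..<t}, x)) x)"
        proof (rule nn_integral_cong_AE)
          show "AE k in state_action D (\<xi> t (restrict \<omega> {0..<t}, x)) x. f (fst k) = f x"
            using AE_state_action_fst[OF strategy_prob(1)[OF \<xi> h], of x x] by eventually_elim simp
        qed
        then show ?thesis
          by (simp add: emeasure_space_1)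
      qed
      then have "(\<integral>\<^sup>+k. f (fst k) \<partial>policy_step D \<mu> \<xi> t (restrict \<omega> {0..<t})) =
          (\<integral>\<^sup>+x. f x \<partial>(case t of 0 \<Rightarrow> \<mu> | Suc s \<Rightarrow> trans D (restrict \<omega> {0..<t} s)))"
        by (subst nn_integral_policy_step[OF \<mu> \<xi> h f']) simp
      also have "(case t of 0 \<Rightarrow> \<mu> | Suc s \<Rightarrow> trans D (restrict \<omega> {0..<t} s)) =
          (case t of 0 \<Rightarrow> \<mu> | Suc s \<Rightarrow> trans D (\<omega> s))"
        by (cases t) auto
      finally show "(\<integral>\<^sup>+k. f (fst k) \<partial>policy_step D \<mu> \<xi> t (restrict \<omega> {0..<t})) =
          (\<integral>\<^sup>+x. f x \<partial>(case t of 0 \<Rightarrow> \<mu> | Suc s \<Rightarrow> trans D (\<omega> s)))" .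
    qed
    finally show ?thesis .
  qed
  interpret prob_space "policy_law D \<mu> \<xi>"
    by (rule policy_law_prob[OF \<mu> \<xi>])
  show "(\<integral>\<^sup>+\<omega>. f (fst (\<omega> 0)) \<partial>policy_law D \<mu> \<xi>) = (\<integral>\<^sup>+x. f x \<partial>\<mu>)"
    using step[of 0] by (simp add: emeasure_space_1)
  show "(\<integral>\<^sup>+\<omega>. f (fst (\<omega> (Suc n))) \<partial>policy_law D \<mu> \<xi>) =
      (\<integral>\<^sup>+\<omega>. (\<integral>\<^sup>+y. f y \<partial>trans D (\<omega> n)) \<partial>policy_law D \<mu> \<xi>)"
    using step[of "Suc n"] by simp
qed

lemma stationary_strategy:
  assumes v: "v \<in> stationary D"
  shows "stationary_strategy v \<in> strategies D"
proof -
  have "stationary_strategy v t \<in> PiM {0..<t} (\<lambda>_. grM D) \<Otimes>\<^sub>M borel \<rightarrow>\<^sub>M prob_algebra borel" for t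
    unfolding stationary_strategy_def split_def
    by (rule measurable_compose[OF measurable_snd stationaryD(1)[OF v]])
  then show ?thesis
    using stationaryD(4)[OF v] by (auto simp: strategies_def stationary_strategy_def)
qed

text \<open>The Bellman equality for \<open>W\<close> holds only at the minimizing action. This lets
  it be integrated along the trajectory, where under a deterministic selector the action is a
  function of the state.\<close>

lemma nn_integral_policy_law_dirac:
  assumes \<mu>: "\<mu> \<in> space (prob_algebra borel)" and w: "w \<in> borel \<rightarrow>\<^sub>M borel" "\<And>x. w x \<in> acts D x"
    and g: "g \<in> borel_measurable (grM D)"
  shows "(\<integral>\<^sup>+\<omega>. g (\<omega> n) \<partial>policy_law D \<mu> (stationary_strategy (dirac w))) =
    (\<integral>\<^sup>+\<omega>. g (fst (\<omega> n), w (fst (\<omega> n))) \<partial>policy_law D \<mu> (stationary_strategy (dirac w)))"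
proof -
  note \<xi> = stationary_strategy[OF dirac_stationary[OF w]]
  let ?L = "policy_law D \<mu> (stationary_strategy (dirac w))"
  have "(\<lambda>k. (fst k, w (fst k))) \<in> grM D \<rightarrow>\<^sub>M grM D"
  proof -
    have "(\<lambda>k. (fst k, w (fst k))) \<in> grM D \<rightarrow>\<^sub>M borel \<Otimes>\<^sub>M borel"
      using w(1) by measurable
    then have "(\<lambda>k. (fst k, w (fst k))) \<in> grM D \<rightarrow>\<^sub>M borel"
      by (simp add: borel_prod)
    then have "(\<lambda>k. (fst k, w (fst k))) \<in> grM D \<rightarrow>\<^sub>M restrict_space borel (gr D)"
      by (intro measurable_restrict_space2) (auto simp: gr_iff w)
    then show ?thesis
      by (simp add: grM_def)
  qed
  then have g': "(\<lambda>k. g (fst k, w (fst k))) \<in> borel_measurable (grM D)"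
    using g by (rule measurable_compose)
  have strat: "stationary_strategy (dirac w) n (h, x) = dirac w x" for h x
    by (simp add: stationary_strategy_def)
  have "(\<integral>\<^sup>+k. g k \<partial>policy_step D \<mu> (stationary_strategy (dirac w)) n h) =
      (\<integral>\<^sup>+k. g (fst k, w (fst k)) \<partial>policy_step D \<mu> (stationary_strategy (dirac w)) n h)"
    if h: "h \<in> space (PiM {0..<n} (\<lambda>_. grM D))" for h
    using nn_integral_state_action_dirac[of w, OF w(2) g] nn_integral_state_action_dirac[of w, OF w(2) g']
    by (simp add: nn_integral_policy_step[OF \<mu> \<xi> h g] nn_integral_policy_step[OF \<mu> \<xi> h g'] strat)
  then have "(\<integral>\<^sup>+\<omega>. (\<integral>\<^sup>+k. g k \<partial>policy_step D \<mu> (stationary_strategy (dirac w)) n (restrict \<omega> {0..<n})) \<partial>?L) =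
      (\<integral>\<^sup>+\<omega>. (\<integral>\<^sup>+k. g (fst k, w (fst k)) \<partial>policy_step D \<mu> (stationary_strategy (dirac w)) n (restrict \<omega> {0..<n})) \<partial>?L)"
    by (rule nn_integral_cong) (simp add: restrict_in_space[OF \<mu> \<xi>])
  then show ?thesis
    using nn_integral_process_law_coord[OF policy_step_meas[OF \<mu> \<xi>] g]
      nn_integral_process_law_coord[OF policy_step_meas[OF \<mu> \<xi>] g']
    unfolding policy_law_def by simp
qed

lemma nn_integral_policy_law_cost_sum:
  assumes \<mu>: "\<mu> \<in> space (prob_algebra borel)" and \<xi>: "\<xi> \<in> strategies D"
  shows "(\<integral>\<^sup>+\<omega>. (\<Sum>n<N. cost D (\<omega> n)) \<partial>policy_law D \<mu> \<xi>) = (\<Sum>n<N. \<integral>\<^sup>+\<omega>. cost D (\<omega> n) \<partial>policy_law D \<mu> \<xi>)"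
  by (rule nn_integral_sum) (rule policy_law_coord_meas[OF \<mu> \<xi> cost_meas])

lemma beta_le_average_cost:
  assumes "\<mu> \<in> space (prob_algebra borel)" and "\<xi> \<in> strategies D"
  shows "ennreal \<beta> \<le> average_cost D \<mu> \<xi>"
  unfolding beta_eq[symmetric] beta_def optimal_cost_def using assms
  by (auto intro!: INF_lower2[OF assms(1)] INF_lower2[OF assms(2)])

lemma atom_coefficient:
  "ennreal (\<beta> * \<delta> + \<beta> + \<epsilon>) * indicator B x = ennreal (\<beta> + \<alpha>) * ennreal (atom x)"
proof (cases "x \<in> B")
  case True
  have "(\<beta> + \<alpha>) * \<delta> = \<beta> * \<delta> + \<beta> + \<epsilon>"
    using \<alpha>(2) by (simp add: distrib_right)
  with True \<alpha>(1) \<beta>_nonneg \<delta> show ?thesis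
    by (simp add: atom ennreal_mult[symmetric] del: ennreal_plus)
qed (simp add: atom)

text \<open>The value of \<nu>(W) is still unknown here. The two terms with \<open>atom\<close> are
  kept apart because their difference is exactly what decides the comparison with \<beta>.\<close>

lemma W_bellman_le:
  assumes k: "k \<in> gr D"
  shows "W (fst k) + (ennreal \<beta> + ennreal (atom (fst k)) * (\<integral>\<^sup>+y. W y \<partial>\<nu>)) \<le>
    ennreal (\<beta> + \<alpha>) * ennreal (atom (fst k)) + (cost D k + (\<integral>\<^sup>+y. W y \<partial>trans D k))"
proof -
  have "ennreal (\<beta> * \<delta> + \<beta> + \<epsilon>) * indicator B (fst k) = ennreal (\<beta> + \<alpha>) * ennreal (atom (fst k))"
    by (rule atom_coefficient)
  then show ?thesis
    using add_right_mono[OF W_le[OF k], of "ennreal \<beta> + ennreal (atom (fst k)) * (\<integral>\<^sup>+y. W y \<partial>\<nu>)"]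
      bellman_killed_trans[OF k W_meas] by simp
qed

lemma W_bellman_eq:
  assumes w: "\<And>x. w x \<in> acts D x" "\<And>x. W x = cost' (x, w x) + (\<integral>\<^sup>+y. W y \<partial>killed (x, w x))"
  shows "W x + (ennreal \<beta> + ennreal (atom x) * (\<integral>\<^sup>+y. W y \<partial>\<nu>)) =
    ennreal (\<beta> + \<alpha>) * ennreal (atom x) + (cost D (x, w x) + (\<integral>\<^sup>+y. W y \<partial>trans D (x, w x)))"
proof -
  have k: "(x, w x) \<in> gr D"
    by (simp add: gr_iff w)
  have "ennreal (\<beta> * \<delta> + \<beta> + \<epsilon>) * indicator B x = ennreal (\<beta> + \<alpha>) * ennreal (atom x)"
    by (rule atom_coefficient)
  then show ?thesis
    using bellman_killed_trans[OF k W_meas] w(2)[of x] by simp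
qed

text \<open>(H2) rewritten through \<open>V_star = W - \<alpha>\<close>; the new constant absorbs
  \<open>\<theta> * \<alpha>\<close> and is made nonnegative.\<close>

lemma cost_W_bound: "\<exists>\<theta> K. 0 < \<theta> \<and> \<theta> < 1 \<and> 0 \<le> K \<and> (\<forall>k\<in>gr D. ennreal \<theta> * W (fst k) \<le> cost D k + ennreal K)"
proof -
  obtain \<theta> K where \<theta>: "0 < \<theta>" "\<theta> < 1"
    and H: "\<And>x. ereal (\<theta> * (enn2real (W x) - \<alpha>) - K) \<le> enn2ereal (INF u\<in>acts D x. cost D (x, u))"
    using H2 by (auto simp: H2_def V_star_W)
  define K' where "K' = max 0 (\<theta> * \<alpha> + K)"
  have "ennreal \<theta> * W (fst k) \<le> cost D k + ennreal K'" if k: "k \<in> gr D" for k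
  proof (cases "cost D k" rule: ennreal_cases)
    case (real c)
    have "(INF u\<in>acts D (fst k). cost D (fst k, u)) \<le> cost D k"
      using k by (cases k) (auto simp: gr_iff intro: INF_lower)
    then have "ereal (\<theta> * (enn2real (W (fst k)) - \<alpha>) - K) \<le> enn2ereal (cost D k)"
      using H[of "fst k"] by (meson order_trans less_eq_ennreal.rep_eq)
    then have "\<theta> * enn2real (W (fst k)) \<le> c + K'"
      using real by (simp add: K'_def algebra_simps)
    then have "ennreal (\<theta> * enn2real (W (fst k))) \<le> ennreal (c + K')"
      by (rule ennreal_leI)
    also have "\<dots> = cost D k + ennreal K'"
      using real by (simp add: K'_def)
    also have "ennreal (\<theta> * enn2real (W (fst k))) = ennreal \<theta> * W (fst k)"
      using \<theta> W_finite[of "fst k"] by (simp add: ennreal_mult)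
    finally show ?thesis .
  qed simp
  then show ?thesis
    using \<theta> by (intro exI[of _ \<theta>] exI[of _ K']) (auto simp: K'_def)
qed

text \<open>Cheap steps happen only on \<open>B\<close>, where
  \<open>\<alpha> * \<delta> = \<beta> + \<epsilon>\<close> compensates. In the mean, a low running
  cost therefore forces a positive frequency of regenerations.\<close>

lemma cost_atom_ge: "k \<in> gr D \<Longrightarrow> ennreal (\<beta> + \<epsilon>) \<le> cost D k + ennreal \<alpha> * ennreal (atom (fst k))"
  using \<alpha> \<delta> cost_off_B[of k]
  by (cases "fst k \<in> B") (auto simp: atom ennreal_mult[symmetric] intro: order_trans[of _ "ennreal (\<beta> + \<epsilon>)"])

lemma W_fst_meas: "(\<lambda>k. W (fst k)) \<in> borel_measurable (grM D)"
  and atom_fst_meas: "(\<lambda>k. ennreal (atom (fst k))) \<in> borel_measurable (grM D)"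
  by measurable

lemma mean_atom_le_1:
  assumes \<mu>: "\<mu> \<in> space (prob_algebra borel)" and \<xi>: "\<xi> \<in> strategies D"
  shows "(\<integral>\<^sup>+\<omega>. ennreal (atom (fst (\<omega> n))) \<partial>policy_law D \<mu> \<xi>) \<le> 1"
proof -
  interpret prob_space "policy_law D \<mu> \<xi>"
    by (rule policy_law_prob[OF \<mu> \<xi>])
  have "(\<integral>\<^sup>+\<omega>. ennreal (atom (fst (\<omega> n))) \<partial>policy_law D \<mu> \<xi>) \<le> (\<integral>\<^sup>+\<omega>. 1 \<partial>policy_law D \<mu> \<xi>)"
    using atom by (intro nn_integral_mono) (auto intro: less_imp_le)
  then show ?thesis
    by (simp add: emeasure_space_1)
qed

lemma mean_cost_atom_ge:
  assumes \<mu>: "\<mu> \<in> space (prob_algebra borel)" and \<xi>: "\<xi> \<in> strategies D"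
  shows "ennreal (\<beta> + \<epsilon>) \<le> (\<integral>\<^sup>+\<omega>. cost D (\<omega> n) \<partial>policy_law D \<mu> \<xi>) +
    ennreal \<alpha> * (\<integral>\<^sup>+\<omega>. ennreal (atom (fst (\<omega> n))) \<partial>policy_law D \<mu> \<xi>)"
proof -
  let ?L = "policy_law D \<mu> \<xi>"
  interpret prob_space ?L
    by (rule policy_law_prob[OF \<mu> \<xi>])
  note [measurable] = policy_law_coord_meas[OF \<mu> \<xi> cost_meas] policy_law_coord_meas[OF \<mu> \<xi> atom_fst_meas]
  have "(\<integral>\<^sup>+\<omega>. ennreal (\<beta> + \<epsilon>) \<partial>?L) \<le> (\<integral>\<^sup>+\<omega>. cost D (\<omega> n) + ennreal \<alpha> * ennreal (atom (fst (\<omega> n))) \<partial>?L)"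
    by (intro nn_integral_mono cost_atom_ge policy_law_gr[OF \<mu> \<xi>])
  then show ?thesis
    by (simp add: nn_integral_add nn_integral_cmult emeasure_space_1 del: ennreal_plus)
qed

section \<open>The value of \<nu>(W)\<close>

definition m\<nu> :: real where "m\<nu> = enn2real (\<integral>\<^sup>+y. W y \<partial>\<nu>)"

lemma m\<nu>: "(\<integral>\<^sup>+y. W y \<partial>\<nu>) = ennreal m\<nu>" "0 \<le> m\<nu>"
  using nn_integral_W_\<nu> by (simp_all add: m\<nu>_def)

text \<open>Otherwise, summing the Bellman inequality along a nearly optimal strategy makes the mean of
  \<open>W\<close> grow linearly in time, whereas (H2) bounds it by the mean cost, which is bounded on average.\<close>

lemma m\<nu>_le: "m\<nu> \<le> \<beta> + \<alpha>"
proof (rule ccontr)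
  assume not_le: "\<not> ?thesis"
  \<comment> \<open>The excess of \<nu>(W) contributes
    \<open>(m\<nu> - \<beta> - \<alpha>) * e n = g * \<alpha> * e n\<close> in step
    \<open>n\<close>, and \<open>\<alpha> * e n\<close> is at least
    \<open>\<beta> + \<epsilon> - c n\<close>.\<close>
  define g where "g = (m\<nu> - \<beta> - \<alpha>) / \<alpha>"
  have g: "0 < g"
    using not_le \<alpha>(1) by (simp add: g_def)
  obtain \<theta> K where \<theta>: "0 < \<theta>" "0 \<le> K" "\<And>k. k \<in> gr D \<Longrightarrow> ennreal \<theta> * W (fst k) \<le> cost D k + ennreal K"
    using cost_W_bound by blast
  \<comment> \<open>Chosen so that \<open>(1 + g) * \<eta> = g * \<epsilon> / 2\<close>: half of the
    gain per step survives the suboptimality of the strategy.\<close>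
  define \<eta> where "\<eta> = g * \<epsilon> / (2 * (g + 1))"
  have \<eta>: "0 < \<eta>"
    using g \<epsilon> by (simp add: \<eta>_def)
  have "beta D < ennreal (\<beta> + \<eta>)"
    using \<eta> \<beta>_nonneg by (simp add: beta_eq ennreal_less_iff del: ennreal_plus)
  then obtain \<mu> \<xi> where \<mu>: "\<mu> \<in> space (prob_algebra borel)" and \<xi>: "\<xi> \<in> strategies D"
    and avg: "average_cost D \<mu> \<xi> < ennreal (\<beta> + \<eta>)"
    unfolding beta_def optimal_cost_def by (auto simp: INF_less_iff)
  let ?L = "policy_law D \<mu> \<xi>"
  define c where "c n = (\<integral>\<^sup>+\<omega>. cost D (\<omega> n) \<partial>?L)" for n
  define w where "w n = (\<integral>\<^sup>+\<omega>. W (fst (\<omega> n)) \<partial>?L)" for n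
  define e where "e n = (\<integral>\<^sup>+\<omega>. ennreal (atom (fst (\<omega> n))) \<partial>?L)" for n
  interpret prob_space ?L
    by (rule policy_law_prob[OF \<mu> \<xi>])
  note meas = policy_law_coord_meas[OF \<mu> \<xi>]
  note [measurable] = meas[OF cost_meas] meas[OF W_fst_meas] meas[OF atom_fst_meas]
    meas[OF nn_integral_trans_meas[OF W_meas]]
  have gr: "\<omega> n \<in> gr D" if "\<omega> \<in> space ?L" for \<omega> n
    using policy_law_gr[OF \<mu> \<xi> that] .
  have e_fin: "e n \<le> 1" for n
    unfolding e_def by (rule mean_atom_le_1[OF \<mu> \<xi>])
  have 1: "w n + (ennreal \<beta> + e n * ennreal m\<nu>) \<le> ennreal (\<beta> + \<alpha>) * e n + (c n + w (Suc n))" for n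
  proof -
    have "(\<integral>\<^sup>+\<omega>. W (fst (\<omega> n)) + (ennreal \<beta> + ennreal (atom (fst (\<omega> n))) * ennreal m\<nu>) \<partial>?L) \<le>
        (\<integral>\<^sup>+\<omega>. ennreal (\<beta> + \<alpha>) * ennreal (atom (fst (\<omega> n))) +
          (cost D (\<omega> n) + (\<integral>\<^sup>+y. W y \<partial>trans D (\<omega> n))) \<partial>?L)"
      by (intro nn_integral_mono) (use W_bellman_le[OF gr] m\<nu> in simp)
    then show ?thesis
      using nn_integral_policy_law_state(2)[OF \<mu> \<xi> W_meas, of n]
      by (simp add: nn_integral_add nn_integral_cmult nn_integral_multc w_def e_def c_def emeasure_space_1)
  qed
  have 2: "ennreal \<theta> * w n \<le> c n + ennreal K" for n
  proof -
    have "(\<integral>\<^sup>+\<omega>. ennreal \<theta> * W (fst (\<omega> n)) \<partial>?L) \<le> (\<integral>\<^sup>+\<omega>. cost D (\<omega> n) + ennreal K \<partial>?L)"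
      by (intro nn_integral_mono \<theta> gr)
    then show ?thesis
      by (simp add: nn_integral_add nn_integral_cmult w_def c_def emeasure_space_1)
  qed
  have 3: "ennreal (\<beta> + \<epsilon>) \<le> c n + ennreal \<alpha> * e n" for n
    unfolding c_def e_def by (rule mean_cost_atom_ge[OF \<mu> \<xi>])
  have "\<forall>\<^sub>F N in sequentially. (\<Sum>n<N. c n) / of_nat N < ennreal (\<beta> + \<eta>)"
    using avg unfolding average_cost_def nn_integral_policy_law_cost_sum[OF \<mu> \<xi>] c_def[symmetric]
    by (rule Limsup_lessD)
  then obtain N0 where N0: "\<And>N. N0 \<le> N \<Longrightarrow> (\<Sum>n<N. c n) / of_nat N < ennreal (\<beta> + \<eta>)"
    by (auto simp: eventually_sequentially)
  have sum_le: "(\<Sum>n<N. c n) \<le> ennreal (real N * (\<beta> + \<eta>))" if "N0 \<le> N" "0 < N" for N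
  proof -
    have "(\<Sum>n<N. c n) = of_nat N * ((\<Sum>n<N. c n) / of_nat N)"
      using that by (subst ennreal_times_divide, subst mult.commute, subst ennreal_mult_divide_eq) auto
    also have "\<dots> \<le> of_nat N * ennreal (\<beta> + \<eta>)"
      using N0[OF that(1)] by (intro mult_left_mono) auto
    also have "\<dots> = ennreal (real N * (\<beta> + \<eta>))"
      using \<eta> \<beta>_nonneg by (simp add: ennreal_mult ennreal_of_nat_eq_real_of_nat del: ennreal_plus)
    finally show ?thesis .
  qed
  have c_fin: "c n < \<infinity>" for n
  proof -
    let ?N = "N0 + Suc n"
    have "c n \<le> (\<Sum>n<?N. c n)"
      by (rule member_le_sum) auto
    also have "\<dots> \<le> ennreal (real ?N * (\<beta> + \<eta>))"
      by (rule sum_le) auto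
    finally show ?thesis
      by (simp add: order_le_less_trans del: ennreal_plus)
  qed
  have w_fin: "w n < \<infinity>" for n
  proof -
    have "ennreal \<theta> * w n < \<infinity>"
      using 2[of n] c_fin[of n] by (auto intro: order_le_less_trans)
    then show ?thesis
      using \<theta>(1) by (auto simp: ennreal_mult_less_top)
  qed
  define c' where "c' n = enn2real (c n)" for n
  define w' where "w' n = enn2real (w n)" for n
  define e' where "e' n = enn2real (e n)" for n
  have c': "c n = ennreal (c' n)" "0 \<le> c' n" for n
    using c_fin[of n] by (simp_all add: c'_def)
  have w': "w n = ennreal (w' n)" "0 \<le> w' n" for n
    using w_fin[of n] by (simp_all add: w'_def)
  have e': "e n = ennreal (e' n)" "0 \<le> e' n" for n
    using e_fin[of n] by (simp_all add: e'_def order_le_less_trans)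
  note simps = ennreal_mult[symmetric] ennreal_plus[symmetric]
  have 1: "w' n + \<beta> + e' n * m\<nu> \<le> (\<beta> + \<alpha>) * e' n + c' n + w' (Suc n)" for n
  proof -
    have "0 \<le> (\<beta> + \<alpha>) * e' n"
      using e'[of n] \<alpha>(1) \<beta>_nonneg by simp
    then have nonneg: "0 \<le> (\<beta> + \<alpha>) * e' n + (c' n + w' (Suc n))"
      using c'(2)[of n] w'(2)[of "Suc n"] by simp
    have "ennreal (w' n + (\<beta> + e' n * m\<nu>)) \<le> ennreal ((\<beta> + \<alpha>) * e' n + (c' n + w' (Suc n)))"
      using 1[of n] c'[of n] w'[of n] w'[of "Suc n"] e'[of n] m\<nu>(2) \<alpha>(1) \<beta>_nonneg
      by (simp add: simps add_nonneg_nonneg del: ennreal_plus ennreal_le_iff)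
    then show ?thesis
      using nonneg by (subst (asm) ennreal_le_iff) (simp_all add: add.assoc)
  qed
  have 2: "\<theta> * w' n \<le> c' n + K" for n
  proof -
    have "ennreal (\<theta> * w' n) \<le> ennreal (c' n + K)"
      using 2[of n] c'[of n] w'[of n] \<theta>(1,2)
      by (simp add: simps add_nonneg_nonneg del: ennreal_plus ennreal_le_iff)
    then show ?thesis
      using c'(2)[of n] \<theta>(2) by (subst (asm) ennreal_le_iff) simp_all
  qed
  have 3: "\<beta> + \<epsilon> \<le> c' n + \<alpha> * e' n" for n
    using 3[of n] c'[of n] e'[of n] \<alpha>(1) \<beta>_nonneg \<epsilon>(1)
    by (simp add: simps ennreal_le_iff2 add_nonneg_nonneg del: ennreal_plus)
  have sum_le: "(\<Sum>n<N. c' n) \<le> real N * (\<beta> + \<eta>)" if "N0 \<le> N" "0 < N" for N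
  proof -
    have "ennreal (\<Sum>n<N. c' n) \<le> ennreal (real N * (\<beta> + \<eta>))"
      using sum_le[OF that] c' by (simp add: sum_ennreal)
    then show ?thesis
      using \<beta>_nonneg \<eta> by (subst (asm) ennreal_le_iff) auto
  qed
  have 4: "w' n + \<beta> + g * (\<beta> + \<epsilon> - c' n) \<le> c' n + w' (Suc n)" for n
  proof -
    have "g * (\<beta> + \<epsilon> - c' n) \<le> g * (\<alpha> * e' n)"
      using 3[of n] g by (intro mult_left_mono) auto
    also have "\<dots> = (m\<nu> - \<beta> - \<alpha>) * e' n"
      using \<alpha>(1) by (simp add: g_def)
    finally show ?thesis
      using 1[of n] by (simp add: algebra_simps)
  qed
  have 5: "real N * (\<beta> + g * (\<beta> + \<epsilon>)) \<le> (1 + g) * (\<Sum>n<N. c' n) + w' N" for N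
  proof (induction N)
    case (Suc N)
    then show ?case
      using 4[of N] by (simp add: algebra_simps)
  qed (simp add: w')
  define q where "q = g * \<epsilon> / 2"
  have q: "0 < q"
    using g \<epsilon> by (simp add: q_def)
  have 6: "real N * q \<le> w' N" if "N0 \<le> N" "0 < N" for N
  proof -
    have "(1 + g) * (\<Sum>n<N. c' n) \<le> (1 + g) * (real N * (\<beta> + \<eta>))"
      using sum_le[OF that] g by (intro mult_left_mono) auto
    with 5[of N] have "real N * (\<beta> + g * (\<beta> + \<epsilon>)) \<le> (1 + g) * (real N * (\<beta> + \<eta>)) + w' N"
      by linarith
    moreover have "(1 + g) * (real N * (\<beta> + \<eta>)) = real N * (\<beta> + g * \<beta> + q)"
    proof -
      have "(1 + g) * \<eta> = q"
        using g by (simp add: \<eta>_def q_def field_simps)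
      moreover have "(1 + g) * (real N * (\<beta> + \<eta>)) = real N * (\<beta> + g * \<beta> + (1 + g) * \<eta>)"
        by (simp add: algebra_simps)
      ultimately show ?thesis
        by simp
    qed
    moreover have "g * \<epsilon> = 2 * q"
      by (simp add: q_def)
    then have "real N * (\<beta> + g * (\<beta> + \<epsilon>)) = real N * (\<beta> + g * \<beta> + q) + real N * q"
      by (simp add: algebra_simps)
    ultimately show ?thesis
      by linarith
  qed
  \<comment> \<open>Over the times from \<open>M\<close> to \<open>2 * M\<close> the linear growth
    of the mean of \<open>W\<close>, together with (H2), makes the summed cost quadratic in
    \<open>M\<close>. \<open>M0\<close> is where this exceeds the linear bound
    \<open>2 * M * (\<beta> + \<eta>)\<close>.\<close>
  obtain M0 :: nat where M0: "(2 * (\<beta> + \<eta>) + K) / (\<theta> * q) < real M0"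
    using reals_Archimedean2 by blast
  define M where "M = max (max M0 N0) 1"
  have M: "N0 \<le> M" "0 < M" "real M0 \<le> real M"
    by (auto simp: M_def)
  have "2 * (\<beta> + \<eta>) + K < \<theta> * q * real M"
  proof -
    have "0 < \<theta> * q"
      using \<theta>(1) q by simp
    then have "2 * (\<beta> + \<eta>) + K < real M0 * (\<theta> * q)"
      using M0 by (simp only: pos_divide_less_eq)
    also have "\<dots> \<le> real M * (\<theta> * q)"
      using M(3) \<open>0 < \<theta> * q\<close> by (intro mult_right_mono) auto
    finally show ?thesis
      by (simp add: ac_simps)
  qed
  then have "real M * (2 * (\<beta> + \<eta>)) < real M * (\<theta> * q * real M - K)"
    using M(2) by (intro mult_strict_left_mono) auto
  also have "\<dots> = (\<Sum>n\<in>{M..<2 * M}. \<theta> * q * real M - K)"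
    by simp
  also have "\<dots> \<le> (\<Sum>n\<in>{M..<2 * M}. c' n)"
  proof (rule sum_mono)
    fix n assume n: "n \<in> {M..<2 * M}"
    have "\<theta> * q * real M \<le> \<theta> * (real n * q)"
      using n \<theta>(1) q by (simp add: mult.assoc mult.commute[of q])
    also have "\<dots> \<le> \<theta> * w' n"
      using 6[of n] n M \<theta>(1) by (intro mult_left_mono) auto
    finally show "\<theta> * q * real M - K \<le> c' n"
      using 2[of n] by linarith
  qed
  also have "\<dots> \<le> (\<Sum>n<2 * M. c' n)"
    by (rule sum_mono2) (auto simp: c')
  also have "\<dots> \<le> real (2 * M) * (\<beta> + \<eta>)"
    using M by (intro sum_le) auto
  finally show False
    by (simp add: algebra_simps)
qed

text \<open>Otherwise the minimizing selector has an average cost below \<open>\<beta>\<close>.\<close>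

lemma m\<nu>_ge: "\<beta> + \<alpha> \<le> m\<nu>"
proof (rule ccontr)
  assume "\<not> ?thesis"
  then have m\<nu>_less: "m\<nu> < \<beta> + \<alpha>"
    by simp
  \<comment> \<open>The cap \<open>1 / 2\<close> keeps \<open>1 - g\<close> positive, so that the
    telescoped inequality can be solved for the sum of the costs.\<close>
  define g where "g = min ((\<beta> + \<alpha> - m\<nu>) / \<alpha>) (1 / 2)"
  have g: "0 < g" "g < 1" "g * \<alpha> \<le> \<beta> + \<alpha> - m\<nu>"
    using m\<nu>_less \<alpha>(1) by (auto simp: g_def min_def field_simps)
  obtain u where u: "u \<in> borel \<rightarrow>\<^sub>M borel" "\<And>x. u x \<in> acts D x"
    "\<And>x. W x = cost' (x, u x) + (\<integral>\<^sup>+y. W y \<partial>killed (x, u x))"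
    by (rule W_selector) (rule that)
  fix x0 :: 'x
  let ?\<mu> = "return borel x0" and ?\<xi> = "stationary_strategy (dirac u)"
  let ?L = "policy_law D ?\<mu> ?\<xi>"
  have \<mu>: "?\<mu> \<in> space (prob_algebra borel)"
    by (simp add: space_prob_algebra prob_space_return)
  note \<xi> = stationary_strategy[OF dirac_stationary[OF u(1,2)]]
  define c where "c n = (\<integral>\<^sup>+\<omega>. cost D (\<omega> n) \<partial>?L)" for n
  define w where "w n = (\<integral>\<^sup>+\<omega>. W (fst (\<omega> n)) \<partial>?L)" for n
  define e where "e n = (\<integral>\<^sup>+\<omega>. ennreal (atom (fst (\<omega> n))) \<partial>?L)" for n
  interpret prob_space ?L
    by (rule policy_law_prob[OF \<mu> \<xi>])
  note meas = policy_law_coord_meas[OF \<mu> \<xi>]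
  note [measurable] = meas[OF cost_meas] meas[OF W_fst_meas] meas[OF atom_fst_meas]
    meas[OF nn_integral_trans_meas[OF W_meas]]
  have e_fin: "e n \<le> 1" for n
    unfolding e_def by (rule mean_atom_le_1[OF \<mu> \<xi>])
  have 1: "w n + (ennreal \<beta> + e n * ennreal m\<nu>) = ennreal (\<beta> + \<alpha>) * e n + (c n + w (Suc n))" for n
  proof -
    let ?l = "\<lambda>k. cost D k + (\<integral>\<^sup>+y. W y \<partial>trans D k)"
    have l: "?l \<in> borel_measurable (grM D)"
      using cost_meas nn_integral_trans_meas[OF W_meas] by measurable
    have "c n + w (Suc n) = (\<integral>\<^sup>+\<omega>. ?l (\<omega> n) \<partial>?L)"
      using nn_integral_policy_law_state(2)[OF \<mu> \<xi> W_meas, of n]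
      by (simp add: nn_integral_add w_def c_def)
    also have "\<dots> = (\<integral>\<^sup>+\<omega>. ?l (fst (\<omega> n), u (fst (\<omega> n))) \<partial>?L)"
      by (rule nn_integral_policy_law_dirac[OF \<mu> u(1,2) l])
    finally have *: "c n + w (Suc n) = (\<integral>\<^sup>+\<omega>. ?l (fst (\<omega> n), u (fst (\<omega> n))) \<partial>?L)" .
    have "(\<lambda>k. ?l (fst k, u (fst k))) \<in> borel_measurable (grM D)"
    proof -
      have "(\<lambda>x. \<integral>\<^sup>+k. ?l k \<partial>state_action D (dirac u x) x) \<in> borel_measurable borel"
        by (rule nn_integral_stationary_meas[OF dirac_stationary[OF u(1,2)] l])
      then have "(\<lambda>x. ?l (x, u x)) \<in> borel_measurable borel"
        using nn_integral_state_action_dirac[of u, OF u(2) l] by simp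
      then show ?thesis
        by (rule measurable_compose[OF fst_grM])
    qed
    from meas[OF this, of n] have [measurable]: "(\<lambda>\<omega>. ?l (fst (\<omega> n), u (fst (\<omega> n)))) \<in> borel_measurable ?L" .
    have "(\<integral>\<^sup>+\<omega>. W (fst (\<omega> n)) + (ennreal \<beta> + ennreal (atom (fst (\<omega> n))) * ennreal m\<nu>) \<partial>?L) =
        (\<integral>\<^sup>+\<omega>. ennreal (\<beta> + \<alpha>) * ennreal (atom (fst (\<omega> n))) + ?l (fst (\<omega> n), u (fst (\<omega> n))) \<partial>?L)"
      using W_bellman_eq[of u, OF u(2,3)] m\<nu>(1) by simp
    also have "\<dots> = ennreal (\<beta> + \<alpha>) * e n + (c n + w (Suc n))"
      unfolding * by (subst nn_integral_add) (auto simp: nn_integral_cmult e_def)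
    finally show ?thesis
      by (simp add: nn_integral_add nn_integral_multc w_def e_def emeasure_space_1)
  qed
  have 3: "ennreal (\<beta> + \<epsilon>) \<le> c n + ennreal \<alpha> * e n" for n
    unfolding c_def e_def by (rule mean_cost_atom_ge[OF \<mu> \<xi>])
  have em: "e n * ennreal m\<nu> < \<infinity>" for n
    using e_fin[of n] by (auto simp: ennreal_mult_less_top intro: order_le_less_trans)
  \<comment> \<open>The equality carries finiteness from \<open>W x0\<close> forward in time; the
    telescoping in \<open>5\<close> depends on it.\<close>
  have w_fin: "w n < \<infinity>" for n
  proof (induction n)
    case 0
    have "w 0 = W x0"
      unfolding w_def nn_integral_policy_law_state(1)[OF \<mu> \<xi> W_meas] by (simp add: nn_integral_return)
    then show ?case
      using W_finite[of x0] by simp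
  next
    case (Suc n)
    then have "w n + (ennreal \<beta> + e n * ennreal m\<nu>) < \<infinity>"
      using em[of n] by simp
    then show ?case
      unfolding 1 by simp
  qed
  have c_fin: "c n < \<infinity>" for n
  proof -
    have "w n + (ennreal \<beta> + e n * ennreal m\<nu>) < \<infinity>"
      using w_fin[of n] em[of n] by simp
    then show ?thesis
      unfolding 1 by simp
  qed
  define c' where "c' n = enn2real (c n)" for n
  define w' where "w' n = enn2real (w n)" for n
  define e' where "e' n = enn2real (e n)" for n
  have c': "c n = ennreal (c' n)" "0 \<le> c' n" for n
    using c_fin[of n] by (simp_all add: c'_def)
  have w': "w n = ennreal (w' n)" "0 \<le> w' n" for n
    using w_fin[of n] by (simp_all add: w'_def)
  have e': "e n = ennreal (e' n)" "0 \<le> e' n" for n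
    using e_fin[of n] by (simp_all add: e'_def order_le_less_trans)
  note simps = ennreal_mult[symmetric] ennreal_plus[symmetric]
  have 1: "w' n + \<beta> + e' n * m\<nu> = (\<beta> + \<alpha>) * e' n + c' n + w' (Suc n)" for n
    using 1[of n] c'[of n] w'[of n] w'[of "Suc n"] e'[of n] m\<nu>(2) \<alpha>(1) \<beta>_nonneg
    by (simp add: simps ennreal_inj add_nonneg_nonneg del: ennreal_plus)
  have 3: "\<beta> + \<epsilon> \<le> c' n + \<alpha> * e' n" for n
    using 3[of n] c'[of n] e'[of n] \<alpha>(1) \<beta>_nonneg \<epsilon>(1)
    by (simp add: simps ennreal_le_iff2 add_nonneg_nonneg del: ennreal_plus)
  have 4: "c' n + w' (Suc n) + g * (\<beta> + \<epsilon> - c' n) \<le> w' n + \<beta>" for n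
  proof -
    have "g * (\<beta> + \<epsilon> - c' n) \<le> g * (\<alpha> * e' n)"
      using 3[of n] g by (intro mult_left_mono) auto
    also have "\<dots> = (g * \<alpha>) * e' n"
      by simp
    also have "\<dots> \<le> (\<beta> + \<alpha> - m\<nu>) * e' n"
      using g(3) e'(2) by (rule mult_right_mono)
    finally show ?thesis
      using 1[of n] by (simp add: algebra_simps)
  qed
  have 5: "(1 - g) * (\<Sum>n<N. c' n) + w' N \<le> w' 0 + real N * (\<beta> - g * (\<beta> + \<epsilon>))" for N
  proof (induction N)
    case (Suc N)
    then show ?case
      using 4[of N] by (simp add: algebra_simps)
  qed simp
  \<comment> \<open>Here \<open>(1 - g) * r = g * \<epsilon> / 2\<close>: half of the saving lowers
    the average cost by \<open>r\<close>, the other half absorbs the initial term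
    \<open>w' 0\<close> from time \<open>N1\<close> on.\<close>
  define r where "r = g * \<epsilon> / (2 * (1 - g))"
  have r: "0 < r"
    using g \<epsilon>(1) by (simp add: r_def)
  obtain N1 :: nat where N1: "w' 0 / ((1 - g) * r) < real N1"
    using reals_Archimedean2 by blast
  have 6: "(\<Sum>n<N. c' n) \<le> real N * (\<beta> - r)" if N: "N1 \<le> N" for N
  proof -
    have gr_eq: "(1 - g) * r = g * \<epsilon> / 2"
      using g by (simp add: r_def field_simps)
    moreover have "w' 0 < (1 - g) * r * real N1"
      using N1 g r by (simp add: field_simps)
    moreover have "(1 - g) * r * real N1 \<le> (1 - g) * r * real N"
      using N g r by (intro mult_left_mono) auto
    moreover have "(1 - g) * r * real N = real N * (g * \<epsilon> / 2)"
      using gr_eq by simp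
    ultimately have "w' 0 \<le> real N * (g * \<epsilon> / 2)"
      by linarith
    then have "(1 - g) * (\<Sum>n<N. c' n) \<le> real N * (\<beta> - g * \<beta> - g * \<epsilon> / 2)"
      using 5[of N] w'(2)[of N] by (simp add: algebra_simps)
    also have "\<dots> = (1 - g) * (real N * (\<beta> - r))"
    proof -
      have "(1 - g) * (real N * (\<beta> - r)) = real N * ((1 - g) * \<beta> - (1 - g) * r)"
        by (simp add: algebra_simps)
      then show ?thesis
        unfolding gr_eq by (simp add: algebra_simps)
    qed
    finally show ?thesis
      using g by simp
  qed
  have "ennreal \<beta> \<le> average_cost D ?\<mu> ?\<xi>"
    by (rule beta_le_average_cost[OF \<mu> \<xi>])
  also have "average_cost D ?\<mu> ?\<xi> \<le> ennreal (\<beta> - r)"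
    unfolding average_cost_def nn_integral_policy_law_cost_sum[OF \<mu> \<xi>] c_def[symmetric]
  proof (rule Limsup_bounded, unfold eventually_sequentially, intro exI allI impI)
    fix N assume N: "Suc N1 \<le> N"
    have "(\<Sum>n<N. c n) / of_nat N = ennreal ((\<Sum>n<N. c' n) / real N)"
      using N c' by (simp add: sum_ennreal sum_nonneg divide_ennreal ennreal_of_nat_eq_real_of_nat)
    also have "\<dots> \<le> ennreal (\<beta> - r)"
      using 6[of N] N by (intro ennreal_leI) (simp add: field_simps)
    finally show "(\<Sum>n<N. c n) / of_nat N \<le> ennreal (\<beta> - r)" .
  qed
  finally have "ennreal \<beta> \<le> ennreal (\<beta> - r)" .
  \<comment> \<open>Conversion to \<open>ennreal\<close> sends negative numbers to 0, so the
    comparison just obtained is conclusive only once \<open>\<beta> - r\<close> is known to be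
    nonnegative.\<close>
  moreover have "0 \<le> real (Suc N1) * (\<beta> - r)"
    using 6[of "Suc N1"] c'(2) by (meson order_trans le_SucI order_refl sum_nonneg)
  then have "0 \<le> \<beta> - r"
    by (simp add: zero_le_mult_iff)
  ultimately show False
    using r by (simp add: ennreal_le_iff)
qed

text \<open>For this value the coefficients of \<open>atom\<close> on the two sides of the Bellman
  relation coincide and cancel; what remains is the average-cost optimality equation.\<close>

lemma nn_integral_W_\<nu>_eq: "(\<integral>\<^sup>+y. W y \<partial>\<nu>) = ennreal (\<beta> + \<alpha>)"
  using m\<nu>_le m\<nu>_ge m\<nu>(1) by simp

end

section \<open>Value iteration\<close>

lemma ereal_integral_bdd_below:
  assumes M: "prob_space M" and f: "f \<in> borel_measurable M" "\<And>x. - b \<le> f x"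
  shows "integrable M f \<Longrightarrow> ereal_integral M (\<lambda>x. ereal (f x)) = ereal (\<integral>x. f x \<partial>M)"
    and "\<not> integrable M f \<Longrightarrow> ereal_integral M (\<lambda>x. ereal (f x)) = \<infinity>"
proof -
  interpret prob_space M
    by (rule M)
  have "(\<integral>\<^sup>+x. ennreal (- f x) \<partial>M) \<le> (\<integral>\<^sup>+x. ennreal b \<partial>M)"
    using f(2) by (intro nn_integral_mono ennreal_leI) (simp add: minus_le_iff)
  then have neg: "(\<integral>\<^sup>+x. ennreal (- f x) \<partial>M) < \<infinity>"
    by (simp add: emeasure_space_1 order_le_less_trans)
  have eq: "ereal_integral M (\<lambda>x. ereal (f x)) =
      enn2ereal (\<integral>\<^sup>+x. ennreal (f x) \<partial>M) - enn2ereal (\<integral>\<^sup>+x. ennreal (- f x) \<partial>M)"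
    by (simp add: ereal_integral_def)
  {
    assume "integrable M f"
    then have pos: "(\<integral>\<^sup>+x. ennreal (f x) \<partial>M) < \<infinity>"
      by (simp add: real_integrable_def less_top[symmetric])
    show "ereal_integral M (\<lambda>x. ereal (f x)) = ereal (\<integral>x. f x \<partial>M)"
      using pos neg unfolding eq real_lebesgue_integral_def[OF \<open>integrable M f\<close>]
      by (cases "\<integral>\<^sup>+x. ennreal (f x) \<partial>M"; cases "\<integral>\<^sup>+x. ennreal (- f x) \<partial>M") auto
  next
    assume "\<not> integrable M f"
    then have "(\<integral>\<^sup>+x. ennreal (f x) \<partial>M) = \<infinity>"
      using f(1) neg by (auto simp: real_integrable_def)
    then show "ereal_integral M (\<lambda>x. ereal (f x)) = \<infinity>"
      using neg unfolding eq by (cases "\<integral>\<^sup>+x. ennreal (- f x) \<partial>M") auto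
  }
qed

section \<open>The optimality equation for real-valued functions\<close>

context mdp_setting
begin

definition Wr :: "'x \<Rightarrow> real" where "Wr x = enn2real (W x)"

lemma W_Wr: "W x = ennreal (Wr x)" and Wr_nonneg [simp]: "0 \<le> Wr x"
  using W_finite[of x] by (simp_all add: Wr_def)

lemma Wr_meas [measurable]: "Wr \<in> borel_measurable borel"
  unfolding Wr_def[abs_def] by measurable

lemma trans_measI: "f \<in> borel_measurable borel \<Longrightarrow> k \<in> gr D \<Longrightarrow> f \<in> borel_measurable (trans D k)"
  by (simp add: measurable_cong_sets[OF trans_sets refl])

lemma \<nu>_measI: "f \<in> borel_measurable borel \<Longrightarrow> f \<in> borel_measurable \<nu>"
  by (simp add: measurable_cong_sets[OF \<nu>_sets refl])

lemma Wr_\<nu>: "integrable \<nu> Wr" "(\<integral>y. Wr y \<partial>\<nu>) = \<beta> + \<alpha>"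
proof -
  have "(\<integral>\<^sup>+y. ennreal (Wr y) \<partial>\<nu>) = ennreal (\<beta> + \<alpha>)"
    using nn_integral_W_\<nu>_eq by (simp add: W_Wr)
  then have "has_bochner_integral \<nu> Wr (\<beta> + \<alpha>)"
    using \<beta>_nonneg \<alpha>(1) by (intro has_bochner_integral_nn_integral \<nu>_measI) auto
  then show "integrable \<nu> Wr" "(\<integral>y. Wr y \<partial>\<nu>) = \<beta> + \<alpha>"
    by (auto simp: has_bochner_integral_iff)
qed

lemma atom_integral_le:
  assumes k: "k \<in> gr D" and f: "f \<in> borel_measurable borel" "\<And>y. 0 \<le> f y"
    and int: "integrable (trans D k) f" "integrable \<nu> f"
  shows "atom (fst k) * (\<integral>y. f y \<partial>\<nu>) \<le> (\<integral>y. f y \<partial>trans D k)"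
proof -
  have "ennreal (atom (fst k)) * (\<integral>\<^sup>+y. ennreal (f y) \<partial>\<nu>) \<le> (\<integral>\<^sup>+y. ennreal (f y) \<partial>trans D k)"
    using f(1) by (subst nn_integral_trans[OF k]) auto
  then have "ennreal (atom (fst k) * (\<integral>y. f y \<partial>\<nu>)) \<le> ennreal (\<integral>y. f y \<partial>trans D k)"
    using int f(2) atom(1) by (simp add: nn_integral_eq_integral ennreal_mult)
  then show ?thesis
    using f(2) by (subst (asm) ennreal_le_iff) (auto intro!: integral_nonneg_AE)
qed

lemma W_optimality_le:
  assumes k: "k \<in> gr D"
  shows "W (fst k) + ennreal \<beta> \<le> cost D k + (\<integral>\<^sup>+y. W y \<partial>trans D k)"
proof -
  have "ennreal (\<beta> + \<alpha>) * ennreal (atom (fst k)) + (W (fst k) + ennreal \<beta>) \<le>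
      ennreal (\<beta> + \<alpha>) * ennreal (atom (fst k)) + (cost D k + (\<integral>\<^sup>+y. W y \<partial>trans D k))"
    using W_bellman_le[OF k] by (simp add: nn_integral_W_\<nu>_eq ac_simps del: ennreal_plus)
  then show ?thesis
    by (subst (asm) ennreal_add_left_cancel_le) (simp add: ennreal_mult_eq_top_iff del: ennreal_plus)
qed

lemma W_optimality_eq:
  assumes w: "\<And>x. w x \<in> acts D x" "\<And>x. W x = cost' (x, w x) + (\<integral>\<^sup>+y. W y \<partial>killed (x, w x))"
  shows "W x + ennreal \<beta> = cost D (x, w x) + (\<integral>\<^sup>+y. W y \<partial>trans D (x, w x))"
proof -
  have "ennreal (\<beta> + \<alpha>) * ennreal (atom x) + (W x + ennreal \<beta>) =
      ennreal (\<beta> + \<alpha>) * ennreal (atom x) + (cost D (x, w x) + (\<integral>\<^sup>+y. W y \<partial>trans D (x, w x)))"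
    using W_bellman_eq[OF w, of x] by (simp add: nn_integral_W_\<nu>_eq ac_simps del: ennreal_plus)
  then show ?thesis
    by (subst (asm) ennreal_add_left_cancel) (simp add: ennreal_mult_eq_top_iff del: ennreal_plus)
qed

definition cr :: "'x \<times> 'u \<Rightarrow> real" where "cr k = enn2real (cost D k)"

lemma cr_nonneg [simp]: "0 \<le> cr k"
  by (simp add: cr_def)

lemma Wr_integral_ge:
  assumes k: "k \<in> gr D" and c: "cost D k < \<infinity>" and int: "integrable (trans D k) Wr"
  shows "Wr (fst k) + \<beta> \<le> cr k + (\<integral>y. Wr y \<partial>trans D k)"
proof -
  have "(\<integral>\<^sup>+y. W y \<partial>trans D k) = ennreal (\<integral>y. Wr y \<partial>trans D k)"
    unfolding W_Wr by (rule nn_integral_eq_integral[OF int]) simp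
  moreover have "cost D k = ennreal (cr k)"
    using c by (simp add: cr_def)
  moreover have I: "0 \<le> (\<integral>y. Wr y \<partial>trans D k)"
    by (rule integral_nonneg_AE) simp
  ultimately have "ennreal (Wr (fst k) + \<beta>) \<le> ennreal (cr k + (\<integral>y. Wr y \<partial>trans D k))"
    using W_optimality_le[OF k] \<beta>_nonneg by (simp add: W_Wr del: ennreal_le_iff)
  then show ?thesis
    using I by (subst (asm) ennreal_le_iff) auto
qed

text \<open>By induction \<open>e + C * \<gamma> ^ j * L j - g j\<close> is nonnegative, so its mean
  under the transition law dominates \<open>atom\<close> times its \<nu>-mean. The regenerated part
  of \<open>g\<close> is held below \<open>e\<close> by the bound on its \<nu>-mean, the surviving
  part contracts with \<open>L\<close>. Selector and Lyapunov function may vary with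
  \<open>j\<close>, which the value iteration selectors require.\<close>

lemma killed_contraction:
  fixes g L :: "nat \<Rightarrow> 'x \<Rightarrow> real"
  assumes w: "\<And>j x. w j x \<in> acts D x"
    and g: "\<And>j. g j \<in> borel_measurable borel" "\<And>j. integrable \<nu> (g j)"
      "\<And>j x. integrable (trans D (x, w j x)) (g j)" "\<And>j. (\<integral>y. g j y \<partial>\<nu>) \<le> e"
      "\<And>j x. g (Suc j) x \<le> (\<integral>y. g j y \<partial>trans D (x, w j x))"
    and L: "\<And>j. L j \<in> borel_measurable borel" "\<And>j. integrable \<nu> (L j)"
      "\<And>j x. integrable (trans D (x, w j x)) (L j)"
      "\<And>j x. (\<integral>y. L j y \<partial>trans D (x, w j x)) - atom x * (\<integral>y. L j y \<partial>\<nu>) \<le> \<gamma> * L (Suc j) x"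
    and C: "0 \<le> C" "0 \<le> \<gamma>" and g0: "\<And>x. g 0 x \<le> e + C * L 0 x"
  shows "g j x \<le> e + C * \<gamma> ^ j * L j x"
proof (induction j arbitrary: x)
  case 0
  then show ?case
    using g0 by simp
next
  case (Suc j)
  let ?k = "(x, w j x)"
  have k: "?k \<in> gr D"
    using w by (simp add: gr_iff)
  interpret T: prob_space "trans D ?k"
    by (rule trans_prob[OF k])
  interpret N: prob_space \<nu>
    by (rule \<nu>_prob)
  let ?f = "\<lambda>y. e + C * \<gamma> ^ j * L j y - g j y"
  have "atom (fst ?k) * (\<integral>y. ?f y \<partial>\<nu>) \<le> (\<integral>y. ?f y \<partial>trans D ?k)"
    using Suc.IH g L by (intro atom_integral_le[OF k]) auto
  also have "(\<integral>y. ?f y \<partial>\<nu>) = e + C * \<gamma> ^ j * (\<integral>y. L j y \<partial>\<nu>) - (\<integral>y. g j y \<partial>\<nu>)"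
    using g L by (simp add: N.prob_space)
  also have "(\<integral>y. ?f y \<partial>trans D ?k) = e + C * \<gamma> ^ j * (\<integral>y. L j y \<partial>trans D ?k) - (\<integral>y. g j y \<partial>trans D ?k)"
    using g L by (simp add: T.prob_space)
  finally have "(\<integral>y. g j y \<partial>trans D ?k) \<le> e - atom x * e + atom x * (\<integral>y. g j y \<partial>\<nu>) +
      C * \<gamma> ^ j * ((\<integral>y. L j y \<partial>trans D ?k) - atom x * (\<integral>y. L j y \<partial>\<nu>))"
    by (simp add: algebra_simps)
  also have "atom x * (\<integral>y. g j y \<partial>\<nu>) \<le> atom x * e"
    by (rule mult_left_mono[OF g(4) atom(1)])
  also have "C * \<gamma> ^ j * ((\<integral>y. L j y \<partial>trans D ?k) - atom x * (\<integral>y. L j y \<partial>\<nu>)) \<le> C * \<gamma> ^ j * (\<gamma> * L (Suc j) x)"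
    using C by (intro mult_left_mono L) auto
  finally have "(\<integral>y. g j y \<partial>trans D ?k) \<le> e + C * \<gamma> ^ Suc j * L (Suc j) x"
    by (simp add: ac_simps)
  with g(5)[of j x] show ?case
    by linarith
qed

text \<open>The weight is \<open>1 + \<bar>W - \<alpha>\<bar>\<close>, hence at most
  \<open>1 + W + \<alpha>\<close>. A single \<open>C\<close> serves as slope and as
  constant.\<close>

lemma weighted_class_bounds:
  assumes \<Phi>0: "\<Phi>0 \<in> lsc_bdd_below \<inter> weighted_class (V_star D B \<nu> \<delta>)"
  shows "\<exists>b C. 0 \<le> b \<and> 0 \<le> C \<and> (\<forall>x. - b \<le> \<Phi>0 x \<and> \<Phi>0 x \<le> C * Wr x + C)"
proof -
  obtain b where b: "\<And>x. b \<le> \<Phi>0 x"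
    using \<Phi>0 by (auto simp: lsc_bdd_below_def bdd_below_def)
  have "weighted_norm (V_star D B \<nu> \<delta>) \<Phi>0 < \<infinity>"
    using \<Phi>0 by (simp add: weighted_class_def)
  then obtain r where r: "weighted_norm (V_star D B \<nu> \<delta>) \<Phi>0 < ereal r"
    by (metis ereal_dense2 less_ereal.simps(2) linorder_neq_iff not_less_iff_gr_or_eq real_of_ereal.cases less_PInf_Ex_of_nat)
  have bound: "\<bar>\<Phi>0 x\<bar> \<le> max 0 r * (1 + (Wr x + \<alpha>))" for x
  proof -
    have "ereal (\<bar>\<Phi>0 x\<bar> / (1 + \<bar>V_star D B \<nu> \<delta> x\<bar>)) \<le> weighted_norm (V_star D B \<nu> \<delta>) \<Phi>0"
      unfolding weighted_norm_def by (rule SUP_upper) simp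
    then have "ereal (\<bar>\<Phi>0 x\<bar> / (1 + \<bar>V_star D B \<nu> \<delta> x\<bar>)) < ereal r"
      using r by (rule order_le_less_trans)
    then have "\<bar>\<Phi>0 x\<bar> / (1 + \<bar>V_star D B \<nu> \<delta> x\<bar>) \<le> max 0 r"
      by simp
    then have "\<bar>\<Phi>0 x\<bar> \<le> max 0 r * (1 + \<bar>V_star D B \<nu> \<delta> x\<bar>)"
      by (subst (asm) pos_divide_le_eq) auto
    also have "\<dots> \<le> max 0 r * (1 + (Wr x + \<alpha>))"
      using \<alpha>(1) Wr_nonneg[of x]
      by (intro mult_left_mono) (auto simp: V_star_W Wr_def[symmetric] abs_le_iff)
    finally show ?thesis .
  qed
  define C where "C = max 0 r * (1 + \<alpha>)"
  have "\<Phi>0 x \<le> C * Wr x + C" for x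
  proof -
    have "max 0 r * (1 + (Wr x + \<alpha>)) \<le> C * Wr x + C"
      using \<alpha>(1) Wr_nonneg[of x] by (auto simp: C_def algebra_simps max_def)
    with bound[of x] show ?thesis
      by linarith
  qed
  moreover have "- \<bar>b\<bar> \<le> \<Phi>0 x" for x
    using b[of x] by linarith
  moreover have "0 \<le> C"
    using \<alpha>(1) by (simp add: C_def)
  ultimately show ?thesis
    by (intro exI[of _ "\<bar>b\<bar>"] exI[of _ C]) auto
qed

end

section \<open>Growth bounds for the value iterates\<close>

locale value_iteration = mdp_setting +
  fixes \<Phi>0 :: "'a \<Rightarrow> real" and v :: "nat \<Rightarrow> 'a \<Rightarrow> 'b" and u :: "'a \<Rightarrow> 'b" and \<theta> K b C :: real
  assumes \<Phi>0: "\<Phi>0 \<in> borel_measurable borel" "0 \<le> b" "0 \<le> C" "\<And>x. - b \<le> \<Phi>0 x" "\<And>x. \<Phi>0 x \<le> C * Wr x + C"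
    and v: "\<And>n. minimizing_selector D (value_iter D \<Phi>0 n) (v n)"
    and u: "u \<in> borel \<rightarrow>\<^sub>M borel" "\<And>x. u x \<in> acts D x"
      "\<And>x. W x = cost' (x, u x) + (\<integral>\<^sup>+y. W y \<partial>killed (x, u x))"
    and \<theta>: "0 < \<theta>" "\<theta> < 1" "0 \<le> K" "\<And>k. k \<in> gr D \<Longrightarrow> ennreal \<theta> * W (fst k) \<le> cost D k + ennreal K"
begin

abbreviation "\<rho> \<equiv> 1 - \<theta>"

lemma v_acts: "v n x \<in> acts D x" and v_meas: "v n \<in> borel \<rightarrow>\<^sub>M borel"
  and v_min: "w \<in> acts D x \<Longrightarrow> bellman D (value_iter D \<Phi>0 n) x (v n x) \<le> bellman D (value_iter D \<Phi>0 n) x w"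
  using v[of n] by (auto simp: minimizing_selector_def is_arg_min_def not_less)

lemma value_iter_Suc_v: "value_iter D \<Phi>0 (Suc n) x = bellman D (value_iter D \<Phi>0 n) x (v n x)"
  using v_min v_acts by (auto intro!: antisym INF_lower INF_greatest)

lemma gr_u: "(x, u x) \<in> gr D" and gr_v: "(x, v n x) \<in> gr D"
  by (simp_all add: gr_iff u v_acts)

lemma graph_meas:
  assumes "w \<in> borel \<rightarrow>\<^sub>M borel" "\<And>x. (x, w x) \<in> gr D"
  shows "(\<lambda>x. (x, w x)) \<in> borel \<rightarrow>\<^sub>M grM D"
proof -
  have "(\<lambda>x. (x, w x)) \<in> borel \<rightarrow>\<^sub>M borel \<Otimes>\<^sub>M borel"
    using assms(1) by measurable
  then have "(\<lambda>x. (x, w x)) \<in> borel \<rightarrow>\<^sub>M borel"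
    by (simp add: borel_prod)
  then have "(\<lambda>x. (x, w x)) \<in> borel \<rightarrow>\<^sub>M restrict_space borel (gr D)"
    using assms(2) by (intro measurable_restrict_space2) auto
  then show ?thesis
    by (simp add: grM_def)
qed

lemma cr_ge: "k \<in> gr D \<Longrightarrow> cost D k < \<infinity> \<Longrightarrow> \<theta> * Wr (fst k) - K \<le> cr k"
proof -
  assume k: "k \<in> gr D" "cost D k < \<infinity>"
  then have "ennreal (\<theta> * Wr (fst k)) \<le> ennreal (cr k + K)"
    using \<theta>(4)[OF k(1)] \<theta> by (simp add: W_Wr cr_def ennreal_mult del: ennreal_le_iff)
  then show ?thesis
    using \<theta>(3) by (subst (asm) ennreal_le_iff) auto
qed

lemma cost_u: "cost D (x, u x) < \<infinity>" and Wr_u: "integrable (trans D (x, u x)) Wr"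
  and Wr_u_eq: "Wr x + \<beta> = cr (x, u x) + (\<integral>y. Wr y \<partial>trans D (x, u x))"
proof -
  have eq: "W x + ennreal \<beta> = cost D (x, u x) + (\<integral>\<^sup>+y. W y \<partial>trans D (x, u x))"
    by (rule W_optimality_eq[OF u(2,3)])
  have "W x + ennreal \<beta> < \<infinity>"
    using W_finite[of x] by simp
  then show c: "cost D (x, u x) < \<infinity>" and "integrable (trans D (x, u x)) Wr"
    using Wr_meas gr_u[of x] unfolding eq
    by (auto intro!: integrableI_nonneg trans_measI simp: W_Wr[symmetric])
  then have "(\<integral>\<^sup>+y. W y \<partial>trans D (x, u x)) = ennreal (\<integral>y. Wr y \<partial>trans D (x, u x))"
    unfolding W_Wr by (intro nn_integral_eq_integral) simp_all
  moreover have I: "0 \<le> (\<integral>y. Wr y \<partial>trans D (x, u x))"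
    by (rule integral_nonneg_AE) simp
  ultimately have "ennreal (Wr x + \<beta>) = ennreal (cr (x, u x) + (\<integral>y. Wr y \<partial>trans D (x, u x)))"
    using eq c \<beta>_nonneg by (simp add: W_Wr cr_def del: ennreal_inj)
  then show "Wr x + \<beta> = cr (x, u x) + (\<integral>y. Wr y \<partial>trans D (x, u x))"
    using I \<beta>_nonneg by (subst (asm) ennreal_inj) auto
qed

definition \<Phi> :: "nat \<Rightarrow> 'a \<Rightarrow> real" where "\<Phi> n x = real_of_ereal (value_iter D \<Phi>0 n x)"

text \<open>A lower bound on the iterate rules out \<open>\<infinity> - \<infinity>\<close>, so an
  infinite cost or a failure of integrability shows as the value \<open>\<infinity>\<close>. A
  finite value at the competitor \<open>u x\<close> then forces finite cost and integrability at the
  minimizer.\<close>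

lemma bellman_\<Phi>:
  assumes eq: "\<And>x. value_iter D \<Phi>0 n x = ereal (\<Phi> n x)" and meas: "\<Phi> n \<in> borel_measurable borel"
    and bd: "\<And>x. - c \<le> \<Phi> n x" and w: "(x, w) \<in> gr D"
  shows "bellman D (value_iter D \<Phi>0 n) x w = (if cost D (x, w) < \<infinity> \<and> integrable (trans D (x, w)) (\<Phi> n)
    then ereal (cr (x, w) - \<beta> + (\<integral>y. \<Phi> n y \<partial>trans D (x, w))) else \<infinity>)"
proof -
  have "value_iter D \<Phi>0 n = (\<lambda>x. ereal (\<Phi> n x))"
    using eq by blast
  note * = ereal_integral_bdd_below[OF trans_prob[OF w] trans_measI[OF meas w] bd]
  show ?thesis
    unfolding bellman_def \<open>value_iter D \<Phi>0 n = (\<lambda>x. ereal (\<Phi> n x))\<close> beta_eq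
    using * \<beta>_nonneg
    by (cases "cost D (x, w)"; cases "integrable (trans D (x, w)) (\<Phi> n)") (auto simp: cr_def)
qed

text \<open>The additive constants gathered by the iteration: step \<open>n\<close> contributes
  \<open>\<rho> ^ n * (K + \<beta>)\<close>, as the induction for the bounds on the iterates
  shows.\<close>

definition \<tau> :: "nat \<Rightarrow> real" where "\<tau> n = (K + \<beta>) * (\<Sum>i<n. \<rho> ^ i)"

lemma \<tau>_Suc: "\<tau> (Suc n) = \<tau> n + \<rho> ^ n * (K + \<beta>)"
  by (simp add: \<tau>_def algebra_simps)

lemma \<tau>_bounds: "0 \<le> \<tau> n" "\<tau> n \<le> (K + \<beta>) / \<theta>"
proof -
  show "0 \<le> \<tau> n"
    unfolding \<tau>_def using \<theta> \<beta>_nonneg by (intro mult_nonneg_nonneg sum_nonneg) auto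
  have "(\<Sum>i<n. \<rho> ^ i) \<le> (\<Sum>i. \<rho> ^ i)"
    using \<theta> by (intro sum_le_suminf summable_geometric) auto
  also have "\<dots> = 1 / \<theta>"
    using \<theta> by (subst suminf_geometric) auto
  finally have "\<tau> n \<le> (K + \<beta>) * (1 / \<theta>)"
    unfolding \<tau>_def using \<theta> \<beta>_nonneg by (intro mult_left_mono) auto
  then show "\<tau> n \<le> (K + \<beta>) / \<theta>"
    by simp
qed

lemma \<rho>_power: "0 \<le> \<rho> ^ n" "\<rho> ^ n \<le> 1"
  using \<theta> by (auto intro: power_le_one)

lemma integrable_linear_growth:
  assumes "prob_space M" "f \<in> borel_measurable M" "integrable M Wr" "\<And>x. \<bar>f x\<bar> \<le> p * Wr x + q"
  shows "integrable M f"
proof -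
  interpret prob_space M
    by (rule assms)
  show ?thesis
  proof (rule Bochner_Integration.integrable_bound)
    show "integrable M (\<lambda>x. p * Wr x + q)"
      using assms(3) by simp
    show "AE x in M. norm (f x) \<le> norm (p * Wr x + q)"
      using assms(4) by (intro AE_I2) (simp add: order_trans[OF _ abs_ge_self])
  qed (use assms in simp)
qed

text \<open>Both bounds rest on \<open>c \<ge> \<theta> * W - K\<close>. From above, the minimum is
  tested with \<open>u\<close>, for which the mean of \<open>W\<close> after one step is at most
  \<open>\<rho> * W + K + \<beta>\<close>. From below, every relevant action has mean at least
  \<open>W + \<beta> - c\<close>; using it with weight \<open>1 - \<rho> ^ n\<close> leaves
  \<open>\<rho> ^ n * c\<close>, and (H2) turns that into the missing multiple of \<open>W\<close>.
  Finiteness and measurability are carried along because each step integrates the previous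
  iterate.\<close>

lemma value_iter_invariant:
  "(\<forall>x. value_iter D \<Phi>0 n x = ereal (\<Phi> n x)) \<and> \<Phi> n \<in> borel_measurable borel \<and>
    (\<forall>x. \<Phi> n x \<le> Wr x + C * \<rho> ^ n * Wr x + (C + C * \<tau> n)) \<and>
    (\<forall>x. (1 - \<rho> ^ n) * Wr x - (b + \<tau> n) \<le> \<Phi> n x)"
proof (induction n)
  case 0
  have "\<Phi> 0 = \<Phi>0"
    by (simp add: \<Phi>_def fun_eq_iff)
  moreover have "\<Phi>0 x \<le> Wr x + C * Wr x + C" for x
    using \<Phi>0(5)[of x] Wr_nonneg[of x] by linarith
  ultimately show ?case
    using \<Phi>0 by (simp add: \<tau>_def)
next
  case (Suc n)
  have eq: "\<And>x. value_iter D \<Phi>0 n x = ereal (\<Phi> n x)" and meas: "\<Phi> n \<in> borel_measurable borel"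
    and up: "\<And>x. \<Phi> n x \<le> Wr x + C * \<rho> ^ n * Wr x + (C + C * \<tau> n)"
    and lo: "\<And>x. (1 - \<rho> ^ n) * Wr x - (b + \<tau> n) \<le> \<Phi> n x"
    using Suc by auto
  have lo': "- (b + \<tau> n) \<le> \<Phi> n x" for x
  proof -
    have "0 \<le> (1 - \<rho> ^ n) * Wr x"
      using \<rho>_power[of n] by simp
    then show ?thesis
      using lo[of x] by linarith
  qed
  note bell = bellman_\<Phi>[OF eq meas lo']
  let ?I = "\<lambda>x. \<integral>y. \<Phi> n y \<partial>trans D (x, u x)"
  have \<Phi>_u: "integrable (trans D (x, u x)) (\<Phi> n)" for x
  proof (rule integrable_linear_growth[OF trans_prob[OF gr_u] trans_measI[OF meas gr_u] Wr_u])
    show "\<bar>\<Phi> n y\<bar> \<le> (1 + C * \<rho> ^ n) * Wr y + (C + C * \<tau> n + b + \<tau> n)" for y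
    proof -
      have "0 \<le> C * \<rho> ^ n * Wr y" "0 \<le> C * \<tau> n"
        using \<Phi>0(3) \<rho>_power[of n] \<tau>_bounds(1)[of n] by auto
      moreover have "(1 + C * \<rho> ^ n) * Wr y = Wr y + C * \<rho> ^ n * Wr y"
        by (simp add: distrib_right)
      ultimately show ?thesis
        using up[of y] lo'[of y] \<Phi>0(2,3) \<tau>_bounds(1)[of n] Wr_nonneg[of y] by linarith
    qed
  qed
  have bell_u: "bellman D (value_iter D \<Phi>0 n) x (u x) = ereal (cr (x, u x) - \<beta> + ?I x)" for x
    using bell[OF gr_u] cost_u \<Phi>_u by simp
  have bell_v_le: "bellman D (value_iter D \<Phi>0 n) x (v n x) \<le> ereal (cr (x, u x) - \<beta> + ?I x)" for x
    using v_min[OF u(2)] bell_u by metis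
  have fin: "cost D (x, v n x) < \<infinity>" "integrable (trans D (x, v n x)) (\<Phi> n)" for x
    using bell_v_le[of x] bell[OF gr_v[of x n]] by (auto split: if_splits)
  have bell_v: "bellman D (value_iter D \<Phi>0 n) x (v n x) =
      ereal (cr (x, v n x) - \<beta> + (\<integral>y. \<Phi> n y \<partial>trans D (x, v n x)))" for x
    using bell[OF gr_v[of x n]] fin by simp
  then have eq': "value_iter D \<Phi>0 (Suc n) x = ereal (\<Phi> (Suc n) x)"
    and \<Phi>_Suc: "\<Phi> (Suc n) x = cr (x, v n x) - \<beta> + (\<integral>y. \<Phi> n y \<partial>trans D (x, v n x))" for x
    unfolding \<Phi>_def value_iter_Suc_v by simp_all
  have \<Phi>_Suc_le: "\<Phi> (Suc n) x \<le> cr (x, u x) - \<beta> + ?I x" for x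
    using bell_v_le[of x] unfolding bell_v \<Phi>_Suc by simp
  have meas': "\<Phi> (Suc n) \<in> borel_measurable borel"
  proof -
    have g: "(\<lambda>x. (x, v n x)) \<in> borel \<rightarrow>\<^sub>M grM D"
      by (rule graph_meas[OF v_meas gr_v])
    have "(\<lambda>x. \<integral>y. \<Phi> n y \<partial>trans D (x, v n x)) \<in> borel_measurable borel"
      by (rule measurable_compose[OF measurable_compose[OF g measurable_prob_algebraD[OF trans_meas]]
            integral_measurable_subprob_algebra[OF meas]])
    moreover have "(\<lambda>x. cr (x, v n x)) \<in> borel_measurable borel"
      unfolding cr_def using measurable_compose[OF g cost_meas] by measurable
    ultimately show ?thesis
      unfolding \<Phi>_Suc[abs_def] by measurable
  qed
  have up': "\<Phi> (Suc n) x \<le> Wr x + C * \<rho> ^ Suc n * Wr x + (C + C * \<tau> (Suc n))" for x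
  proof -
    interpret prob_space "trans D (x, u x)"
      by (rule trans_prob[OF gr_u])
    let ?w = "\<integral>y. Wr y \<partial>trans D (x, u x)"
    have "?I x \<le> (\<integral>y. Wr y + C * \<rho> ^ n * Wr y + (C + C * \<tau> n) \<partial>trans D (x, u x))"
      using \<Phi>_u Wr_u up by (intro integral_mono) auto
    also have "\<dots> = ?w + C * \<rho> ^ n * ?w + (C + C * \<tau> n)"
      using Wr_u by (simp add: prob_space)
    finally have "\<Phi> (Suc n) x \<le> Wr x + C * \<rho> ^ n * ?w + (C + C * \<tau> n)"
      using \<Phi>_Suc_le[of x] Wr_u_eq[of x] by linarith
    moreover have "?w \<le> \<rho> * Wr x + (K + \<beta>)"
      using Wr_u_eq[of x] cr_ge[OF gr_u cost_u, of x] by (simp add: algebra_simps)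
    then have "C * \<rho> ^ n * ?w \<le> C * \<rho> ^ n * (\<rho> * Wr x + (K + \<beta>))"
      using \<Phi>0(3) \<rho>_power by (intro mult_left_mono) auto
    ultimately show ?thesis
      unfolding \<tau>_Suc by (simp add: algebra_simps)
  qed
  have lo'': "(1 - \<rho> ^ Suc n) * Wr x - (b + \<tau> (Suc n)) \<le> \<Phi> (Suc n) x" for x
  proof -
    interpret prob_space "trans D (x, v n x)"
      by (rule trans_prob[OF gr_v])
    let ?c = "cr (x, v n x)"
    have c: "\<theta> * Wr x - K \<le> ?c"
      using cr_ge[OF gr_v fin(1), of x] by simp
    \<comment> \<open>For \<open>n = 0\<close> the factor \<open>1 - \<rho> ^ n\<close> vanishes and
      nothing has to be known about the integrability of \<open>Wr\<close>. For \<open>n > 0\<close>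
      the lower bound on the iterate makes \<open>Wr\<close> integrable because the iterate
      is.\<close>
    have I: "(1 - \<rho> ^ n) * (Wr x + \<beta> - ?c) - (b + \<tau> n) \<le> (\<integral>y. \<Phi> n y \<partial>trans D (x, v n x))"
    proof (cases "n = 0")
      case True
      have "(\<integral>y. - (b + \<tau> n) \<partial>trans D (x, v n x)) \<le> (\<integral>y. \<Phi> n y \<partial>trans D (x, v n x))"
        using fin(2) lo' by (intro integral_mono) auto
      then have "- (b + \<tau> n) \<le> (\<integral>y. \<Phi> n y \<partial>trans D (x, v n x))"
        by (simp add: prob_space)
      with True show ?thesis
        by simp
    next
      case False
      have pos: "0 < 1 - \<rho> ^ n"
        using \<theta> False by (simp add: power_less_one_iff)
      have Wr_int: "integrable (trans D (x, v n x)) Wr"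
      proof (rule Bochner_Integration.integrable_bound)
        show "integrable (trans D (x, v n x)) (\<lambda>y. (\<Phi> n y + (b + \<tau> n)) / (1 - \<rho> ^ n))"
          using fin(2) by simp
        have "Wr y \<le> (\<Phi> n y + (b + \<tau> n)) / (1 - \<rho> ^ n)" for y
          using lo[of y] pos by (simp add: pos_le_divide_eq mult.commute)
        then show "AE y in trans D (x, v n x). norm (Wr y) \<le> norm ((\<Phi> n y + (b + \<tau> n)) / (1 - \<rho> ^ n))"
          by (intro AE_I2) (simp add: order_trans[OF _ abs_ge_self] del: abs_divide)
      qed (rule trans_measI[OF Wr_meas gr_v])
      have "(1 - \<rho> ^ n) * (Wr x + \<beta> - ?c) \<le> (1 - \<rho> ^ n) * (\<integral>y. Wr y \<partial>trans D (x, v n x))"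
        using Wr_integral_ge[OF gr_v fin(1) Wr_int] pos by (intro mult_left_mono) auto
      moreover have "(\<integral>y. (1 - \<rho> ^ n) * Wr y - (b + \<tau> n) \<partial>trans D (x, v n x)) \<le> (\<integral>y. \<Phi> n y \<partial>trans D (x, v n x))"
        using fin(2) Wr_int lo by (intro integral_mono) auto
      moreover have "(\<integral>y. (1 - \<rho> ^ n) * Wr y - (b + \<tau> n) \<partial>trans D (x, v n x)) =
          (1 - \<rho> ^ n) * (\<integral>y. Wr y \<partial>trans D (x, v n x)) - (b + \<tau> n)"
        using Wr_int by (simp add: prob_space)
      ultimately show ?thesis
        by linarith
    qed
    have "\<rho> ^ n * (\<theta> * Wr x - K) \<le> \<rho> ^ n * ?c"
      using c \<rho>_power by (intro mult_left_mono) auto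
    then show ?thesis
      using I unfolding \<Phi>_Suc \<tau>_Suc by (simp add: algebra_simps)
  qed
  show ?case
    using eq' meas' up' lo'' by blast
qed

definition "T = C + C * ((K + \<beta>) / \<theta>)"
definition "b' = b + (K + \<beta>) / \<theta>"

lemma T_nonneg: "0 \<le> T" and b'_nonneg: "0 \<le> b'"
  using \<Phi>0(2,3) \<theta> \<beta>_nonneg by (simp_all add: T_def b'_def)

lemma value_iter_\<Phi>: "value_iter D \<Phi>0 n x = ereal (\<Phi> n x)"
  and \<Phi>_meas: "\<Phi> n \<in> borel_measurable borel"
  and \<Phi>_le: "\<Phi> n x \<le> Wr x + C * \<rho> ^ n * Wr x + T"
  and \<Phi>_ge: "(1 - \<rho> ^ n) * Wr x - b' \<le> \<Phi> n x"
proof -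
  note * = value_iter_invariant[of n]
  show "value_iter D \<Phi>0 n x = ereal (\<Phi> n x)" "\<Phi> n \<in> borel_measurable borel"
    using * by auto
  have "C * \<tau> n \<le> C * ((K + \<beta>) / \<theta>)"
    using \<tau>_bounds(2) \<Phi>0(3) by (rule mult_left_mono)
  then show "\<Phi> n x \<le> Wr x + C * \<rho> ^ n * Wr x + T"
    using *[THEN conjunct2, THEN conjunct2, THEN conjunct1, rule_format, of x] by (simp add: T_def)
  show "(1 - \<rho> ^ n) * Wr x - b' \<le> \<Phi> n x"
    using *[THEN conjunct2, THEN conjunct2, THEN conjunct2, rule_format, of x] \<tau>_bounds(2)[of n]
    by (simp add: b'_def)
qed

lemma \<Phi>_ge': "- b' \<le> \<Phi> n x"
proof -
  have "0 \<le> (1 - \<rho> ^ n) * Wr x"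
    using \<rho>_power[of n] by simp
  then show ?thesis
    using \<Phi>_ge[of n x] by linarith
qed

lemma \<Phi>_abs: "\<bar>\<Phi> n x\<bar> \<le> (1 + C) * Wr x + (T + b')"
proof -
  have "\<rho> ^ n * (C * Wr x) \<le> 1 * (C * Wr x)"
    using \<rho>_power \<Phi>0(3) by (intro mult_right_mono) auto
  then have "C * \<rho> ^ n * Wr x \<le> C * Wr x"
    by (simp add: ac_simps)
  moreover have "0 \<le> C * Wr x"
    using \<Phi>0(3) by simp
  moreover have "(1 + C) * Wr x = Wr x + C * Wr x"
    by (simp add: distrib_right)
  ultimately show ?thesis
    using \<Phi>_le[of n x] \<Phi>_ge'[of n x] T_nonneg b'_nonneg Wr_nonneg[of x] by linarith
qed

lemma \<Phi>_u: "integrable (trans D (x, u x)) (\<Phi> n)"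
  by (rule integrable_linear_growth[OF trans_prob[OF gr_u] trans_measI[OF \<Phi>_meas gr_u] Wr_u \<Phi>_abs])

lemma \<Phi>_\<nu>: "integrable \<nu> (\<Phi> n)"
  by (rule integrable_linear_growth[OF \<nu>_prob \<nu>_measI[OF \<Phi>_meas] Wr_\<nu>(1) \<Phi>_abs])

lemma bellman_v:
  shows cost_v: "cost D (x, v n x) < \<infinity>" and \<Phi>_v: "integrable (trans D (x, v n x)) (\<Phi> n)"
    and \<Phi>_Suc: "\<Phi> (Suc n) x = cr (x, v n x) - \<beta> + (\<integral>y. \<Phi> n y \<partial>trans D (x, v n x))"
    and \<Phi>_Suc_le: "\<Phi> (Suc n) x \<le> cr (x, u x) - \<beta> + (\<integral>y. \<Phi> n y \<partial>trans D (x, u x))"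
proof -
  note bell = bellman_\<Phi>[OF value_iter_\<Phi> \<Phi>_meas \<Phi>_ge']
  have le: "bellman D (value_iter D \<Phi>0 n) x (v n x) \<le> ereal (cr (x, u x) - \<beta> + (\<integral>y. \<Phi> n y \<partial>trans D (x, u x)))"
    using v_min[OF u(2), of n x] bell[OF gr_u, of n x] cost_u \<Phi>_u by simp
  then show c: "cost D (x, v n x) < \<infinity>" and i: "integrable (trans D (x, v n x)) (\<Phi> n)"
    using bell[OF gr_v[of x n], of n] by (auto split: if_splits)
  have "ereal (\<Phi> (Suc n) x) = ereal (cr (x, v n x) - \<beta> + (\<integral>y. \<Phi> n y \<partial>trans D (x, v n x)))"
    using bell[OF gr_v[of x n], of n] c i by (simp only: value_iter_\<Phi>[symmetric] value_iter_Suc_v) simp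
  then show eq: "\<Phi> (Suc n) x = cr (x, v n x) - \<beta> + (\<integral>y. \<Phi> n y \<partial>trans D (x, v n x))"
    by simp
  show "\<Phi> (Suc n) x \<le> cr (x, u x) - \<beta> + (\<integral>y. \<Phi> n y \<partial>trans D (x, u x))"
    using le bell[OF gr_v[of x n], of n] c i unfolding eq by simp
qed

lemma Wr_v:
  assumes "1 \<le> n"
  shows "integrable (trans D (x, v n x)) Wr"
proof (rule Bochner_Integration.integrable_bound)
  have pos: "0 < 1 - \<rho> ^ n"
    using \<theta> assms by (simp add: power_less_one_iff)
  show "integrable (trans D (x, v n x)) (\<lambda>y. (\<Phi> n y + b') / (1 - \<rho> ^ n))"
  proof -
    interpret prob_space "trans D (x, v n x)"
      by (rule trans_prob[OF gr_v])
    show ?thesis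
      using \<Phi>_v by simp
  qed
  have "Wr y \<le> (\<Phi> n y + b') / (1 - \<rho> ^ n)" for y
    using \<Phi>_ge[of n y] pos by (simp add: pos_le_divide_eq mult.commute)
  then show "AE y in trans D (x, v n x). norm (Wr y) \<le> norm ((\<Phi> n y + b') / (1 - \<rho> ^ n))"
    by (intro AE_I2) (simp add: order_trans[OF _ abs_ge_self] del: abs_divide)
qed (rule trans_measI[OF Wr_meas gr_v])

section \<open>Differences between the iterates and the optimal value\<close>

definition h :: "nat \<Rightarrow> 'a \<Rightarrow> real" where "h n x = \<Phi> n x - Wr x"

lemma h_meas [measurable]: "h n \<in> borel_measurable borel"
  unfolding h_def[abs_def] using \<Phi>_meas by measurable

lemma h_u: "integrable (trans D (x, u x)) (h n)"
  and h_\<nu>: "integrable \<nu> (h n)"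
  and h_v: "1 \<le> n \<Longrightarrow> integrable (trans D (x, v n x)) (h n)"
  unfolding h_def[abs_def] using \<Phi>_u \<Phi>_\<nu> \<Phi>_v Wr_u Wr_\<nu> Wr_v by auto

text \<open>\<open>u\<close> attains the minimum for \<open>W\<close> and is a mere competitor for
  the iterate; for \<open>v n\<close> the roles are exchanged, which gives the companion bound. In
  both comparisons the running costs cancel.\<close>

lemma h_Suc_le: "h (Suc n) x \<le> (\<integral>y. h n y \<partial>trans D (x, u x))"
  using \<Phi>_Suc_le[of n x] Wr_u_eq[of x] \<Phi>_u[of x n] Wr_u[of x] by (simp add: h_def)

lemma h_Suc_ge:
  assumes "1 \<le> n"
  shows "(\<integral>y. h n y \<partial>trans D (x, v n x)) \<le> h (Suc n) x"
  using \<Phi>_Suc[of n x] Wr_integral_ge[OF gr_v cost_v Wr_v[OF assms], of x] \<Phi>_v[of x n] Wr_v[OF assms, of x]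
  by (simp add: h_def)

lemma h_abs_le: "\<bar>h n x\<bar> \<le> (1 + C) * \<rho> ^ n * Wr x + (T + b')"
proof -
  have "0 \<le> C * \<rho> ^ n * Wr x" "0 \<le> \<rho> ^ n * Wr x"
    using \<Phi>0(3) \<rho>_power by auto
  then show ?thesis
    using \<Phi>_le[of n x] \<Phi>_ge[of n x] T_nonneg b'_nonneg
    by (simp add: h_def abs_le_iff algebra_simps)
qed

lemma h_abs_le': "\<bar>h n x\<bar> \<le> (1 + C) * Wr x + (T + b')"
proof -
  have "\<rho> ^ n * ((1 + C) * Wr x) \<le> 1 * ((1 + C) * Wr x)"
    using \<rho>_power \<Phi>0(3) by (intro mult_right_mono) auto
  then show ?thesis
    using h_abs_le[of n x] by (simp add: ac_simps)
qed

end

section \<open>Pointwise convergence of the value iterates\<close>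

context value_iteration
begin

lemma Wr_ge: "\<epsilon> \<le> Wr x"
proof -
  have "ennreal \<epsilon> \<le> W x"
    using cost'_ge[OF gr_u, of x] unfolding u(3)[of x] by (rule order_trans) simp
  then have "ennreal \<epsilon> \<le> ennreal (Wr x)"
    by (simp add: W_Wr)
  then show ?thesis
    by simp
qed

lemma cr_off_B: "k \<in> gr D \<Longrightarrow> cost D k < \<infinity> \<Longrightarrow> fst k \<notin> B \<Longrightarrow> \<beta> + \<epsilon> \<le> cr k"
proof -
  assume k: "k \<in> gr D" "cost D k < \<infinity>" "fst k \<notin> B"
  have "ennreal (\<beta> + \<epsilon>) \<le> ennreal (cr k)"
    using cost_off_B[OF k(1,3)] k(2) by (simp add: cr_def)
  then show ?thesis
    by (subst (asm) ennreal_le_iff) auto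
qed

text \<open>With this shift \<open>L n \<ge> \<alpha>\<close> holds everywhere, so on
  \<open>B\<close> the killed term contributes at least
  \<open>\<delta> * \<alpha> = \<beta> + \<epsilon>\<close>.\<close>

definition "a\<^sub>2 = b' + \<alpha>"
definition "C\<^sub>2 = 1 + C + T + a\<^sub>2"
definition "\<gamma> = 1 - (\<theta> / C\<^sub>2) / (1 + (K + \<beta> + \<theta>) / \<epsilon>)"
definition "L n x = \<Phi> n x + a\<^sub>2"

lemma constants: "0 < a\<^sub>2" "1 \<le> C\<^sub>2" "0 < \<gamma>" "\<gamma> < 1"
proof -
  show a: "0 < a\<^sub>2"
    using b'_nonneg \<alpha>(1) by (simp add: a\<^sub>2_def)
  then show C2: "1 \<le> C\<^sub>2"
    using \<Phi>0(3) T_nonneg by (simp add: C\<^sub>2_def)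
  have den: "1 \<le> 1 + (K + \<beta> + \<theta>) / \<epsilon>"
    using \<theta> \<beta>_nonneg \<epsilon>(1) by simp
  have num: "0 < \<theta> / C\<^sub>2" "\<theta> / C\<^sub>2 < 1"
    using \<theta> C2 by (simp_all add: divide_less_eq)
  have "0 < (\<theta> / C\<^sub>2) / (1 + (K + \<beta> + \<theta>) / \<epsilon>)"
    using num den by (intro divide_pos_pos[OF num(1)]) linarith
  then show "\<gamma> < 1"
    by (simp add: \<gamma>_def del: zero_less_divide_iff)
  have "(\<theta> / C\<^sub>2) / (1 + (K + \<beta> + \<theta>) / \<epsilon>) < 1"
    using num den by (subst divide_less_eq) auto
  then show "0 < \<gamma>"
    by (simp add: \<gamma>_def)
qed

text \<open>\<open>z\<close> is the decrease of a Lyapunov function in one killed step. The bound by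
  \<epsilon> is too weak where \<open>W\<close> is large, the bound by
  \<open>\<theta> * W - (K + \<beta>)\<close> where \<open>W\<close> is small. Adding
  \<open>\<zeta> = (K + \<beta> + \<theta>) / \<epsilon>\<close> times the former to the latter
  gives \<open>\<theta> * (W + 1) \<le> (1 + \<zeta>) * z\<close>; this is the origin of
  \<gamma>.\<close>

lemma drift:
  assumes z: "\<epsilon> \<le> z" "\<theta> * Wr x - (K + \<beta>) \<le> z" and l: "l \<le> C\<^sub>2 * (Wr x + 1)"
  shows "(1 - \<gamma>) * l \<le> z"
proof -
  define \<zeta> where "\<zeta> = (K + \<beta> + \<theta>) / \<epsilon>"
  have \<zeta>: "0 \<le> \<zeta>" "\<zeta> * \<epsilon> = K + \<beta> + \<theta>"
    using \<theta> \<beta>_nonneg \<epsilon>(1) by (simp_all add: \<zeta>_def)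
  have "(\<theta> / C\<^sub>2) * l \<le> (\<theta> / C\<^sub>2) * (C\<^sub>2 * (Wr x + 1))"
    using \<theta> constants(2) l by (intro mult_left_mono) auto
  also have "\<dots> = \<theta> * Wr x - (K + \<beta>) + \<zeta> * \<epsilon>"
    using constants(2) by (simp add: \<zeta>(2) distrib_left)
  also have "\<dots> \<le> z + \<zeta> * z"
    using z \<zeta>(1) by (intro add_mono mult_left_mono)
  also have "\<dots> = (1 + \<zeta>) * z"
    by (simp add: distrib_right)
  finally have "(\<theta> / C\<^sub>2) * l / (1 + \<zeta>) \<le> z"
  proof -
    have "0 < 1 + \<zeta>"
      using \<zeta>(1) by simp
    moreover assume "(\<theta> / C\<^sub>2) * l \<le> (1 + \<zeta>) * z"
    ultimately show ?thesis
      by (simp only: pos_divide_le_eq mult.commute)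
  qed
  then show ?thesis
    by (simp add: \<gamma>_def \<zeta>_def)
qed

lemma L_le: "L n x \<le> C\<^sub>2 * (Wr x + 1)"
proof -
  have "(1 + C) * Wr x \<le> C\<^sub>2 * Wr x"
    using T_nonneg constants(1) by (intro mult_right_mono) (auto simp: C\<^sub>2_def)
  moreover have "\<rho> ^ n * (C * Wr x) \<le> 1 * (C * Wr x)"
    using \<rho>_power \<Phi>0(3) by (intro mult_right_mono) auto
  moreover have "T + a\<^sub>2 \<le> C\<^sub>2"
    using \<Phi>0(3) by (simp add: C\<^sub>2_def)
  ultimately show "L n x \<le> C\<^sub>2 * (Wr x + 1)"
    using \<Phi>_le[of n x] by (simp add: L_def algebra_simps)
qed

text \<open>The Bellman recursion is an equality at \<open>v n\<close>, so the decrease is known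
  exactly: \<open>c - \<beta> + atom * \<nu>(L n)\<close>. On \<open>B\<close> the atom makes it at
  least \<epsilon>, off \<open>B\<close> the cost does.\<close>

lemma L_drift: "(\<integral>y. L n y \<partial>trans D (x, v n x)) - atom x * (\<integral>y. L n y \<partial>\<nu>) \<le> \<gamma> * L (Suc n) x"
proof -
  interpret T: prob_space "trans D (x, v n x)"
    by (rule trans_prob[OF gr_v])
  interpret N: prob_space \<nu>
    by (rule \<nu>_prob)
  let ?c = "cr (x, v n x)" and ?p = "\<integral>y. \<Phi> n y \<partial>\<nu>"
  define z where "z = ?c - \<beta> + atom x * (?p + a\<^sub>2)"
  have "(\<integral>y. - b' \<partial>\<nu>) \<le> ?p"
    by (intro integral_mono \<Phi>_\<nu> \<Phi>_ge') simp
  then have p: "\<alpha> \<le> ?p + a\<^sub>2"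
    by (simp add: N.prob_space a\<^sub>2_def)
  have "\<epsilon> \<le> z"
  proof (cases "x \<in> B")
    case True
    have "\<delta> * \<alpha> \<le> \<delta> * (?p + a\<^sub>2)"
      using p \<delta> by (intro mult_left_mono) auto
    then show ?thesis
      using True \<alpha>(2) cr_nonneg[of "(x, v n x)"] by (simp add: z_def atom mult.commute del: cr_nonneg)
  next
    case False
    then show ?thesis
      using cr_off_B[OF gr_v cost_v, of x n] by (simp add: z_def atom)
  qed
  moreover have "\<theta> * Wr x - (K + \<beta>) \<le> z"
  proof -
    have "0 \<le> atom x * (?p + a\<^sub>2)"
      using atom(1)[of x] p \<alpha>(1) by (intro mult_nonneg_nonneg) auto
    then show ?thesis
      using cr_ge[OF gr_v cost_v, of x n] by (simp add: z_def)
  qed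
  ultimately have "(1 - \<gamma>) * L (Suc n) x \<le> z"
    by (rule drift[OF _ _ L_le])
  moreover have "(\<integral>y. L n y \<partial>trans D (x, v n x)) = L (Suc n) x - (?c - \<beta>)"
    using \<Phi>_Suc[of n x] \<Phi>_v[of x n] by (simp add: L_def T.prob_space)
  moreover have "(\<integral>y. L n y \<partial>\<nu>) = ?p + a\<^sub>2"
    using \<Phi>_\<nu>[of n] by (simp add: L_def N.prob_space)
  ultimately show ?thesis
    by (simp add: z_def algebra_simps)
qed

text \<open>For the fixed selector \<open>u\<close> the optimality equation gives the decrease
  \<open>c - \<beta> + atom * (\<beta> + \<alpha>)\<close>, with the known value of
  \<nu>(W).\<close>

lemma Wr_drift: "(\<integral>y. Wr y \<partial>trans D (x, u x)) - atom x * (\<integral>y. Wr y \<partial>\<nu>) \<le> \<gamma> * Wr x"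
proof -
  define z where "z = cr (x, u x) - \<beta> + atom x * (\<beta> + \<alpha>)"
  have "\<epsilon> \<le> z"
  proof (cases "x \<in> B")
    case True
    then show ?thesis
      using \<alpha>(2) cr_nonneg[of "(x, u x)"] \<delta> \<beta>_nonneg
      by (simp add: z_def atom distrib_left mult.commute[of \<delta> \<alpha>] add_increasing2 del: cr_nonneg)
  next
    case False
    then show ?thesis
      using cr_off_B[OF gr_u cost_u, of x] by (simp add: z_def atom)
  qed
  moreover have "\<theta> * Wr x - (K + \<beta>) \<le> z"
  proof -
    have "0 \<le> atom x * (\<beta> + \<alpha>)"
      using atom(1)[of x] \<alpha>(1) \<beta>_nonneg by (intro mult_nonneg_nonneg) auto
    then show ?thesis
      using cr_ge[OF gr_u cost_u, of x] by (simp add: z_def)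
  qed
  moreover have "Wr x \<le> C\<^sub>2 * (Wr x + 1)"
    using mult_right_mono[OF constants(2), of "Wr x + 1"] by (simp add: add_nonneg_nonneg)
  ultimately have "(1 - \<gamma>) * Wr x \<le> z"
    by (rule drift)
  then show ?thesis
    using Wr_u_eq[of x] by (simp add: z_def Wr_\<nu>(2) algebra_simps)
qed

text \<open>The killed operator of \<open>u\<close> on real functions, needed because
  \<open>h n\<close> has no sign; integrability takes the place of nonnegativity.\<close>

definition r :: "('a \<Rightarrow> real) \<Rightarrow> 'a \<Rightarrow> real" where
  "r f x = (\<integral>y. f y \<partial>trans D (x, u x)) - atom x * (\<integral>y. f y \<partial>\<nu>)"

lemma r_meas: "f \<in> borel_measurable borel \<Longrightarrow> r f \<in> borel_measurable borel"
proof -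
  assume f: "f \<in> borel_measurable borel"
  have "(\<lambda>x. \<integral>y. f y \<partial>trans D (x, u x)) \<in> borel_measurable borel"
    by (rule measurable_compose[OF measurable_compose[OF graph_meas[OF u(1) gr_u]
            measurable_prob_algebraD[OF trans_meas]] integral_measurable_subprob_algebra[OF f]])
  then show ?thesis
    unfolding r_def[abs_def] by measurable
qed

lemma r_mono:
  assumes "f \<in> borel_measurable borel" "g \<in> borel_measurable borel"
    and int: "integrable (trans D (x, u x)) f" "integrable (trans D (x, u x)) g" "integrable \<nu> f" "integrable \<nu> g"
    and le: "\<And>y. f y \<le> g y"
  shows "r f x \<le> r g x"
  using atom_integral_le[OF gr_u[of x], of "\<lambda>y. g y - f y"] assms
  by (simp add: r_def right_diff_distrib)

lemma bounded_integrable: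
  assumes "f \<in> borel_measurable borel" "\<And>x. 0 \<le> f x" "\<And>x. f x \<le> (1::real)"
  shows "integrable (trans D (x, u x)) f" "integrable \<nu> f"
proof -
  interpret T: prob_space "trans D (x, u x)"
    by (rule trans_prob[OF gr_u])
  interpret N: prob_space \<nu>
    by (rule \<nu>_prob)
  show "integrable (trans D (x, u x)) f"
    using assms by (intro T.integrable_const_bound[of _ 1] trans_measI gr_u) auto
  show "integrable \<nu> f"
    using assms by (intro N.integrable_const_bound[of _ 1] \<nu>_measI) auto
qed

text \<open>\<open>q j x\<close> is the probability that the first regeneration under
  \<open>u\<close> happens in step \<open>Suc j\<close>, and \<open>F j x\<close> below is the
  probability of none in the first \<open>j\<close> steps.\<close>

definition q :: "nat \<Rightarrow> 'a \<Rightarrow> real" where "q j = (r ^^ j) atom"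

definition F :: "nat \<Rightarrow> 'a \<Rightarrow> real" where "F j = (r ^^ j) (\<lambda>_. 1)"

lemma q_F_Suc: "q (Suc j) = r (q j)" "F (Suc j) = r (F j)" "q 0 = atom" "F 0 = (\<lambda>_. 1)"
  by (simp_all add: q_def F_def)

lemma r_zero: "r (\<lambda>_. 0) x = 0"
  by (simp add: r_def)

lemma r_one: "r (\<lambda>_. 1) x = 1 - atom x"
  using prob_space.prob_space[OF trans_prob[OF gr_u]] prob_space.prob_space[OF \<nu>_prob]
  by (simp add: r_def)

lemma r_nonneg:
  assumes f: "f \<in> borel_measurable borel" "\<And>x. 0 \<le> f x" "\<And>x. f x \<le> 1"
  shows "0 \<le> r f x" "r f x \<le> 1"
proof -
  have "r (\<lambda>_. 0) x \<le> r f x"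
    using bounded_integrable[OF f] f by (intro r_mono) auto
  then show "0 \<le> r f x"
    by (simp add: r_zero)
  have one: "integrable (trans D (x, u x)) (\<lambda>_. 1 :: real)" "integrable \<nu> (\<lambda>_. 1 :: real)"
    by (rule bounded_integrable; simp)+
  have "r f x \<le> r (\<lambda>_. 1) x"
    by (rule r_mono[OF f(1) borel_measurable_const bounded_integrable(1)[OF f] one(1)
          bounded_integrable(2)[OF f] one(2) f(3)])
  then show "r f x \<le> 1"
    using atom(1)[of x] by (simp add: r_one)
qed

lemma q_facts: "q j \<in> borel_measurable borel \<and> (\<forall>x. 0 \<le> q j x \<and> q j x \<le> 1)"
proof (induction j)
  case 0
  then show ?case
    using atom(1,2) by (auto simp: q_F_Suc intro: less_imp_le)
next
  case (Suc j)
  then show ?case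
    unfolding q_F_Suc using r_meas r_nonneg by blast
qed

text \<open>Since \<open>W \<ge> \<epsilon>\<close>, the constant 1 is dominated by
  \<open>W / \<epsilon>\<close>, and the killed operator contracts \<open>W\<close>. Hence
  regeneration times have geometric tails.\<close>

lemma F_facts: "F j \<in> borel_measurable borel \<and> (\<forall>x. 0 \<le> F j x \<and> F j x \<le> 1) \<and> (\<forall>x. F j x \<le> (1 / \<epsilon>) * \<gamma> ^ j * Wr x)"
proof (induction j)
  case 0
  have "1 \<le> 1 / \<epsilon> * Wr x" for x
    using Wr_ge[of x] \<epsilon>(1) by simp
  then show ?case
    by (simp add: q_F_Suc)
next
  case (Suc j)
  then have j: "F j \<in> borel_measurable borel" "\<And>x. 0 \<le> F j x" "\<And>x. F j x \<le> 1"
    "\<And>x. F j x \<le> (1 / \<epsilon>) * \<gamma> ^ j * Wr x"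
    by auto
  have "r (F j) x \<le> (1 / \<epsilon>) * \<gamma> ^ Suc j * Wr x" for x
  proof -
    have "r (F j) x \<le> r (\<lambda>x. (1 / \<epsilon>) * \<gamma> ^ j * Wr x) x"
      using bounded_integrable[OF j(1,2,3)] j(1,4) Wr_u Wr_\<nu> by (intro r_mono) auto
    also have "\<dots> = (1 / \<epsilon>) * \<gamma> ^ j * r Wr x"
      by (simp add: r_def algebra_simps)
    also have "\<dots> \<le> (1 / \<epsilon>) * \<gamma> ^ j * (\<gamma> * Wr x)"
      using Wr_drift[of x] \<epsilon>(1) constants(3) unfolding r_def by (intro mult_left_mono) auto
    finally show ?thesis
      by (simp add: ac_simps)
  qed
  then show ?case
    unfolding q_F_Suc using r_meas[OF j(1)] r_nonneg[OF j(1,2,3)] by blast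
qed

lemma F_int: "integrable (trans D (x, u x)) (F j)" "integrable \<nu> (F j)"
  and q_int: "integrable (trans D (x, u x)) (q j)" "integrable \<nu> (q j)"
  by (rule bounded_integrable; use F_facts[of j] q_facts[of j] in blast)+

lemma F_Suc_diff: "F (Suc j) x = F j x - q j x"
proof (induction j arbitrary: x)
  case 0
  then show ?case
    by (simp add: q_F_Suc r_one)
next
  case (Suc j)
  then have "F (Suc j) = (\<lambda>x. F j x - q j x)"
    by blast
  then have "r (F (Suc j)) x = r (F j) x - r (q j) x"
    using F_int q_int by (simp add: r_def algebra_simps)
  then show ?case
    by (simp only: q_F_Suc(1,2))
qed

definition a :: "nat \<Rightarrow> real" where "a n = (\<integral>y. h n y \<partial>\<nu>)"

definition "C\<^sub>3 = (1 + C) + (T + b') / \<epsilon>"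

lemma h_le_C3: "\<bar>h n x\<bar> \<le> C\<^sub>3 * Wr x"
proof -
  have "(T + b') / \<epsilon> * \<epsilon> \<le> (T + b') / \<epsilon> * Wr x"
    using Wr_ge T_nonneg b'_nonneg \<epsilon>(1) by (intro mult_left_mono) auto
  moreover have "(T + b') / \<epsilon> * \<epsilon> = T + b'"
    using \<epsilon>(1) by simp
  moreover have "C\<^sub>3 * Wr x = (1 + C) * Wr x + (T + b') / \<epsilon> * Wr x"
    unfolding C\<^sub>3_def by (rule distrib_right)
  ultimately show ?thesis
    using h_abs_le'[of n x] by linarith
qed

lemma C3_nonneg: "0 \<le> C\<^sub>3"
  using \<Phi>0(3) T_nonneg b'_nonneg \<epsilon>(1) by (simp add: C\<^sub>3_def)

text \<open>Decomposition at the first regeneration: if it occurs in step \<open>Suc j\<close>, the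
  chain restarts from \<nu> with \<open>n - Suc j\<close> iterations left, which contributes
  \<open>a (n - Suc j)\<close>; without regeneration the contraction of \<open>W\<close> bounds the
  contribution.\<close>

lemma h_le_renewal: "h n x \<le> C\<^sub>3 * \<gamma> ^ n * Wr x + (\<Sum>j<n. q j x * a (n - Suc j))"
proof (induction n arbitrary: x)
  case 0
  then show ?case
    using h_le_C3[of 0 x] by (simp add: abs_le_iff)
next
  case (Suc n)
  define p where "p y = C\<^sub>3 * \<gamma> ^ n * Wr y + (\<Sum>j<n. q j y * a (n - Suc j))" for y
  have p_meas: "p \<in> borel_measurable borel"
  proof -
    have [measurable]: "q j \<in> borel_measurable borel" for j
      using q_facts by blast
    show ?thesis
      unfolding p_def[abs_def] by measurable
  qed
  have p_int: "integrable (trans D (x, u x)) p" "integrable \<nu> p"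
    unfolding p_def[abs_def] using Wr_u Wr_\<nu> q_int by auto
  have "r (h n) x \<le> r p x"
    using Suc p_int h_u h_\<nu> p_meas by (intro r_mono) (auto simp: p_def)
  also have "r p x = C\<^sub>3 * \<gamma> ^ n * r Wr x + (\<Sum>j<n. q (Suc j) x * a (n - Suc j))"
    using Wr_u[of x] Wr_\<nu>(1) q_int
    by (simp add: p_def[abs_def] r_def q_F_Suc(1) algebra_simps sum_subtractf sum_distrib_left)
  also have "C\<^sub>3 * \<gamma> ^ n * r Wr x \<le> C\<^sub>3 * \<gamma> ^ n * (\<gamma> * Wr x)"
    using Wr_drift[of x] C3_nonneg constants(3) unfolding r_def by (intro mult_left_mono) auto
  finally have "r (h n) x \<le> C\<^sub>3 * \<gamma> ^ Suc n * Wr x + (\<Sum>j<n. q (Suc j) x * a (n - Suc j))"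
    by (simp add: ac_simps)
  moreover have "h (Suc n) x \<le> r (h n) x + atom x * a n"
    using h_Suc_le[of n x] by (simp add: r_def a_def)
  ultimately show ?case
    by (simp add: sum.lessThan_Suc_shift q_F_Suc(3) del: sum.lessThan_Suc)
qed

text \<open>Integrating the decomposition against \<nu> turns it into an inequality for
  \<open>a\<close> alone. The required positivity holds because \<nu> lives on \<open>B\<close>:
  regeneration in the first step has probability \<delta> there.\<close>

lemma a_convergent: "convergent a"
proof (rule renewal_inequality_convergent[where p = "\<lambda>j. \<integral>y. q j y \<partial>\<nu>" and F = "\<lambda>j. \<integral>y. F j y \<partial>\<nu>"
      and C = "max C\<^sub>3 (1 / \<epsilon>) * (\<beta> + \<alpha>)" and \<gamma> = \<gamma> and M = "C\<^sub>3 * (\<beta> + \<alpha>)"])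
  interpret N: prob_space \<nu>
    by (rule \<nu>_prob)
  have \<beta>\<alpha>: "0 \<le> \<beta> + \<alpha>"
    using \<alpha>(1) \<beta>_nonneg by simp
  show "0 \<le> (\<integral>y. q j y \<partial>\<nu>)" for j
    using q_facts[of j] by (intro integral_nonneg_AE) auto
  have "(\<integral>y. q 0 y \<partial>\<nu>) = (\<integral>y. \<delta> \<partial>\<nu>)"
    unfolding q_F_Suc
  proof (rule integral_cong_AE)
    show "AE y in \<nu>. atom y = \<delta>"
      using \<nu>_AE_B by eventually_elim (simp add: atom)
  qed (auto intro: \<nu>_measI)
  then show "0 < (\<integral>y. q 0 y \<partial>\<nu>)"
    using \<delta> by (simp add: N.prob_space)
  show "(\<integral>y. F 0 y \<partial>\<nu>) = 1"
    by (simp add: q_F_Suc N.prob_space)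
  show "(\<integral>y. F (Suc j) y \<partial>\<nu>) = (\<integral>y. F j y \<partial>\<nu>) - (\<integral>y. q j y \<partial>\<nu>)" for j
    using F_int q_int by (simp add: F_Suc_diff)
  show "0 \<le> (\<integral>y. F j y \<partial>\<nu>)" for j
    using F_facts[of j] by (intro integral_nonneg_AE) auto
  show "(\<integral>y. F j y \<partial>\<nu>) \<le> max C\<^sub>3 (1 / \<epsilon>) * (\<beta> + \<alpha>) * \<gamma> ^ j" for j
  proof -
    have "(\<integral>y. F j y \<partial>\<nu>) \<le> (\<integral>y. (1 / \<epsilon>) * \<gamma> ^ j * Wr y \<partial>\<nu>)"
      using F_int F_facts[of j] Wr_\<nu> by (intro integral_mono) auto
    also have "\<dots> = (1 / \<epsilon>) * ((\<beta> + \<alpha>) * \<gamma> ^ j)"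
      by (simp add: Wr_\<nu>(2))
    also have "\<dots> \<le> max C\<^sub>3 (1 / \<epsilon>) * ((\<beta> + \<alpha>) * \<gamma> ^ j)"
      using \<beta>\<alpha> constants(3) by (intro mult_right_mono) auto
    finally show ?thesis
      by (simp add: mult.assoc)
  qed
  show "0 < \<gamma>" "\<gamma> < 1"
    by (fact constants)+
  show "\<bar>a n\<bar> \<le> C\<^sub>3 * (\<beta> + \<alpha>)" for n
  proof -
    have "\<bar>a n\<bar> \<le> (\<integral>y. \<bar>h n y\<bar> \<partial>\<nu>)"
      unfolding a_def by (rule integral_abs_bound)
    also have "\<dots> \<le> (\<integral>y. C\<^sub>3 * Wr y \<partial>\<nu>)"
      using h_\<nu> h_le_C3 Wr_\<nu> by (intro integral_mono) auto
    finally show ?thesis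
      by (simp add: Wr_\<nu>(2))
  qed
  show "a (Suc n) \<le> (\<Sum>j\<le>n. (\<integral>y. q j y \<partial>\<nu>) * a (n - j)) + max C\<^sub>3 (1 / \<epsilon>) * (\<beta> + \<alpha>) * \<gamma> ^ n" for n
  proof -
    have "a (Suc n) \<le> (\<integral>y. C\<^sub>3 * \<gamma> ^ Suc n * Wr y + (\<Sum>j<Suc n. q j y * a (n - j)) \<partial>\<nu>)"
      unfolding a_def[of "Suc n"] using h_le_renewal[of "Suc n"] h_\<nu> Wr_\<nu> q_int
      by (intro integral_mono) (auto simp del: sum.lessThan_Suc)
    also have "\<dots> = C\<^sub>3 * \<gamma> ^ Suc n * (\<beta> + \<alpha>) + (\<Sum>j<Suc n. (\<integral>y. q j y \<partial>\<nu>) * a (n - j))"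
      using Wr_\<nu> q_int by (simp del: sum.lessThan_Suc)
    also have "C\<^sub>3 * \<gamma> ^ Suc n * (\<beta> + \<alpha>) \<le> max C\<^sub>3 (1 / \<epsilon>) * (\<beta> + \<alpha>) * \<gamma> ^ n"
    proof -
      have "C\<^sub>3 * \<gamma> ^ Suc n \<le> max C\<^sub>3 (1 / \<epsilon>) * \<gamma> ^ n"
        using C3_nonneg constants(3,4) by (intro mult_mono) (auto simp: mult_left_le_one_le)
      from mult_right_mono[OF this \<beta>\<alpha>] show ?thesis
        by (simp add: ac_simps)
    qed
    finally show ?thesis
      by (simp add: lessThan_Suc_atMost)
  qed
qed

text \<open>From time \<open>N\<close> on, each regeneration inserts a value within
  \<open>e / 2\<close> of the limit of \<open>a\<close>, while the influence of the function reached
  at time \<open>N\<close> decays geometrically. The upper estimate follows \<open>u\<close> with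
  Lyapunov function \<open>Wr\<close>, the lower one follows the selectors \<open>v n\<close> with
  \<open>L n\<close>.\<close>

lemma h_tendsto: "(\<lambda>n. h n x) \<longlonglongrightarrow> lim a"
proof (rule LIMSEQ_I)
  fix e :: real assume e: "0 < e"
  define \<kappa> where "\<kappa> = lim a"
  have "a \<longlonglongrightarrow> \<kappa>"
    using a_convergent by (simp add: convergent_LIMSEQ_iff \<kappa>_def)
  from LIMSEQ_D[OF this, of "e / 2"] e obtain N0 where "\<forall>n\<ge>N0. norm (a n - \<kappa>) < e / 2"
    by (metis half_gt_zero)
  then have N0: "\<And>n. N0 \<le> n \<Longrightarrow> \<bar>a n - \<kappa>\<bar> < e / 2"
    by simp
  \<comment> \<open>\<open>N \<ge> 1\<close> ensures that \<open>h n\<close> is integrable under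
    \<open>v n\<close> and that \<open>1 - \<rho> ^ N \<ge> \<theta>\<close>.\<close>
  define N where "N = max N0 1"
  have N: "1 \<le> N" "\<And>j. \<bar>a (N + j) - \<kappa>\<bar> < e / 2"
    by (simp add: N_def) (rule N0, simp add: N_def)
  \<comment> \<open>The target \<open>\<kappa> + e / 2\<close> may be negative; as
    \<open>Wr \<ge> \<epsilon>\<close>, the second summand times \<open>Wr\<close> outweighs its
    absolute value.\<close>
  define C4 where "C4 = C\<^sub>3 + \<bar>\<kappa> + e / 2\<bar> / \<epsilon>"
  have C4: "0 \<le> C4"
    using C3_nonneg \<epsilon>(1) by (simp add: C4_def)
  have up: "h (N + j) x \<le> \<kappa> + e / 2 + C4 * \<gamma> ^ j * Wr x" for j
  proof (rule killed_contraction[where w = "\<lambda>_. u" and g = "\<lambda>j. h (N + j)" and L = "\<lambda>_. Wr" and j = j])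
    show "(\<integral>y. h (N + j) y \<partial>\<nu>) \<le> \<kappa> + e / 2" for j
      using N(2)[of j] unfolding a_def by linarith
    show "h (N + 0) x \<le> \<kappa> + e / 2 + C4 * Wr x" for x
    proof -
      have "\<bar>\<kappa> + e / 2\<bar> / \<epsilon> * \<epsilon> \<le> \<bar>\<kappa> + e / 2\<bar> / \<epsilon> * Wr x"
        using Wr_ge \<epsilon>(1) by (intro mult_left_mono) auto
      then show ?thesis
        using h_le_C3[of N x] \<epsilon>(1) by (simp add: C4_def distrib_right)
    qed
  qed (use u(2) h_meas h_\<nu> h_u h_Suc_le Wr_\<nu> Wr_u Wr_drift C4 constants(3) in auto)
  \<comment> \<open>Fitted to \<open>L N \<ge> \<theta> * Wr + \<alpha>\<close>: the first summand
    covers the part of \<open>h N\<close> growing with \<open>Wr\<close>, the second its constants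
    and the target.\<close>
  define C5 where "C5 = (1 + C) / \<theta> + (T + b' + \<bar>- \<kappa> + e / 2\<bar>) / \<alpha>"
  have C5: "0 \<le> C5"
    using \<Phi>0(3) \<theta> T_nonneg b'_nonneg \<alpha>(1) by (simp add: C5_def)
  have lo: "- h (N + j) x \<le> - \<kappa> + e / 2 + C5 * \<gamma> ^ j * L (N + j) x" for j
  proof (rule killed_contraction[where w = "\<lambda>j. v (N + j)" and g = "\<lambda>j x. - h (N + j) x" and L = "\<lambda>j. L (N + j)" and j = j])
    interpret N: prob_space \<nu>
      by (rule \<nu>_prob)
    have neg: "(\<integral>y. - h (N + j) y \<partial>\<nu>) = - a (N + j)" for j
      by (simp add: a_def)
    show "(\<integral>y. - h (N + j) y \<partial>\<nu>) \<le> - \<kappa> + e / 2" for j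
      using N(2)[of j] neg[of j] by linarith
    show "- h (N + 0) x \<le> - \<kappa> + e / 2 + C5 * L (N + 0) x" for x
    proof -
      have "\<rho> ^ N \<le> \<rho> ^ 1"
        using N(1) \<theta> by (intro power_decreasing) auto
      then have "\<theta> * Wr x \<le> (1 - \<rho> ^ N) * Wr x"
        by (intro mult_right_mono) auto
      then have L_ge: "\<theta> * Wr x + \<alpha> \<le> L N x"
        using \<Phi>_ge[of N x] by (simp add: L_def a\<^sub>2_def)
      have "(1 + C) / \<theta> * (\<theta> * Wr x) \<le> (1 + C) / \<theta> * L N x"
        using L_ge \<alpha>(1) \<Phi>0(3) \<theta> by (intro mult_left_mono) auto
      moreover have "(T + b' + \<bar>- \<kappa> + e / 2\<bar>) / \<alpha> * \<alpha> \<le> (T + b' + \<bar>- \<kappa> + e / 2\<bar>) / \<alpha> * L N x"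
      proof (rule mult_left_mono)
        have "0 \<le> \<theta> * Wr x"
          using \<theta> by simp
        then show "\<alpha> \<le> L N x"
          using L_ge by linarith
      qed (use T_nonneg b'_nonneg \<alpha>(1) in simp)
      moreover have "- h N x \<le> (1 + C) * Wr x + (T + b')"
        using h_abs_le'[of N x] by (simp add: abs_le_iff)
      moreover have "(1 + C) / \<theta> * (\<theta> * Wr x) = (1 + C) * Wr x"
        using \<theta> by simp
      moreover have "(T + b' + \<bar>- \<kappa> + e / 2\<bar>) / \<alpha> * \<alpha> = T + b' + \<bar>- \<kappa> + e / 2\<bar>"
        using \<alpha>(1) by simp
      moreover have "C5 * L N x = (1 + C) / \<theta> * L N x + (T + b' + \<bar>- \<kappa> + e / 2\<bar>) / \<alpha> * L N x"
        unfolding C5_def by (rule distrib_right)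
      ultimately show ?thesis
        unfolding add_0_right by linarith
    qed
    show "integrable (trans D (x, v (N + j) x)) (\<lambda>x. - h (N + j) x)" for j x
      using h_v[of "N + j" x] N(1) by simp
    show "- h (N + Suc j) x \<le> (\<integral>y. - h (N + j) y \<partial>trans D (x, v (N + j) x))" for j x
      using h_Suc_ge[of "N + j" x] N(1) by simp
    show "L (N + j) \<in> borel_measurable borel" "integrable \<nu> (L (N + j))" for j
      unfolding L_def[abs_def] using \<Phi>_meas \<Phi>_\<nu> by simp_all
    show "integrable (trans D (x, v (N + j) x)) (L (N + j))" for j x
    proof -
      interpret prob_space "trans D (x, v (N + j) x)"
        by (rule trans_prob[OF gr_v])
      show ?thesis
        unfolding L_def[abs_def] using \<Phi>_v by simp
    qed
    show "(\<integral>y. L (N + j) y \<partial>trans D (x, v (N + j) x)) - atom x * (\<integral>y. L (N + j) y \<partial>\<nu>) \<le> \<gamma> * L (N + Suc j) x" for j x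
      using L_drift[where n = "N + j" and x = x] by simp
  qed (use v_acts h_meas h_\<nu> C5 constants(3) in auto)
  define Q where "Q = (C4 + C5 * C\<^sub>2) * (Wr x + 1)"
  have bound: "\<bar>h (N + j) x - \<kappa>\<bar> \<le> e / 2 + Q * \<gamma> ^ j" for j
  proof -
    have "C5 * \<gamma> ^ j * L (N + j) x \<le> C5 * \<gamma> ^ j * (C\<^sub>2 * (Wr x + 1))"
      using C5 constants(3) by (intro mult_left_mono L_le) auto
    moreover have "C4 * \<gamma> ^ j * Wr x \<le> C4 * \<gamma> ^ j * (Wr x + 1)"
      using C4 constants(3) by (intro mult_left_mono) auto
    moreover have "0 \<le> C4 * \<gamma> ^ j * (Wr x + 1)" "0 \<le> C5 * \<gamma> ^ j * (C\<^sub>2 * (Wr x + 1))"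
      using C4 C5 constants by (auto intro!: mult_nonneg_nonneg)
    moreover have "Q * \<gamma> ^ j = C4 * \<gamma> ^ j * (Wr x + 1) + C5 * \<gamma> ^ j * (C\<^sub>2 * (Wr x + 1))"
      by (simp add: Q_def algebra_simps)
    ultimately show ?thesis
      using up[of j] lo[of j] by linarith
  qed
  have "(\<lambda>j. Q * \<gamma> ^ j) \<longlonglongrightarrow> Q * 0"
    using constants by (intro tendsto_intros LIMSEQ_power_zero) auto
  then have "(\<lambda>j. Q * \<gamma> ^ j) \<longlonglongrightarrow> 0"
    by simp
  from LIMSEQ_D[OF this, of "e / 2"] e obtain J where "\<forall>j\<ge>J. norm (Q * \<gamma> ^ j - 0) < e / 2"
    by (metis half_gt_zero)
  then have J: "\<And>j. J \<le> j \<Longrightarrow> \<bar>Q * \<gamma> ^ j\<bar> < e / 2"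
    by (simp only: diff_0_right real_norm_def)
  show "\<exists>no. \<forall>n\<ge>no. norm (h n x - lim a) < e"
  proof (intro exI allI impI)
    fix n assume n: "N + J \<le> n"
    then have "n = N + (n - N)" "J \<le> n - N"
      by auto
    then show "norm (h n x - lim a) < e"
      using bound[of "n - N"] J[of "n - N"] by (simp add: \<kappa>_def)
  qed
qed

end

section \<open>Invariant measures of the minimizing selectors\<close>

context mdp_setting
begin

lemma kernel_of_dirac:
  assumes w: "w \<in> borel \<rightarrow>\<^sub>M borel" "\<And>x. w x \<in> acts D x"
  shows "kernel_of D (dirac w) x = trans D (x, w x)"
proof (rule measure_eqI)
  have k: "(x, w x) \<in> gr D"
    by (simp add: gr_iff w)
  let ?M = "restrict_space (dirac w x) (acts D x)"
  have M: "prob_space ?M"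
    using acts(2) stationaryD[OF dirac_stationary[OF w]] by (intro prob_space_restrict_space) auto
  have meas: "(\<lambda>u. trans D (x, u)) \<in> ?M \<rightarrow>\<^sub>M subprob_algebra borel"
    by (rule measurable_compose[OF Pair_meas' measurable_prob_algebraD[OF trans_meas]]) (simp add: dirac_def)
  have "sets (kernel_of D (dirac w) x) = sets borel"
    unfolding kernel_of_def
    by (rule sets_bind[OF _ prob_space.not_empty[OF M]])
      (auto simp: space_restrict_space trans_sets gr_iff)
  then show "sets (kernel_of D (dirac w) x) = sets (trans D (x, w x))"
    by (simp add: trans_sets[OF k])
  fix A assume "A \<in> sets (kernel_of D (dirac w) x)"
  then have A: "A \<in> sets borel"
    using \<open>sets (kernel_of D (dirac w) x) = sets borel\<close> by simp
  have em: "(\<lambda>k. emeasure (trans D k) A) \<in> borel_measurable (grM D)"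
    by (rule measurable_compose[OF measurable_prob_algebraD[OF trans_meas] measurable_emeasure_subprob_algebra[OF A]])
  have "emeasure (kernel_of D (dirac w) x) A = (\<integral>\<^sup>+u. emeasure (trans D (x, u)) A \<partial>?M)"
    unfolding kernel_of_def by (rule emeasure_bind[OF prob_space.not_empty[OF M] meas A])
  also have "\<dots> = (\<integral>\<^sup>+k. emeasure (trans D k) A \<partial>state_action D (dirac w x) x)"
    unfolding state_action_def
    by (rule nn_integral_distr[OF Pair_meas', symmetric]) (simp_all add: dirac_def em)
  also have "\<dots> = emeasure (trans D (x, w x)) A"
    by (rule nn_integral_state_action_dirac[OF w(2) em])
  finally show "emeasure (kernel_of D (dirac w) x) A = emeasure (trans D (x, w x)) A" .
qed

lemma cost_compact: "compact {k \<in> gr D. cost D k \<le> ennreal t}"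
  using inf_compact by (simp add: inf_compact_def)

text \<open>Dini's argument on the compact sublevel sets of the cost.\<close>

lemma trans_uniformly_small:
  assumes E: "\<And>m. E m \<in> sets borel" "decseq E" "(\<Inter>m. E m) = {}" and e: "0 < e"
  shows "\<exists>m. \<forall>k\<in>gr D. cost D k \<le> ennreal t \<longrightarrow> measure (trans D k) (E m) < e"
proof (rule ccontr)
  assume contra: "\<not> ?thesis"
  let ?K = "{k \<in> gr D. cost D k \<le> ennreal t}"
  define S where "S m = ?K \<inter> (\<lambda>k. measure (trans D k) (E m)) -` {e..}" for m
  have "continuous_on (gr D) (\<lambda>k. \<integral>y. (indicator (E m) y :: real) \<partial>trans D k)" for m
    using E(1) by (intro trans_bounded_continuous boundedI[of _ 1]) (auto split: split_indicator)
  moreover have "(\<integral>y. (indicator (E m) y :: real) \<partial>trans D k) = measure (trans D k) (E m)" if "k \<in> gr D" for k m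
    using E(1) that by (simp add: trans_sets trans_space)
  ultimately have cont: "continuous_on (gr D) (\<lambda>k. measure (trans D k) (E m))" for m
    by (simp cong: continuous_on_cong)
  have closed: "closed (S m)" for m
    unfolding S_def
    by (intro continuous_closed_preimage continuous_on_subset[OF cont] compact_imp_closed[OF cost_compact]) auto
  have "compact (S m)" for m
  proof -
    have "S m = ?K \<inter> S m"
      by (auto simp: S_def)
    then show ?thesis
      using compact_Int_closed[OF cost_compact closed] by metis
  qed
  moreover have "S m \<noteq> {}" for m
    using contra by (fastforce simp: S_def not_less)
  moreover have "decseq S"
  proof (rule decseq_SucI)
    fix m
    have mono: "measure (trans D k) (E (Suc m)) \<le> measure (trans D k) (E m)" if k: "k \<in> gr D" for k
    proof -
      interpret prob_space "trans D k"
        by (rule trans_prob[OF k])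
      show ?thesis
        using E(1,2) k by (intro finite_measure_mono) (auto simp: trans_sets decseq_Suc_iff)
    qed
    show "S (Suc m) \<subseteq> S m"
      unfolding S_def using mono by (auto intro: order_trans)
  qed
  ultimately have "(\<Inter>m. S m) \<noteq> {}"
    by (rule decseq_compact_Inter_nonempty)
  then obtain k where k: "\<And>m. k \<in> S m"
    by blast
  then have kg: "k \<in> gr D"
    by (auto simp: S_def)
  interpret prob_space "trans D k"
    by (rule trans_prob[OF kg])
  have "(\<lambda>m. measure (trans D k) (E m)) \<longlonglongrightarrow> measure (trans D k) (\<Inter>m. E m)"
    using E(1,2) kg by (intro finite_Lim_measure_decseq) (auto simp: trans_sets)
  then have "(\<lambda>m. measure (trans D k) (E m)) \<longlonglongrightarrow> 0"
    by (simp add: E(3))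
  then have "e \<le> 0"
    by (rule LIMSEQ_le_const) (use k in \<open>auto simp: S_def\<close>)
  with e show False
    by simp
qed

end

lemma (in value_iteration) invariant_integral:
  assumes "invariant_prob (kernel_of D (dirac (v n))) \<pi>" and f: "f \<in> borel_measurable borel"
  shows "(\<integral>\<^sup>+x. f x \<partial>\<pi>) = (\<integral>\<^sup>+x. (\<integral>\<^sup>+y. f y \<partial>trans D (x, v n x)) \<partial>\<pi>)"
proof -
  have "kernel_of D (dirac (v n)) = (\<lambda>x. trans D (x, v n x))"
    using kernel_of_dirac[of "v n", OF v_meas v_acts] by blast
  then have \<pi>: "\<pi> \<in> space (prob_algebra borel)" "\<pi> \<bind> (\<lambda>x. trans D (x, v n x)) = \<pi>"
    using assms(1) by (simp_all add: invariant_prob_def)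
  have "(\<lambda>x. trans D (x, v n x)) \<in> borel \<rightarrow>\<^sub>M subprob_algebra borel"
    by (rule measurable_compose[OF graph_meas[OF v_meas gr_v] measurable_prob_algebraD[OF trans_meas]])
  then have "(\<lambda>x. trans D (x, v n x)) \<in> \<pi> \<rightarrow>\<^sub>M subprob_algebra borel"
    using \<pi>(1) by (simp add: space_prob_algebra cong: measurable_cong_sets)
  from nn_integral_bind[OF f this] show ?thesis
    by (simp add: \<pi>(2))
qed

section \<open>Lyapunov bounds and costs under the invariant measures\<close>

context value_iteration
begin

text \<open>Truncating at \<open>m\<close> makes all integrals finite, so that the drift inequality can be
  integrated against an invariant measure.\<close>

lemma invariant_Wr_bound:
  assumes inv: "invariant_prob (kernel_of D (dirac (v n))) \<pi>"
    and drift: "\<And>x. (\<integral>\<^sup>+y. W y \<partial>trans D (x, v n x)) \<le> ennreal l * W x + ennreal k"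
    and l: "0 \<le> l" "l < 1" and k: "0 \<le> k"
  shows "(\<integral>\<^sup>+x. W x \<partial>\<pi>) \<le> ennreal (k / (1 - l))"
proof -
  have \<pi>: "prob_space \<pi>" "sets \<pi> = sets borel"
    using inv by (auto simp: invariant_prob_def space_prob_algebra)
  interpret prob_space \<pi>
    by (rule \<pi>)
  have [measurable]: "W \<in> borel_measurable \<pi>"
    using W_meas by (simp add: measurable_cong_sets[OF \<pi>(2) refl])
  let ?W = "\<lambda>m x. if W x \<le> of_nat m then W x else 0"
  let ?g = "\<lambda>m x. min (ennreal l * W x + ennreal k) (of_nat m)"
  have bound: "(\<integral>\<^sup>+x. ?W m x \<partial>\<pi>) \<le> ennreal (k / (1 - l))" for m :: nat
  proof -
    have "(\<integral>\<^sup>+x. min (W x) (of_nat m) \<partial>\<pi>) = (\<integral>\<^sup>+x. (\<integral>\<^sup>+y. min (W y) (of_nat m) \<partial>trans D (x, v n x)) \<partial>\<pi>)"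
      by (rule invariant_integral[OF inv]) measurable
    also have "\<dots> \<le> (\<integral>\<^sup>+x. ?g m x \<partial>\<pi>)"
    proof (rule nn_integral_mono)
      fix x
      interpret T: prob_space "trans D (x, v n x)"
        by (rule trans_prob[OF gr_v])
      have "(\<integral>\<^sup>+y. min (W y) (of_nat m) \<partial>trans D (x, v n x)) \<le> (\<integral>\<^sup>+y. W y \<partial>trans D (x, v n x))"
        by (intro nn_integral_mono) simp
      moreover have "(\<integral>\<^sup>+y. min (W y) (of_nat m) \<partial>trans D (x, v n x)) \<le> (\<integral>\<^sup>+y. of_nat m \<partial>trans D (x, v n x))"
        by (intro nn_integral_mono) simp
      ultimately show "(\<integral>\<^sup>+y. min (W y) (of_nat m) \<partial>trans D (x, v n x)) \<le> ?g m x"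
        using drift[of x] by (simp add: T.emeasure_space_1)
    qed
    finally have le: "(\<integral>\<^sup>+x. min (W x) (of_nat m) \<partial>\<pi>) \<le> (\<integral>\<^sup>+x. ?g m x \<partial>\<pi>)" .
    have "(\<integral>\<^sup>+x. ?g m x \<partial>\<pi>) \<le> (\<integral>\<^sup>+x. of_nat m \<partial>\<pi>)"
      by (intro nn_integral_mono) simp
    then have fin: "(\<integral>\<^sup>+x. ?g m x \<partial>\<pi>) < \<infinity>"
      by (simp add: emeasure_space_1 order_le_less_trans of_nat_less_top)
    \<comment> \<open>Where \<open>W\<close> is at most \<open>m\<close>, the drift bound leaves a
      share \<open>1 - l\<close> of \<open>W\<close> to spare; above \<open>m\<close> both
      truncations are at most \<open>m\<close> and nothing is claimed.\<close>
    have pw: "?g m x + ennreal (1 - l) * ?W m x \<le> min (W x) (of_nat m) + ennreal k" for x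
    proof (cases "W x \<le> of_nat m")
      case True
      have "?g m x + ennreal (1 - l) * W x \<le> (ennreal l * W x + ennreal k) + ennreal (1 - l) * W x"
        by (intro add_right_mono) simp
      also have "\<dots> = ennreal (l * Wr x + k + (1 - l) * Wr x)"
        using l k by (simp add: W_Wr ennreal_mult)
      also have "l * Wr x + k + (1 - l) * Wr x = Wr x + k"
        by (simp add: left_diff_distrib)
      also have "ennreal (Wr x + k) = W x + ennreal k"
        using k by (simp add: W_Wr)
      finally show ?thesis
        using True by (simp add: min_def)
    next
      case False
      then show ?thesis
        by (simp add: min.coboundedI2 add_increasing2)
    qed
    have "(\<integral>\<^sup>+x. ?g m x \<partial>\<pi>) + ennreal (1 - l) * (\<integral>\<^sup>+x. ?W m x \<partial>\<pi>) =
        (\<integral>\<^sup>+x. ?g m x + ennreal (1 - l) * ?W m x \<partial>\<pi>)"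
      by (simp add: nn_integral_add nn_integral_cmult)
    also have "\<dots> \<le> (\<integral>\<^sup>+x. min (W x) (of_nat m) + ennreal k \<partial>\<pi>)"
      by (intro nn_integral_mono pw)
    also have "\<dots> = (\<integral>\<^sup>+x. min (W x) (of_nat m) \<partial>\<pi>) + ennreal k"
      by (simp add: nn_integral_add emeasure_space_1)
    also have "\<dots> \<le> (\<integral>\<^sup>+x. ?g m x \<partial>\<pi>) + ennreal k"
      by (intro add_right_mono le)
    finally have *: "ennreal (1 - l) * (\<integral>\<^sup>+x. ?W m x \<partial>\<pi>) \<le> ennreal k"
      using fin by (subst (asm) ennreal_add_left_cancel_le) auto
    have "(\<integral>\<^sup>+x. ?W m x \<partial>\<pi>) = ennreal (1 / (1 - l)) * (ennreal (1 - l) * (\<integral>\<^sup>+x. ?W m x \<partial>\<pi>))"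
      using l by (simp add: mult.assoc[symmetric] ennreal_mult[symmetric])
    also have "\<dots> \<le> ennreal (1 / (1 - l)) * ennreal k"
      by (intro mult_left_mono *) simp
    also have "\<dots> = ennreal (k / (1 - l))"
      using l k by (simp add: ennreal_mult[symmetric])
    finally show ?thesis .
  qed
  have "W x = (SUP m. ?W m x)" for x
  proof (rule antisym)
    obtain m :: nat where "Wr x \<le> real m"
      using real_arch_simple by blast
    then have "W x = ?W m x"
      by (simp add: W_Wr ennreal_of_nat_eq_real_of_nat)
    also have "\<dots> \<le> (SUP m. ?W m x)"
      by (rule SUP_upper) simp
    finally show "W x \<le> (SUP m. ?W m x)" .
    show "(SUP m. ?W m x) \<le> W x"
      by (intro SUP_least) simp
  qed
  then have "(\<integral>\<^sup>+x. W x \<partial>\<pi>) = (\<integral>\<^sup>+x. (SUP m. ?W m x) \<partial>\<pi>)"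
    by simp
  also have "\<dots> = (SUP m. \<integral>\<^sup>+x. ?W m x \<partial>\<pi>)"
  proof (rule nn_integral_monotone_convergence_SUP)
    show "incseq ?W"
    proof (rule incseq_SucI, rule le_funI)
      fix m x
      have "of_nat m \<le> (of_nat (Suc m) :: ennreal)"
        by (rule of_nat_mono) simp
      then show "?W m x \<le> ?W (Suc m) x"
        by (cases "W x \<le> of_nat m") (simp_all add: order_trans[of "W x" "of_nat m"] del: of_nat_Suc)
    qed
  qed measurable
  also have "\<dots> \<le> ennreal (k / (1 - l))"
    by (intro SUP_least bound)
  finally show ?thesis .
qed

text \<open>Division by \<theta> makes up for the factor
  \<open>1 - \<rho> ^ n \<ge> \<theta>\<close> in front of the mean of \<open>W\<close>.\<close>

definition "k\<^sub>1 = (T + K + \<beta> + b') / \<theta>"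

lemma k1_nonneg: "0 \<le> k\<^sub>1"
  using T_nonneg b'_nonneg \<theta> \<beta>_nonneg by (simp add: k\<^sub>1_def)

text \<open>The mean of the iterate after one step is \<open>\<Phi> (Suc n) - c + \<beta>\<close>.
  Bounding the iterate below by \<open>(1 - \<rho> ^ n) * W\<close> on the left, and
  \<open>\<Phi> (Suc n)\<close> above and \<open>c\<close> below on the right, gives the coefficient
  \<open>1 + C * \<rho> ^ Suc n - \<theta>\<close>; divided by \<open>1 - \<rho> ^ n\<close> it
  tends to \<open>1 - \<theta>\<close>, which leaves room for
  \<open>1 - \<theta> / 2\<close>.\<close>

lemma eventually_drift:
  "\<forall>\<^sub>F n in sequentially. 1 \<le> n \<and> (\<forall>x. (\<integral>\<^sup>+y. W y \<partial>trans D (x, v n x)) \<le> ennreal (1 - \<theta> / 2) * W x + ennreal k\<^sub>1)"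
proof -
  have "(\<lambda>n. 1 + C * \<rho> ^ Suc n - \<theta>) \<longlonglongrightarrow> 1 + C * 0 - \<theta>"
    using \<theta> by (intro tendsto_intros LIMSEQ_Suc[OF LIMSEQ_power_zero]) auto
  moreover have "(\<lambda>n. (1 - \<theta> / 2) * (1 - \<rho> ^ n)) \<longlonglongrightarrow> (1 - \<theta> / 2) * (1 - 0)"
    using \<theta> by (intro tendsto_intros LIMSEQ_power_zero) auto
  ultimately have "(\<lambda>n. (1 - \<theta> / 2) * (1 - \<rho> ^ n) - (1 + C * \<rho> ^ Suc n - \<theta>)) \<longlonglongrightarrow>
      (1 - \<theta> / 2) * (1 - 0) - (1 + C * 0 - \<theta>)"
    by (rule tendsto_diff[rotated])
  moreover have "0 < (1 - \<theta> / 2) * (1 - 0) - (1 + C * 0 - \<theta>)"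
    using \<theta> by simp
  ultimately have "\<forall>\<^sub>F n in sequentially. 0 < (1 - \<theta> / 2) * (1 - \<rho> ^ n) - (1 + C * \<rho> ^ Suc n - \<theta>)"
    by (rule order_tendstoD(1))
  then show ?thesis
    using eventually_ge_at_top[of "1::nat"]
  proof eventually_elim
    case (elim n)
    have "(\<integral>\<^sup>+y. W y \<partial>trans D (x, v n x)) \<le> ennreal (1 - \<theta> / 2) * W x + ennreal k\<^sub>1" for x
    proof -
      interpret prob_space "trans D (x, v n x)"
        by (rule trans_prob[OF gr_v])
      let ?p = "1 - \<rho> ^ n" and ?w = "\<integral>y. Wr y \<partial>trans D (x, v n x)"
      have "\<rho> ^ n \<le> \<rho> ^ 1"
        using elim(2) \<theta> by (intro power_decreasing) auto
      then have p: "\<theta> \<le> ?p"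
        by simp
      have "(\<integral>y. ?p * Wr y - b' \<partial>trans D (x, v n x)) \<le> (\<integral>y. \<Phi> n y \<partial>trans D (x, v n x))"
        using Wr_v[OF elim(2)] \<Phi>_v \<Phi>_ge by (intro integral_mono) auto
      then have "?p * ?w - b' \<le> (\<integral>y. \<Phi> n y \<partial>trans D (x, v n x))"
        using Wr_v[OF elim(2), of x] by (simp add: prob_space)
      also have "\<dots> = \<Phi> (Suc n) x - cr (x, v n x) + \<beta>"
        by (simp add: \<Phi>_Suc)
      also have "\<dots> \<le> (Wr x + C * \<rho> ^ Suc n * Wr x + T) - (\<theta> * Wr x - K) + \<beta>"
        using \<Phi>_le[of "Suc n" x] cr_ge[OF gr_v cost_v, of x n] by simp
      also have "\<dots> = (1 + C * \<rho> ^ Suc n - \<theta>) * Wr x + (T + K + \<beta>)"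
        by (simp add: algebra_simps)
      also have "\<dots> \<le> ((1 - \<theta> / 2) * ?p) * Wr x + (T + K + \<beta>)"
        using elim(1) by (intro add_right_mono mult_right_mono) auto
      also have "((1 - \<theta> / 2) * ?p) * Wr x = ?p * ((1 - \<theta> / 2) * Wr x)"
        by (simp only: ac_simps)
      finally have "?p * ?w \<le> ?p * ((1 - \<theta> / 2) * Wr x) + (T + K + \<beta> + b')"
        by linarith
      also have "T + K + \<beta> + b' = \<theta> * k\<^sub>1"
        using \<theta> by (simp add: k\<^sub>1_def)
      also have "\<theta> * k\<^sub>1 \<le> ?p * k\<^sub>1"
        using p k1_nonneg by (rule mult_right_mono)
      finally have "?p * ?w \<le> ?p * ((1 - \<theta> / 2) * Wr x + k\<^sub>1)"
        by (simp add: distrib_left)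
      then have "?w \<le> (1 - \<theta> / 2) * Wr x + k\<^sub>1"
        using p \<theta>(1) by (subst (asm) mult_le_cancel_left_pos) auto
      then have "ennreal ?w \<le> ennreal ((1 - \<theta> / 2) * Wr x + k\<^sub>1)"
        by (rule ennreal_leI)
      also have "\<dots> = ennreal (1 - \<theta> / 2) * W x + ennreal k\<^sub>1"
        using \<theta> k1_nonneg by (simp add: W_Wr ennreal_mult)
      also have "ennreal ?w = (\<integral>\<^sup>+y. W y \<partial>trans D (x, v n x))"
        unfolding W_Wr using Wr_v[OF elim(2)] by (intro nn_integral_eq_integral[symmetric]) simp_all
      finally show ?thesis .
    qed
    with elim(2) show ?case
      by blast
  qed
qed

text \<open>Invariance makes the mean of \<open>\<Phi> n\<close> after one step equal to its mean
  before, so integrating the recursion gives \<beta> plus the mean increment, in which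
  \<open>W\<close> cancels. The shift by \<open>b'\<close> keeps the computation in
  \<open>ennreal\<close> until the cost is known to have a finite mean.\<close>

lemma invariant_cost:
  assumes inv: "invariant_prob (kernel_of D (dirac (v n))) \<pi>" and W: "integrable \<pi> Wr"
  shows "(\<integral>\<^sup>+x. cost D (x, v n x) \<partial>\<pi>) = ennreal (\<beta> + (\<integral>x. h (Suc n) x - h n x \<partial>\<pi>))"
    and "0 \<le> \<beta> + (\<integral>x. h (Suc n) x - h n x \<partial>\<pi>)"
proof -
  have \<pi>: "prob_space \<pi>" "sets \<pi> = sets borel"
    using inv by (auto simp: invariant_prob_def space_prob_algebra)
  interpret prob_space \<pi>
    by (rule \<pi>)
  have \<pi>_measI: "f \<in> borel_measurable borel \<Longrightarrow> f \<in> borel_measurable \<pi>" for f :: "'a \<Rightarrow> real"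
    by (simp add: measurable_cong_sets[OF \<pi>(2) refl])
  have \<Phi>_\<pi>: "integrable \<pi> (\<Phi> m)" for m
    by (rule integrable_linear_growth[OF \<pi>(1) \<pi>_measI[OF \<Phi>_meas] W \<Phi>_abs])
  have nn: "0 \<le> \<Phi> m x + b'" for m x
    using \<Phi>_ge'[of m x] by simp
  have shift: "(\<integral>\<^sup>+x. ennreal (\<Phi> m x + b') \<partial>\<pi>) = ennreal ((\<integral>x. \<Phi> m x \<partial>\<pi>) + b')" for m
    using \<Phi>_\<pi>[of m] nn by (subst nn_integral_eq_integral) (auto simp: prob_space)
  have eq: "cost D (x, v n x) + (\<integral>\<^sup>+y. ennreal (\<Phi> n y + b') \<partial>trans D (x, v n x)) =
      ennreal (\<Phi> (Suc n) x + b') + ennreal \<beta>" for x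
  proof -
    interpret T: prob_space "trans D (x, v n x)"
      by (rule trans_prob[OF gr_v])
    have i: "(\<integral>\<^sup>+y. ennreal (\<Phi> n y + b') \<partial>trans D (x, v n x)) = ennreal ((\<integral>y. \<Phi> n y \<partial>trans D (x, v n x)) + b')"
      using \<Phi>_v[of x n] nn by (subst nn_integral_eq_integral) (auto simp: T.prob_space)
    have "0 \<le> (\<integral>y. \<Phi> n y + b' \<partial>trans D (x, v n x))"
      using nn by (intro integral_nonneg_AE) simp
    then have "0 \<le> (\<integral>y. \<Phi> n y \<partial>trans D (x, v n x)) + b'"
      using \<Phi>_v[of x n] by (simp add: T.prob_space)
    moreover have "cost D (x, v n x) = ennreal (cr (x, v n x))"
      using cost_v by (simp add: cr_def)
    ultimately show ?thesis
      using nn[of "Suc n" x] \<beta>_nonneg unfolding i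
      by (simp add: \<Phi>_Suc[of n x] ennreal_plus[symmetric] del: ennreal_plus)
  qed
  have g: "(\<lambda>x. (x, v n x)) \<in> \<pi> \<rightarrow>\<^sub>M grM D"
    using graph_meas[OF v_meas gr_v] by (simp add: measurable_cong_sets[OF \<pi>(2) refl])
  have meas: "(\<lambda>y. ennreal (\<Phi> n y + b')) \<in> borel_measurable borel"
    using \<Phi>_meas by measurable
  have [measurable]: "(\<lambda>x. cost D (x, v n x)) \<in> borel_measurable \<pi>"
    "(\<lambda>x. \<integral>\<^sup>+y. ennreal (\<Phi> n y + b') \<partial>trans D (x, v n x)) \<in> borel_measurable \<pi>"
    "\<Phi> (Suc n) \<in> borel_measurable \<pi>"
    using measurable_compose[OF g cost_meas] measurable_compose[OF g nn_integral_trans_meas[OF meas]]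
      \<pi>_measI[OF \<Phi>_meas] by simp_all
  have "(\<integral>\<^sup>+x. cost D (x, v n x) \<partial>\<pi>) + ennreal ((\<integral>x. \<Phi> n x \<partial>\<pi>) + b') =
      (\<integral>\<^sup>+x. cost D (x, v n x) \<partial>\<pi>) + (\<integral>\<^sup>+x. (\<integral>\<^sup>+y. ennreal (\<Phi> n y + b') \<partial>trans D (x, v n x)) \<partial>\<pi>)"
    using invariant_integral[OF inv meas] shift[of n] by simp
  also have "\<dots> = (\<integral>\<^sup>+x. cost D (x, v n x) + (\<integral>\<^sup>+y. ennreal (\<Phi> n y + b') \<partial>trans D (x, v n x)) \<partial>\<pi>)"
    by (simp add: nn_integral_add)
  also have "\<dots> = (\<integral>\<^sup>+x. ennreal (\<Phi> (Suc n) x + b') + ennreal \<beta> \<partial>\<pi>)"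
    by (simp only: eq)
  also have "\<dots> = ennreal ((\<integral>x. \<Phi> (Suc n) x \<partial>\<pi>) + b') + ennreal \<beta>"
    using shift[of "Suc n"] by (simp add: nn_integral_add emeasure_space_1)
  finally have main: "(\<integral>\<^sup>+x. cost D (x, v n x) \<partial>\<pi>) + ennreal ((\<integral>x. \<Phi> n x \<partial>\<pi>) + b') =
      ennreal ((\<integral>x. \<Phi> (Suc n) x \<partial>\<pi>) + b') + ennreal \<beta>" .
  then have "(\<integral>\<^sup>+x. cost D (x, v n x) \<partial>\<pi>) < \<infinity>"
    by (metis ennreal_add_eq_top ennreal_neq_top infinity_ennreal_def less_top)
  then obtain c where c: "(\<integral>\<^sup>+x. cost D (x, v n x) \<partial>\<pi>) = ennreal c" "0 \<le> c"
    by (cases "\<integral>\<^sup>+x. cost D (x, v n x) \<partial>\<pi>") auto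
  have pos: "0 \<le> (\<integral>x. \<Phi> m x \<partial>\<pi>) + b'" for m
  proof -
    have "0 \<le> (\<integral>x. \<Phi> m x + b' \<partial>\<pi>)"
      using nn by (intro integral_nonneg_AE) simp
    then show ?thesis
      using \<Phi>_\<pi>[of m] by (simp add: prob_space)
  qed
  have "c + ((\<integral>x. \<Phi> n x \<partial>\<pi>) + b') = (\<integral>x. \<Phi> (Suc n) x \<partial>\<pi>) + b' + \<beta>"
    using main c pos[of n] pos[of "Suc n"] \<beta>_nonneg
    by (simp add: ennreal_plus[symmetric] del: ennreal_plus)
  moreover have "(\<integral>x. h (Suc n) x - h n x \<partial>\<pi>) = (\<integral>x. \<Phi> (Suc n) x \<partial>\<pi>) - (\<integral>x. \<Phi> n x \<partial>\<pi>)"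
    using \<Phi>_\<pi> by (simp add: h_def)
  ultimately have "c = \<beta> + (\<integral>x. h (Suc n) x - h n x \<partial>\<pi>)"
    by linarith
  with c show "(\<integral>\<^sup>+x. cost D (x, v n x) \<partial>\<pi>) = ennreal (\<beta> + (\<integral>x. h (Suc n) x - h n x \<partial>\<pi>))"
    and "0 \<le> \<beta> + (\<integral>x. h (Suc n) x - h n x \<partial>\<pi>)"
    by simp_all
qed

section \<open>Convergence of the stationary costs\<close>

definition "M\<^sub>W = k\<^sub>1 / (\<theta> / 2)"

lemma MW_nonneg: "0 \<le> M\<^sub>W"
  using k1_nonneg \<theta> by (simp add: M\<^sub>W_def)

definition "A\<^sub>1 = 2 * (1 + C)"
definition "A\<^sub>2 = 2 * (T + b')"

lemma A_nonneg: "0 \<le> A\<^sub>1" "0 \<le> A\<^sub>2"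
  using \<Phi>0(3) T_nonneg b'_nonneg by (simp_all add: A\<^sub>1_def A\<^sub>2_def)

lemma h_diff_le: "\<bar>h (Suc n) x - h n x\<bar> \<le> A\<^sub>1 * \<rho> ^ n * Wr x + A\<^sub>2"
proof -
  define X where "X m = (1 + C) * \<rho> ^ m * Wr x" for m
  have "X (Suc n) \<le> X n"
    unfolding X_def using \<Phi>0(3) \<theta> by (intro mult_right_mono mult_left_mono power_decreasing) auto
  have h_X: "\<bar>h m x\<bar> \<le> X m + (T + b')" for m
    unfolding X_def by (rule h_abs_le)
  have "\<bar>h (Suc n) x - h n x\<bar> \<le> (X (Suc n) + (T + b')) + (X n + (T + b'))"
    by (intro order_trans[OF abs_triangle_ineq4] add_mono h_X)
  also have "\<dots> \<le> (X n + (T + b')) + (X n + (T + b'))"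
    by (intro add_right_mono) fact
  also have "\<dots> = A\<^sub>1 * \<rho> ^ n * Wr x + A\<^sub>2"
    by (simp add: A\<^sub>1_def A\<^sub>2_def X_def algebra_simps)
  finally show ?thesis .
qed

lemma invariant_cost_tendsto:
  assumes inv: "\<And>n. N0 \<le> n \<Longrightarrow> invariant_prob (kernel_of D (dirac (v n))) (\<pi> n)"
  shows "(\<lambda>n. \<integral>\<^sup>+x. cost D (x, v n x) \<partial>\<pi> n) \<longlonglongrightarrow> beta D"
proof -
  define d where "d n = (\<integral>x. h (Suc n) x - h n x \<partial>\<pi> n)" for n
  obtain N1 where N1: "\<And>n. N1 \<le> n \<Longrightarrow> 1 \<le> n"
    "\<And>n x. N1 \<le> n \<Longrightarrow> (\<integral>\<^sup>+y. W y \<partial>trans D (x, v n x)) \<le> ennreal (1 - \<theta> / 2) * W x + ennreal k\<^sub>1"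
    using eventually_drift unfolding eventually_sequentially by blast
  define N where "N = max N0 N1"
  have \<pi>: "prob_space (\<pi> n)" "sets (\<pi> n) = sets borel" if "N \<le> n" for n
    using inv[of n] that by (auto simp: N_def invariant_prob_def space_prob_algebra)
  have \<pi>_measI: "f \<in> borel_measurable (\<pi> n)" if "N \<le> n" "f \<in> borel_measurable borel" for n and f :: "'a \<Rightarrow> real"
    using that by (simp add: measurable_cong_sets[OF \<pi>(2) refl])
  have W_\<pi>: "integrable (\<pi> n) Wr" "(\<integral>x. Wr x \<partial>\<pi> n) \<le> M\<^sub>W" if n: "N \<le> n" for n
  proof -
    have "(\<integral>\<^sup>+x. W x \<partial>\<pi> n) \<le> ennreal (k\<^sub>1 / (1 - (1 - \<theta> / 2)))"
    proof (rule invariant_Wr_bound)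
      show "invariant_prob (kernel_of D (dirac (v n))) (\<pi> n)"
        using n by (intro inv) (simp add: N_def)
      show "(\<integral>\<^sup>+y. W y \<partial>trans D (x, v n x)) \<le> ennreal (1 - \<theta> / 2) * W x + ennreal k\<^sub>1" for x
        using n by (intro N1) (simp add: N_def)
    qed (use \<theta> k1_nonneg in auto)
    then have le: "(\<integral>\<^sup>+x. ennreal (Wr x) \<partial>\<pi> n) \<le> ennreal M\<^sub>W"
      by (simp add: W_Wr[symmetric] M\<^sub>W_def)
    show int: "integrable (\<pi> n) Wr"
      using le by (intro integrableI_nonneg \<pi>_measI n Wr_meas) (auto intro: order_le_less_trans)
    have "ennreal (\<integral>x. Wr x \<partial>\<pi> n) \<le> ennreal M\<^sub>W"
      using le by (simp add: nn_integral_eq_integral[OF int])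
    then show "(\<integral>x. Wr x \<partial>\<pi> n) \<le> M\<^sub>W"
      using MW_nonneg by (subst (asm) ennreal_le_iff) auto
  qed
  have cost: "(\<integral>\<^sup>+x. cost D (x, v n x) \<partial>\<pi> n) = ennreal (\<beta> + d n)" if "N \<le> n" for n
    unfolding d_def using that by (intro invariant_cost inv W_\<pi>) (auto simp: N_def)
  have D_int: "integrable (\<pi> n) (\<lambda>x. \<bar>h (Suc n) x - h n x\<bar>)" if n: "N \<le> n" for n
  proof -
    have "(\<lambda>x. \<bar>h (Suc n) x - h n x\<bar>) \<in> borel_measurable borel"
      by measurable
    then show ?thesis
      using h_diff_le
      by (intro integrable_linear_growth[OF \<pi>(1)[OF n] \<pi>_measI[OF n] W_\<pi>(1)[OF n], of _ "A\<^sub>1 * \<rho> ^ n" "A\<^sub>2"]) auto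
  qed
  have d_le: "\<bar>d n\<bar> \<le> (\<integral>x. \<bar>h (Suc n) x - h n x\<bar> \<partial>\<pi> n)" for n
    unfolding d_def by (rule integral_abs_bound)
  have Wint: "A\<^sub>1 * \<rho> ^ n * (\<integral>x. Wr x \<partial>\<pi> n) \<le> A\<^sub>1 * \<rho> ^ n * M\<^sub>W" if "N \<le> n" for n
    using A_nonneg(1) \<rho>_power by (intro mult_left_mono W_\<pi>(2) that) auto
  \<comment> \<open>A bound on the stationary costs \<open>\<beta> + d n\<close> that is uniform in
    \<open>n\<close>, to be used in Markov's inequality.\<close>
  define M where "M = \<beta> + A\<^sub>1 * M\<^sub>W + A\<^sub>2 + 1"
  have M: "0 < M"
    using \<beta>_nonneg A_nonneg MW_nonneg by (simp add: M_def add_nonneg_pos)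
  have d_M: "\<beta> + d n \<le> M" if n: "N \<le> n" for n
  proof -
    interpret prob_space "\<pi> n"
      by (rule \<pi>(1)[OF n])
    have "(\<integral>x. \<bar>h (Suc n) x - h n x\<bar> \<partial>\<pi> n) \<le> (\<integral>x. A\<^sub>1 * \<rho> ^ n * Wr x + A\<^sub>2 \<partial>\<pi> n)"
      using D_int[OF n] W_\<pi>[OF n] by (intro integral_mono h_diff_le) auto
    also have "\<dots> = A\<^sub>1 * \<rho> ^ n * (\<integral>x. Wr x \<partial>\<pi> n) + A\<^sub>2"
      using W_\<pi>[OF n] by (simp add: prob_space)
    also have "\<dots> \<le> A\<^sub>1 * \<rho> ^ n * M\<^sub>W + A\<^sub>2"
      using Wint[OF n] by simp
    also have "A\<^sub>1 * \<rho> ^ n * M\<^sub>W \<le> A\<^sub>1 * 1 * M\<^sub>W"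
      using A_nonneg(1) MW_nonneg \<rho>_power by (intro mult_right_mono mult_left_mono) auto
    finally show ?thesis
      using d_le[of n] by (simp add: M_def)
  qed
  have "d \<longlonglongrightarrow> 0"
  proof (rule LIMSEQ_I)
    fix s :: real assume s: "0 < s"
    \<comment> \<open>The three error terms below are \<open>e\<close>,
      \<open>A\<^sub>2 * (2 * e)\<close> and eventually less than \<open>e\<close>; together they
      stay below \<open>c * e = s / 2\<close>.\<close>
    define c where "c = 2 + 2 * A\<^sub>2"
    define e where "e = s / 2 / c"
    have "0 < c"
      using A_nonneg(2) unfolding c_def by linarith
    then have e: "0 < e" "c * e < s"
      using s by (simp_all add: e_def)
    \<comment> \<open>Collecting all later indices makes the sets decrease, and pointwise
      convergence of \<open>h\<close> empties their intersection. A single \<open>m\<close> can then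
      serve every \<open>n \<ge> m\<close>, although the measures change.\<close>
    define E where "E m = (\<Union>j\<in>{m..}. {x. e < \<bar>h (Suc j) x - h j x\<bar>})" for m
    have E_sets: "E m \<in> sets borel" for m
    proof -
      have "{x \<in> space borel. e < \<bar>h (Suc j) x - h j x\<bar>} \<in> sets borel" for j
        by measurable
      then show ?thesis
        unfolding E_def by (intro sets.countable_UN') auto
    qed
    have E_dec: "decseq E"
      unfolding E_def by (intro antimonoI UN_mono) auto
    have E_empty: "(\<Inter>m. E m) = {}"
    proof -
      have "x \<notin> (\<Inter>m. E m)" for x
      proof -
        have "(\<lambda>n. \<bar>h (Suc n) x - h n x\<bar>) \<longlonglongrightarrow> \<bar>lim a - lim a\<bar>"
          by (intro tendsto_intros LIMSEQ_Suc[OF h_tendsto] h_tendsto)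
        then have "(\<lambda>n. \<bar>h (Suc n) x - h n x\<bar>) \<longlonglongrightarrow> 0"
          by simp
        from order_tendstoD(2)[OF this e(1)] obtain m where "\<And>j. m \<le> j \<Longrightarrow> \<bar>h (Suc j) x - h j x\<bar> < e"
          by (auto simp: eventually_sequentially)
        then have "x \<notin> E m"
          by (force simp: E_def)
        then show ?thesis
          by blast
      qed
      then show ?thesis
        by blast
    qed
    obtain m where m: "\<And>k. k \<in> gr D \<Longrightarrow> cost D k \<le> ennreal (M / e) \<Longrightarrow> measure (trans D k) (E m) < e"
      using trans_uniformly_small[OF E_sets E_dec E_empty e(1), of "M / e"] by blast
    \<comment> \<open>By invariance the mass of \<open>E m\<close> is the mean of its one-step
      probability. Where the cost is at most \<open>M / e\<close> this is below \<open>e\<close>;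
      elsewhere 1 is at most \<open>e / M\<close> times the cost, whose mean is at most
      \<open>M\<close>.\<close>
    have \<pi>E: "measure (\<pi> n) (E m) \<le> 2 * e" if n: "N \<le> n" for n
    proof -
      interpret prob_space "\<pi> n"
        by (rule \<pi>(1)[OF n])
      have g: "(\<lambda>x. (x, v n x)) \<in> \<pi> n \<rightarrow>\<^sub>M grM D"
        using graph_meas[OF v_meas gr_v] by (simp add: measurable_cong_sets[OF \<pi>(2)[OF n] refl])
      have [measurable]: "(\<lambda>x. cost D (x, v n x)) \<in> borel_measurable (\<pi> n)"
        by (rule measurable_compose[OF g cost_meas])
      have pw: "emeasure (trans D (x, v n x)) (E m) \<le> ennreal e + ennreal (e / M) * cost D (x, v n x)" for x
      proof -
        interpret T: prob_space "trans D (x, v n x)"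
          by (rule trans_prob[OF gr_v])
        show ?thesis
        proof (cases "cost D (x, v n x) \<le> ennreal (M / e)")
          case True
          then have "emeasure (trans D (x, v n x)) (E m) \<le> ennreal e"
            using m[OF gr_v, of x n] unfolding T.emeasure_eq_measure by (intro ennreal_leI less_imp_le)
          then show ?thesis
            by (rule order_trans) simp
        next
          case False
          have "emeasure (trans D (x, v n x)) (E m) \<le> 1"
            by (rule T.measure_le_1)
          also have "1 = ennreal (e / M) * ennreal (M / e)"
            using e(1) M by (simp add: ennreal_mult[symmetric])
          also have "\<dots> \<le> ennreal (e / M) * cost D (x, v n x)"
            using False by (intro mult_left_mono) auto
          finally show ?thesis
            by (rule order_trans) simp
        qed
      qed
      have "emeasure (\<pi> n) (E m) = (\<integral>\<^sup>+x. indicator (E m) x \<partial>\<pi> n)"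
        using E_sets \<pi>(2)[OF n] by simp
      also have "\<dots> = (\<integral>\<^sup>+x. (\<integral>\<^sup>+y. indicator (E m) y \<partial>trans D (x, v n x)) \<partial>\<pi> n)"
        using n E_sets by (intro invariant_integral inv) (auto simp: N_def)
      also have "\<dots> = (\<integral>\<^sup>+x. emeasure (trans D (x, v n x)) (E m) \<partial>\<pi> n)"
        using E_sets by (intro nn_integral_cong nn_integral_indicator) (simp add: trans_sets[OF gr_v])
      also have "\<dots> \<le> (\<integral>\<^sup>+x. ennreal e + ennreal (e / M) * cost D (x, v n x) \<partial>\<pi> n)"
        by (intro nn_integral_mono pw)
      also have "\<dots> = ennreal e + ennreal (e / M) * ennreal (\<beta> + d n)"
        using cost[OF n] by (simp add: nn_integral_add nn_integral_cmult emeasure_space_1)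
      also have "\<dots> \<le> ennreal e + ennreal (e / M) * ennreal M"
        by (intro add_left_mono mult_left_mono ennreal_leI d_M[OF n]) simp
      also have "\<dots> = ennreal (2 * e)"
        using e(1) M by (simp add: ennreal_mult[symmetric] ennreal_plus[symmetric] del: ennreal_plus)
      finally show ?thesis
        using e(1) by (simp add: emeasure_eq_measure)
    qed
    have main: "\<bar>d n\<bar> \<le> e + A\<^sub>2 * (2 * e) + A\<^sub>1 * \<rho> ^ n * M\<^sub>W" if n: "max N m \<le> n" for n
    proof -
      have nN: "N \<le> n" and nm: "m \<le> n"
        using n by auto
      interpret prob_space "\<pi> n"
        by (rule \<pi>(1)[OF nN])
      have E\<pi>: "E m \<in> sets (\<pi> n)"
        using E_sets \<pi>(2)[OF nN] by simp
      \<comment> \<open>On \<open>E m\<close> only the crude bound on the increment is available,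
        but its constant is paid for by the small mass of \<open>E m\<close> and its growing part by
        the factor \<open>\<rho> ^ n\<close>.\<close>
      have pw: "\<bar>h (Suc n) x - h n x\<bar> \<le> e + A\<^sub>2 * indicator (E m) x + A\<^sub>1 * \<rho> ^ n * Wr x" for x
      proof (cases "x \<in> E m")
        case True
        then show ?thesis
          using h_diff_le[of n x] e(1) by simp
      next
        case False
        then have "\<bar>h (Suc n) x - h n x\<bar> \<le> e"
          using nm by (auto simp: E_def not_less)
        moreover have "0 \<le> A\<^sub>1 * \<rho> ^ n * Wr x"
          using A_nonneg(1) \<rho>_power by simp
        ultimately show ?thesis
          using False by simp
      qed
      have ind: "integrable (\<pi> n) (indicator (E m) :: 'a \<Rightarrow> real)"
        using E\<pi> by (intro integrable_real_indicator) (simp_all add: less_top[symmetric])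
      have "(\<integral>x. \<bar>h (Suc n) x - h n x\<bar> \<partial>\<pi> n) \<le> (\<integral>x. e + A\<^sub>2 * indicator (E m) x + A\<^sub>1 * \<rho> ^ n * Wr x \<partial>\<pi> n)"
        using D_int[OF nN] W_\<pi>[OF nN] ind by (intro integral_mono pw) auto
      also have "\<dots> = e + A\<^sub>2 * measure (\<pi> n) (E m) + A\<^sub>1 * \<rho> ^ n * (\<integral>x. Wr x \<partial>\<pi> n)"
        using W_\<pi>[OF nN] ind E\<pi> by (simp add: prob_space)
      also have "\<dots> \<le> e + A\<^sub>2 * (2 * e) + A\<^sub>1 * \<rho> ^ n * M\<^sub>W"
        using mult_left_mono[OF \<pi>E[OF nN] A_nonneg(2)] Wint[OF nN] by (intro add_mono) auto
      finally show ?thesis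
        using d_le[of n] by linarith
    qed
    have "(\<lambda>n. A\<^sub>1 * \<rho> ^ n * M\<^sub>W) \<longlonglongrightarrow> A\<^sub>1 * 0 * M\<^sub>W"
      using \<theta> by (intro tendsto_intros LIMSEQ_power_zero) auto
    then have "(\<lambda>n. A\<^sub>1 * \<rho> ^ n * M\<^sub>W) \<longlonglongrightarrow> 0"
      by simp
    from order_tendstoD(2)[OF this e(1)] obtain N2 where N2: "\<And>n. N2 \<le> n \<Longrightarrow> A\<^sub>1 * \<rho> ^ n * M\<^sub>W < e"
      by (auto simp: eventually_sequentially)
    show "\<exists>no. \<forall>n\<ge>no. norm (d n - 0) < s"
    proof (intro exI allI impI)
      fix n assume "max N2 (max N m) \<le> n"
      then have "\<bar>d n\<bar> \<le> e + A\<^sub>2 * (2 * e) + A\<^sub>1 * \<rho> ^ n * M\<^sub>W" "A\<^sub>1 * \<rho> ^ n * M\<^sub>W < e"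
        using main N2 by auto
      then have "\<bar>d n\<bar> < e + A\<^sub>2 * (2 * e) + e"
        by linarith
      also have "e + A\<^sub>2 * (2 * e) + e = c * e"
        by (simp add: c_def algebra_simps)
      finally show "norm (d n - 0) < s"
        using e(2) by simp
    qed
  qed
  then have "(\<lambda>n. ennreal (\<beta> + d n)) \<longlonglongrightarrow> ennreal (\<beta> + 0)"
    by (intro tendsto_intros)
  moreover have "\<forall>\<^sub>F n in sequentially. ennreal (\<beta> + d n) = (\<integral>\<^sup>+x. cost D (x, v n x) \<partial>\<pi> n)"
    using cost unfolding eventually_sequentially by metis
  ultimately show ?thesis
    unfolding beta_eq by (simp add: Lim_transform_eventually)
qed

end

theorem theorem6p4:
  fixes D :: "('x::polish_space, 'u::polish_space) mdp"
    and B :: "'x set" and \<nu> :: "'x measure" and \<delta> :: real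
    and \<Phi>0 :: "'x \<Rightarrow> real" and v :: "nat \<Rightarrow> 'x \<Rightarrow> 'u" and N0 :: nat
    and \<psi> :: "'x measure" and \<pi> :: "nat \<Rightarrow> 'x measure"
  assumes "is_mdp D" and "basic_assms D"
    and "A0 D B \<nu> \<delta>"
    and "A1 TYPE('xs::polish_space) TYPE('us::polish_space) D"
    and "A2 D B \<nu> \<delta>"
    and "H2 D B \<nu> \<delta>"
    and "\<Phi>0 \<in> lsc_bdd_below \<inter> weighted_class (V_star D B \<nu> \<delta>)"
    and "\<And>n. minimizing_selector D (value_iter D \<Phi>0 n) (v n)"
    and "\<And>n. n \<ge> N0 \<Longrightarrow> stabilizing D (dirac (v n))"
    and "inf_compact D"
    and "\<psi> \<in> space (prob_algebra borel)"
    and "\<And>n. n \<ge> N0 \<Longrightarrow> positive_harris (kernel_of D (dirac (v n)))"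
    and "\<And>n. n \<ge> N0 \<Longrightarrow> invariant_prob (kernel_of D (dirac (v n))) (\<pi> n)"
    and "\<And>n. n \<ge> N0 \<Longrightarrow> absolutely_continuous \<psi> (\<pi> n)"
  shows "(\<lambda>n. \<integral>\<^sup>+x. cost D (x, v n x) \<partial>\<pi> n) \<longlonglongrightarrow> beta D"
proof -
  have less: "beta D < (INF k\<in>{k \<in> gr D. fst k \<notin> B}. cost D k)"
    using assms(3) by (simp add: A0_def)
  \<comment> \<open>The infimum of the cost off \<open>B\<close> may be infinite, so the margin is
    read off from a point strictly between it and \<open>beta D\<close>, which is finite.\<close>
  obtain \<epsilon> where \<epsilon>: "0 < \<epsilon>" "beta D + ennreal \<epsilon> < (INF k\<in>{k \<in> gr D. fst k \<notin> B}. cost D k)"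
  proof -
    obtain c where c: "beta D < c" "c < (INF k\<in>{k \<in> gr D. fst k \<notin> B}. cost D k)"
      using less dense by blast
    then have fin: "c < \<top>" "beta D < \<top>"
      using less_le_trans[OF c(2) top_greatest] by (auto intro: less_trans)
    define \<epsilon> where "\<epsilon> = enn2real (c - beta D)"
    have "ennreal \<epsilon> = c - beta D"
      using fin by (simp add: \<epsilon>_def diff_less_top_ennreal)
    then have "beta D + ennreal \<epsilon> = c"
      using c(1) by (simp add: add_diff_inverse_ennreal less_imp_le)
    moreover have "0 < \<epsilon>"
      using c(1) fin by (auto simp: \<epsilon>_def enn2real_positive_iff diff_gr0_ennreal diff_less_top_ennreal)
    ultimately show thesis
      using c(2) that by blast
  qed
  interpret M: mdp_setting D B \<nu> \<delta> \<epsilon>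
  proof
    show "beta D + ennreal \<epsilon> \<le> cost D k" if "k \<in> gr D" "fst k \<notin> B" for k
      using that \<epsilon>(2) by (intro order_trans[OF less_imp_le[OF \<epsilon>(2)]] INF_lower) simp
  qed (fact assms \<epsilon>(1))+
  obtain b C where bC: "0 \<le> b" "0 \<le> C" "\<And>x. - b \<le> \<Phi>0 x" "\<And>x. \<Phi>0 x \<le> C * M.Wr x + C"
    using M.weighted_class_bounds[OF assms(7)] by blast
  obtain u where u: "u \<in> borel \<rightarrow>\<^sub>M borel" "\<And>x. u x \<in> acts D x"
    "\<And>x. M.W x = M.cost' (x, u x) + (\<integral>\<^sup>+y. M.W y \<partial>M.killed (x, u x))"
    by (rule M.W_selector) (rule that)
  obtain \<theta> K where \<theta>: "0 < \<theta>" "\<theta> < 1" "0 \<le> K"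
    "\<And>k. k \<in> gr D \<Longrightarrow> ennreal \<theta> * M.W (fst k) \<le> cost D k + ennreal K"
    using M.cost_W_bound by blast
  interpret value_iteration D B \<nu> \<delta> \<epsilon> \<Phi>0 v u \<theta> K b C
  proof
    show "\<Phi>0 \<in> borel_measurable borel"
      using assms(7) by (simp add: weighted_class_def)
  qed (fact bC u \<theta> assms)+
  show ?thesis
    using assms(13) by (rule invariant_cost_tendsto)
qed

end
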